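(* Let $0<p<1$ and let $F$ be a fixed simple graph with $k=v(F)$ nodes, $e(F)$ edges, $s(F)$ 2-stars and $t(F)$ triangles. Let $T_F^{\mathrm{ind}}$ be the induced subgraph count of $F$ in the $\kappa$-random graph $\mathbb G(n,\kappa)$ with $\kappa\equiv p$, $n\ge k$. Consider the conditions (G1) $e(F)\neq p\binom{v(F)}2$; (G2) $e(F)=p\binom{v(F)}2$ and $s(F)\ne 3p^2\binom{v(F)}3$; (G3) $e(F)=p\binom{v(F)}2$, $s(F)=3p^2\binom{v(F)}3$ and $t(F)\ne p^3\binom{v(F)}3$. If (G1) or (G3) holds, then there is a constant $C>0$ not depending on $n$ such that $$\sup_{z\in\mathbb R}\left|\mathbb P\left[\frac{T_F^{\mathrm{ind}}-\mathbb E\{T_F^{\mathrm{ind}}\}}{(\operatorname{Var}\{T_F^{\mathrm{ind}}\})^{1/2}}\le z\right]-\Phi(z)\right|\le Cn^{-1}.$$ If (G2) holds, then there is a constant $C>0$ not depending on $n$ such that $$\sup_{z\in\mathbb R}\left|\mathbb P\left[\frac{T_F^{\mathrm{ind}}-\mathbb E\{T_F^{\mathrm{ind}}\}}{(\operatorname{Var}\{T_F^{\mathrm{ind}}\})^{1/2}}\le z\right]-\Phi(z)\right|\le Cn^{-1/2}.$$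
   Context: For $\kappa\equiv p$, the edge indicators $\xi_{i,j}=\xi_{j,i}$, $1\le i<j\le n$, of $\mathbb G(n,\kappa)$ are i.i.d. Bernoulli($p$). Define $$T_F^{\mathrm{ind}}=\sum_{1\le\alpha(1)<\dots<\alpha(k)\le n}\ \sum_{H:H\cong F}\ \prod_{(i,j)\in E(H)}\xi_{\alpha(i),\alpha(j)}\prod_{(i,j)\notin E(H)}(1-\xi_{\alpha(i),\alpha(j)}),$$ where $H$ ranges over the $k!/|\mathrm{Aut}(F)|$ graphs on node set $\{1,\dots,k\}$ isomorphic to $F$ and products are over pairs $i<j$ in $\{1,\dots,k\}$. A 2-star is a path with two edges on three nodes; $s(F)$ and $t(F)$ count (not necessarily induced) subgraphs of $F$. $\Phi$ is the standard normal distribution function. The constants may depend on $F$ and $p$. *)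

theory Defs
  imports "HOL-Probability.Probability" "HOL-Library.Ramsey"
begin

text \<open>A finite simple graph is a vertex set together with a set of two-element subsets of it.\<close>

definition simple_graph :: "'a set \<Rightarrow> 'a set set \<Rightarrow> bool" where
  "simple_graph V E \<longleftrightarrow> finite V \<and> E \<subseteq> nsets V 2"

definition graph_isomorphic :: "'a set \<Rightarrow> 'a set set \<Rightarrow> 'b set \<Rightarrow> 'b set set \<Rightarrow> bool" where
  "graph_isomorphic V E W D \<longleftrightarrow> (\<exists>f. bij_betw f V W \<and> D = (\<lambda>e. f ` e) ` E)"

text \<open>The number of (not necessarily induced) subgraphs of \<open>(V, E)\<close> isomorphic to \<open>(W, D)\<close>.\<close>

definition subgraph_count :: "'a set \<Rightarrow> 'a set set \<Rightarrow> 'b set \<Rightarrow> 'b set set \<Rightarrow> nat" where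
  "subgraph_count V E W D =
     card {(V', E'). V' \<subseteq> V \<and> E' \<subseteq> E \<and> simple_graph V' E' \<and> graph_isomorphic W D V' E'}"

definition two_star_count :: "'a set \<Rightarrow> 'a set set \<Rightarrow> nat" where
  "two_star_count V E = subgraph_count V E {1, 2, 3 :: nat} {{1, 2}, {2, 3}}"

definition triangle_count :: "'a set \<Rightarrow> 'a set set \<Rightarrow> nat" where
  "triangle_count V E = subgraph_count V E {1, 2, 3 :: nat} {{1, 2}, {2, 3}, {1, 3}}"

text \<open>
  The law of the edge indicators of the random graph on \<open>{1..n}\<close> with constant kernel \<open>p\<close>.
  Indicators are indexed by unordered pairs, so that \<open>\<xi>\<^sub>i\<^sub>j = \<xi>\<^sub>j\<^sub>i\<close> is built in; \<open>\<omega> e\<close> says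
  whether the edge \<open>e\<close> is present.
\<close>

definition random_graph :: "nat \<Rightarrow> real \<Rightarrow> (nat set \<Rightarrow> bool) pmf" where
  "random_graph n p = Pi_pmf (nsets {1..n} 2) False (\<lambda>_. bernoulli_pmf p)"

definition edge_indicator :: "(nat set \<Rightarrow> bool) \<Rightarrow> nat \<Rightarrow> nat \<Rightarrow> real" where
  "edge_indicator \<omega> i j = of_bool (\<omega> {i, j})"

definition increasing_indices :: "nat \<Rightarrow> nat \<Rightarrow> (nat \<Rightarrow> nat) set" where
  "increasing_indices k n = {\<alpha> \<in> {1..k} \<rightarrow>\<^sub>E {1..n}. strict_mono_on {1..k} \<alpha>}"

definition isomorphic_copies :: "'a set \<Rightarrow> 'a set set \<Rightarrow> nat set set set" where
  "isomorphic_copies V E =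
     {H. simple_graph {1..card V} H \<and> graph_isomorphic V E {1..card V} H}"

definition induced_count ::
    "'a set \<Rightarrow> 'a set set \<Rightarrow> nat \<Rightarrow> (nat set \<Rightarrow> bool) \<Rightarrow> real" where
  "induced_count V E n \<omega> =
     (\<Sum>\<alpha>\<in>increasing_indices (card V) n. \<Sum>H\<in>isomorphic_copies V E.
        (\<Prod>(i, j)\<in>{(i, j). 1 \<le> i \<and> i < j \<and> j \<le> card V \<and> {i, j} \<in> H}.
            edge_indicator \<omega> (\<alpha> i) (\<alpha> j)) *
        (\<Prod>(i, j)\<in>{(i, j). 1 \<le> i \<and> i < j \<and> j \<le> card V \<and> {i, j} \<notin> H}.
            1 - edge_indicator \<omega> (\<alpha> i) (\<alpha> j)))"

definition normal_distance :: "'b pmf \<Rightarrow> ('b \<Rightarrow> real) \<Rightarrow> real" where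
  "normal_distance M T =
     (SUP z::real. \<bar>measure_pmf.prob M
         {\<omega>. (T \<omega> - measure_pmf.expectation M T) / sqrt (measure_pmf.variance M T) \<le> z}
       - cdf std_normal_distribution z\<bar>)"

end

theory Submission
  imports Defs "HOL-Real_Asymp.Real_Asymp"
begin

text \<open>
  Expand the normalized count in the Walsh basis, \<open>W = \<Sum>\<^sub>A w(A) \<chi>\<^sub>A\<close> with
  \<open>\<chi>\<^sub>A = \<Prod>\<^sub>e\<^sub>\<in>\<^sub>A (\<xi>\<^sub>e - p)\<close>, \<open>A\<close> ranging over edge sets, and write
  \<open>W = \<Sum>\<^sub>e (\<xi>\<^sub>e - p) a\<^sub>e\<close> with \<open>a\<^sub>e = \<Sum>\<^sub>A\<^sub>\<ni>\<^sub>e w(A) \<chi>\<^bsub>A - e\<^esub> / |A|\<close>, which does not involve \<open>\<xi>\<^sub>e\<close>.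
  With \<open>c\<^sub>e\<close> the discrete derivative of \<open>W\<close>, Stein's method bounds the Kolmogorov distance by the
  fluctuations of \<open>\<Sum>\<^sub>e a\<^sub>e c\<^sub>e\<close> and by the sizes of the divergences \<open>\<Sum>\<^sub>e (\<xi>\<^sub>e - p) \<psi>(a\<^sub>e) c\<^sub>e\<close> for
  \<open>\<psi>(x) = x\<close> and \<open>\<psi>(x) = |x|\<close>; no third moments appear because the error of the trapezoidal rule for the
  Stein solution is at most an increment of a bounded monotone function, which is integrated by parts again.

  An edge set covering \<open>m\<close> vertices has weight \<open>O(n\<^bsup>g/2 - m\<^esup>)\<close>, where \<open>g\<close> is the least \<open>m\<close> with a nonzero
  weight: \<open>g = 2\<close> under (G1), and \<open>g = 3\<close> otherwise, the weights of 2-stars vanishing under (G3). The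
  divergences are always \<open>O(1/n)\<close>. The variance of \<open>\<Sum>\<^sub>e a\<^sub>e c\<^sub>e\<close> is governed by pairs \<open>A, B\<close> sharing an edge;
  it is \<open>O(n\<^bsup>-2\<^esup>)\<close> except when two 2-stars overlap in one edge, which gives \<open>O(n\<^bsup>-1\<^esup>)\<close> under (G2).
\<close>

section \<open>Stein's equation for the normal distribution\<close>

text \<open>The obstacle to a rate in Kolmogorov distance is that the derivative of the Stein
  solution jumps at \<open>z\<close>, so a Taylor remainder is not small pointwise and would call
  for a separate estimate of the probability that \<open>W\<close> lies near \<open>z\<close>. Here
  the increment of the solution across one flipped coordinate is compared with the average of its
  two end slopes. Since the slope is an increasing plus a decreasing function, the error is an
  increment of one bounded monotone function times a factor that does not involve that coordinate.
  This is again the shape produced by integration by parts, and it is the origin of the divergence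
  with absolute values. All moment bounds are power counting: each covered vertex contributes a
  factor 1/n and each free vertex has at most n choices. The constants count edge sets on a bounded
  vertex set crudely; only their independence of n matters. The rate theta is read off from one
  inequality on vertex numbers, |V(S)| + 2 |V(A) meet V(B)| >= 2g + 2 theta. Its left side is at
  least 6 when g = 2; when g = 3 it is at least 7, and at least 8 once 2-stars are excluded.\<close>

abbreviation Phi :: "real \<Rightarrow> real" where
  "Phi \<equiv> cdf std_normal_distribution"

interpretation std_normal: real_distribution std_normal_distribution
  by (rule real_dist_normal_dist)

lemma Phi_bounds: "0 \<le> Phi x" "Phi x \<le> 1"
  by (simp_all add: std_normal.cdf_nonneg std_normal.cdf_bounded_prob)

lemma Phi_diff_eq_integral:
  assumes "x \<le> y"
  shows "Phi y - Phi x = integral {x..y} std_normal_density"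
proof (cases "x = y")
  case False
  then have "x < y" using assms by simp
  have "Phi y - Phi x = measure std_normal_distribution {x<..y}"
    using \<open>x < y\<close> by (rule std_normal.cdf_diff_eq)
  also have "\<dots> = (\<integral>t. indicator {x<..y} t \<partial>std_normal_distribution)"
    by simp
  also have "\<dots> = (\<integral>t. std_normal_density t * indicator {x<..y} t \<partial>lborel)"
    by (subst integral_density) (auto simp: normal_density_nonneg)
  also have "\<dots> = (LINT t:{x<..y}|lborel. std_normal_density t)"
    by (simp add: set_lebesgue_integral_def mult.commute)
  also have "\<dots> = integral {x<..y} std_normal_density"
    using integrable_mult_indicator[of "{x<..y}" lborel std_normal_density] integrable_normal_density[of 1 0]
    by (intro set_borel_integral_eq_integral) (simp add: set_integrable_def)
  also have "\<dots> = integral {x..y} std_normal_density"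
    by (rule integral_spike_set) (auto intro: negligible_subset[of "{x}"])
  finally show ?thesis .
qed auto

lemma Phi_has_real_derivative: "(Phi has_real_derivative std_normal_density x) (at x)"
proof -
  have "((\<lambda>y. integral {x - 1..y} std_normal_density) has_real_derivative std_normal_density x)
          (at x within {x - 1..x + 1})"
    by (rule integral_has_real_derivative)
       (auto simp: std_normal_density_def intro!: continuous_intros)
  then have "((\<lambda>y. Phi (x - 1) + integral {x - 1..y} std_normal_density) has_real_derivative std_normal_density x)
          (at x within {x - 1..x + 1})"
    by (auto intro!: derivative_eq_intros)
  then have "(Phi has_real_derivative std_normal_density x) (at x within {x - 1..x + 1})"
    by (rule has_field_derivative_transform_within[where d = 1])
       (auto simp: Phi_diff_eq_integral[symmetric])
  then show ?thesis by (simp add: at_within_Icc_at)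
qed

section \<open>Gaussian density, symmetry and tail bounds\<close>

lemma std_normal_density_pos: "0 < std_normal_density x"
  by (simp add: std_normal_density_def)

lemma std_normal_density_minus: "std_normal_density (- x) = std_normal_density x"
  by (simp add: std_normal_density_def)

lemma std_normal_density_has_real_derivative:
  "(std_normal_density has_real_derivative - x * std_normal_density x) (at x)"
  unfolding std_normal_density_def
  by (auto intro!: derivative_eq_intros simp: field_simps)

lemmas DERIV_Phi_chain = DERIV_chain2[OF Phi_has_real_derivative]

lemma Phi_minus: "Phi (- x) = 1 - Phi x"
proof -
  have der: "((\<lambda>x. Phi (- x) + Phi x) has_real_derivative 0) (at x)" for x
    by (auto intro!: derivative_eq_intros DERIV_Phi_chain Phi_has_real_derivative simp: std_normal_density_minus)
  have "(\<lambda>x. Phi (- x) + Phi x) = (\<lambda>_. Phi (- x) + Phi x)"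
    using DERIV_isconst_all[of "\<lambda>x. Phi (- x) + Phi x"] der by fastforce
  moreover have "((\<lambda>x. Phi (- x) + Phi x) \<longlongrightarrow> 0 + 1) at_top"
    using filterlim_compose[OF std_normal.cdf_lim_at_bot filterlim_uminus_at_bot_at_top]
      std_normal.cdf_lim_at_top_prob by (rule tendsto_add)
  ultimately have "((\<lambda>_. Phi (- x) + Phi x) \<longlongrightarrow> 0 + 1) (at_top :: real filter)"
    by simp
  then have "Phi (- x) + Phi x = 1"
    by (simp add: tendsto_const_iff)
  then show ?thesis by simp
qed

text \<open>Device for the tail bounds: a comparison of derivatives anchored at minus infinity
  replaces the estimate of a Gaussian integral.\<close>

lemma nonneg_of_DERIV_nonneg_at_bot:
  fixes h :: "real \<Rightarrow> real"
  assumes "\<And>x. x \<le> a \<Longrightarrow> (h has_real_derivative h' x) (at x)" "\<And>x. x \<le> a \<Longrightarrow> 0 \<le> h' x"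
    and "(h \<longlongrightarrow> 0) at_bot"
  shows "0 \<le> h a"
proof (rule tendsto_upperbound[OF assms(3)])
  show "\<forall>\<^sub>F x in at_bot. h x \<le> h a"
    using eventually_le_at_bot[of a]
  proof eventually_elim
    case (elim x)
    show ?case
      by (rule DERIV_nonneg_imp_nondecreasing[OF elim]) (use assms in blast)
  qed
qed simp

text \<open>After division by \<open>1 + x^2\<close> the derivative of the right side collapses to
  twice the density over \<open>(1 + x^2)^2\<close>, and everything vanishes at minus infinity. The
  combination is chosen because it is the numerator of the derivative of
  \<open>x * mills x\<close>.\<close>

lemma Phi_lower_tail: "0 \<le> (1 + x\<^sup>2) * Phi x + x * std_normal_density x"
proof -
  have pos: "1 + t\<^sup>2 \<noteq> 0" for t :: real
    using zero_le_power2[of t] by linarith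
  have "0 \<le> Phi x + x / (1 + x\<^sup>2) * std_normal_density x"
  proof (rule nonneg_of_DERIV_nonneg_at_bot[where a = x and
        h = "\<lambda>t. Phi t + t / (1 + t\<^sup>2) * std_normal_density t" and
        h' = "\<lambda>t. 2 * std_normal_density t / (1 + t\<^sup>2)\<^sup>2"])
    fix t :: real
    have "((\<lambda>t. t / (1 + t\<^sup>2)) has_real_derivative (1 - t\<^sup>2) / (1 + t\<^sup>2)\<^sup>2) (at t)"
      using pos[of t] by (auto intro!: derivative_eq_intros simp: power2_eq_square)
    note DERIV_add[OF Phi_has_real_derivative DERIV_mult[OF this std_normal_density_has_real_derivative]]
    moreover have "std_normal_density t + ((1 - t\<^sup>2) / (1 + t\<^sup>2)\<^sup>2 * std_normal_density t
          + - t * std_normal_density t * (t / (1 + t\<^sup>2))) = 2 * std_normal_density t / (1 + t\<^sup>2)\<^sup>2"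
      using pos[of t] by (simp add: divide_simps) algebra
    ultimately show "((\<lambda>t. Phi t + t / (1 + t\<^sup>2) * std_normal_density t) has_real_derivative
        2 * std_normal_density t / (1 + t\<^sup>2)\<^sup>2) (at t)" by simp
    show "0 \<le> 2 * std_normal_density t / (1 + t\<^sup>2)\<^sup>2"
      by (simp add: std_normal_density_pos less_imp_le)
  next
    have "((\<lambda>t. t / (1 + t\<^sup>2) * std_normal_density t) \<longlongrightarrow> 0) at_bot"
      unfolding std_normal_density_def by real_asymp
    from tendsto_add[OF std_normal.cdf_lim_at_bot this]
    show "((\<lambda>t. Phi t + t / (1 + t\<^sup>2) * std_normal_density t) \<longlongrightarrow> 0) at_bot" by simp
  qed
  then have "0 \<le> (1 + x\<^sup>2) * (Phi x + x / (1 + x\<^sup>2) * std_normal_density x)"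
    by simp
  also have "\<dots> = (1 + x\<^sup>2) * Phi x + x * std_normal_density x"
    using pos[of x] by (simp add: field_simps)
  finally show ?thesis .
qed

text \<open>After division by \<open>- x\<close> the difference of the two sides has derivative
  density over \<open>x^2\<close>. This is what bounds \<open>x * mills x\<close> by 1 in absolute
  value for negative \<open>x\<close>.\<close>

lemma Phi_upper_tail:
  assumes "x < 0"
  shows "- x * Phi x \<le> std_normal_density x"
proof -
  have "0 \<le> - std_normal_density x / x - Phi x"
  proof (rule nonneg_of_DERIV_nonneg_at_bot[where a = x and
        h = "\<lambda>t. - std_normal_density t / t - Phi t" and
        h' = "\<lambda>t. std_normal_density t / t\<^sup>2"])
    fix t :: real assume "t \<le> x"
    then have t: "t \<noteq> 0" using assms by auto
    show "((\<lambda>t. - std_normal_density t / t - Phi t) has_real_derivative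
        std_normal_density t / t\<^sup>2) (at t)"
      using DERIV_diff[OF DERIV_divide[OF DERIV_minus[OF std_normal_density_has_real_derivative]
            DERIV_ident t] Phi_has_real_derivative] t
      by (simp add: field_simps power2_eq_square)
    show "0 \<le> std_normal_density t / t\<^sup>2"
      by (simp add: std_normal_density_pos less_imp_le)
  next
    have "((\<lambda>t. - std_normal_density t / t) \<longlongrightarrow> 0) at_bot"
      unfolding std_normal_density_def by real_asymp
    from tendsto_diff[OF this std_normal.cdf_lim_at_bot]
    show "((\<lambda>t. - std_normal_density t / t - Phi t) \<longlongrightarrow> 0) at_bot" by simp
  qed
  then show ?thesis using assms by (simp add: field_simps)
qed

text \<open>\<open>mills (- t)\<close> is the usual Mills ratio of the upper tail at
  \<open>t\<close>. It solves \<open>m' = x m + 1\<close>, so multiples of it and of its reflection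
  give the two branches of the Stein solution.\<close>

definition mills :: "real \<Rightarrow> real" where
  "mills x = Phi x / std_normal_density x"

lemma mills_has_real_derivative: "(mills has_real_derivative x * mills x + 1) (at x)"
  unfolding mills_def using std_normal_density_pos[of x]
  by (auto intro!: derivative_eq_intros Phi_has_real_derivative std_normal_density_has_real_derivative
        simp: field_simps power2_eq_square)

lemma mills_nonneg: "0 \<le> mills x"
  by (simp add: mills_def Phi_bounds std_normal_density_pos less_imp_le)

text \<open>The derivative is the expression of \<open>Phi_lower_tail\<close> divided by the
  density.\<close>

lemma mono_times_mills: "mono (\<lambda>x. x * mills x)"
proof (rule monoI)
  fix x y :: real assume "x \<le> y"
  then show "x * mills x \<le> y * mills y"
  proof (rule DERIV_nonneg_imp_nondecreasing)
    fix t :: real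
    have "((\<lambda>x. x * mills x) has_real_derivative mills t + t * (t * mills t + 1)) (at t)"
      by (auto intro!: derivative_eq_intros mills_has_real_derivative)
    moreover have "mills t + t * (t * mills t + 1) =
        ((1 + t\<^sup>2) * Phi t + t * std_normal_density t) / std_normal_density t"
      using std_normal_density_pos[of t] by (simp add: mills_def field_simps power2_eq_square)
    ultimately show "\<exists>D. ((\<lambda>x. x * mills x) has_real_derivative D) (at t) \<and> 0 \<le> D"
      using Phi_lower_tail[of t] std_normal_density_pos[of t] by auto
  qed
qed

lemma times_mills_ge: "x \<le> 0 \<Longrightarrow> - 1 \<le> x * mills x"
  using Phi_upper_tail[of x] std_normal_density_pos[of x]
  by (cases "x = 0") (auto simp: mills_def field_simps)

text \<open>The bounded solution of \<open>f'(w) - w f(w) = 1(w <= z) - Phi z\<close>. The branches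
  agree at \<open>w = z\<close>, where only the derivative jumps.\<close>

definition stein_sol :: "real \<Rightarrow> real \<Rightarrow> real" where
  "stein_sol z w = (if w \<le> z then mills w * (1 - Phi z) else mills (- w) * Phi z)"

lemma stein_sol_right: "z \<le> w \<Longrightarrow> stein_sol z w = mills (- w) * Phi z"
  by (auto simp: stein_sol_def mills_def Phi_minus std_normal_density_minus)

lemma stein_sol_left: "w \<le> z \<Longrightarrow> stein_sol z w = mills w * (1 - Phi z)"
  by (auto simp: stein_sol_def)

text \<open>Each branch is a nonnegative multiple of \<open>x * mills x\<close>, taken directly or
  reflected through the origin, and the branches are joined at \<open>z\<close>.\<close>

lemma mono_times_stein_sol: "mono (\<lambda>w. w * stein_sol z w)"
proof (rule monoI)
  fix x y :: real assume xy: "x \<le> y"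
  have left: "x * stein_sol z x \<le> y * stein_sol z y" if "x \<le> y" "y \<le> z" for x y
    using mult_right_mono[OF monoD[OF mono_times_mills that(1)], of "1 - Phi z"] that
    by (simp add: stein_sol_left Phi_bounds algebra_simps)
  have right: "x * stein_sol z x \<le> y * stein_sol z y" if "x \<le> y" "z \<le> x" for x y
    using mult_right_mono[OF monoD[OF mono_times_mills, of "-y" "-x"], of "Phi z"] that
    by (simp add: stein_sol_right Phi_bounds algebra_simps)
  show "x * stein_sol z x \<le> y * stein_sol z y"
    using left[of x y] right[of x y] left[of x z] right[of z y] xy by linarith
qed

lemma abs_times_stein_sol_le: "\<bar>w * stein_sol z w\<bar> \<le> 1"
proof -
  \<comment> \<open>By monotonicity it is enough to look at a point lying in the right branch with
    known sign; \<open>min (min z w) 0\<close> plays the same role for the lower bound.\<close>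
  have "w * stein_sol z w \<le> max (max z w) 0 * stein_sol z (max (max z w) 0)"
    by (rule monoD[OF mono_times_stein_sol]) simp
  also have "\<dots> \<le> 1"
  proof -
    define v where "v = max (max z w) 0"
    have "v * mills (- v) \<le> 1" "0 \<le> v * mills (-v)"
      using times_mills_ge[of "- v"] mills_nonneg[of "-v"] by (auto simp: v_def)
    then have "(v * mills (- v)) * Phi z \<le> 1 * 1"
      by (intro mult_mono) (auto simp: Phi_bounds)
    then show ?thesis
      by (fold v_def) (simp add: stein_sol_right v_def)
  qed
  finally have 1: "w * stein_sol z w \<le> 1" .
  define v where "v = min (min z w) 0"
  have "- (v * mills v) \<le> 1" "0 \<le> - (v * mills v)"
    using times_mills_ge[of v] mills_nonneg[of v] by (auto simp: v_def mult_le_0_iff)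
  then have "- (v * mills v) * (1 - Phi z) \<le> 1 * 1"
    by (intro mult_mono) (auto simp: Phi_bounds)
  moreover have "stein_sol z v = mills v * (1 - Phi z)"
    by (rule stein_sol_left) (simp add: v_def)
  ultimately have "- 1 \<le> v * stein_sol z v"
    by (simp only:) (simp add: algebra_simps)
  also have "\<dots> \<le> w * stein_sol z w"
    by (rule monoD[OF mono_times_stein_sol]) (simp add: v_def)
  finally show ?thesis using 1 by (simp add: abs_le_iff)
qed

text \<open>Mean value theorem: on one side of \<open>z\<close> the derivative is increasing, so its
  endpoint values bracket the difference quotient.\<close>

lemma stein_sol_diff_left:
  assumes "x \<le> y" "y \<le> z"
  shows "(y - x) * (x * stein_sol z x + 1 - Phi z) \<le> stein_sol z y - stein_sol z x"
    and "stein_sol z y - stein_sol z x \<le> (y - x) * (y * stein_sol z y + 1 - Phi z)"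
proof -
  have "\<exists>t. x \<le> t \<and> t \<le> y \<and> stein_sol z y - stein_sol z x = (y - x) * (t * stein_sol z t + 1 - Phi z)"
  proof (cases "x = y")
    case False
    then have "x < y" using assms by simp
    have "((\<lambda>w. mills w * (1 - Phi z)) has_real_derivative (t * mills t + 1) * (1 - Phi z)) (at t)" for t
      by (auto intro!: derivative_eq_intros mills_has_real_derivative)
    from MVT2[OF \<open>x < y\<close> this] obtain t where "x < t" "t < y"
      "mills y * (1 - Phi z) - mills x * (1 - Phi z) = (y - x) * ((t * mills t + 1) * (1 - Phi z))"
      by blast
    then show ?thesis using assms
      by (intro exI[of _ t]) (simp add: stein_sol_left algebra_simps)
  qed auto
  then obtain t where t: "x \<le> t" "t \<le> y"
    "stein_sol z y - stein_sol z x = (y - x) * (t * stein_sol z t + 1 - Phi z)" by blast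
  show "(y - x) * (x * stein_sol z x + 1 - Phi z) \<le> stein_sol z y - stein_sol z x"
       "stein_sol z y - stein_sol z x \<le> (y - x) * (y * stein_sol z y + 1 - Phi z)"
    unfolding t(3) using monoD[OF mono_times_stein_sol, OF t(1), of z]
      monoD[OF mono_times_stein_sol, OF t(2), of z] assms
    by (auto intro!: mult_left_mono)
qed

lemma stein_sol_diff_right:
  assumes "x \<le> y" "z \<le> x"
  shows "(y - x) * (x * stein_sol z x - Phi z) \<le> stein_sol z y - stein_sol z x"
    and "stein_sol z y - stein_sol z x \<le> (y - x) * (y * stein_sol z y - Phi z)"
proof -
  have "\<exists>t. x \<le> t \<and> t \<le> y \<and> stein_sol z y - stein_sol z x = (y - x) * (t * stein_sol z t - Phi z)"
  proof (cases "x = y")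
    case False
    then have "x < y" using assms by simp
    have "((\<lambda>w. mills (- w) * Phi z) has_real_derivative (t * mills (- t) - 1) * Phi z) (at t)" for t
      by (auto intro!: derivative_eq_intros DERIV_chain2[OF mills_has_real_derivative] simp: algebra_simps)
    from MVT2[OF \<open>x < y\<close> this] obtain t where "x < t" "t < y"
      "mills (- y) * Phi z - mills (- x) * Phi z = (y - x) * ((t * mills (- t) - 1) * Phi z)"
      by blast
    then show ?thesis using assms
      by (intro exI[of _ t]) (simp add: stein_sol_right algebra_simps)
  qed auto
  then obtain t where t: "x \<le> t" "t \<le> y"
    "stein_sol z y - stein_sol z x = (y - x) * (t * stein_sol z t - Phi z)" by blast
  show "(y - x) * (x * stein_sol z x - Phi z) \<le> stein_sol z y - stein_sol z x"
       "stein_sol z y - stein_sol z x \<le> (y - x) * (y * stein_sol z y - Phi z)"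
    unfolding t(3) using monoD[OF mono_times_stein_sol, OF t(1), of z]
      monoD[OF mono_times_stein_sol, OF t(2), of z] assms
    by (auto intro!: mult_left_mono)
qed

text \<open>The derivative is an increasing part plus the decreasing indicator. The lower bound
  takes each part at the endpoint where it is smallest, the upper bound where it is largest, which
  stays valid across the jump.\<close>

lemma stein_sol_diff:
  assumes "x \<le> y"
  shows "(y - x) * (x * stein_sol z x + of_bool (y \<le> z) - Phi z) \<le> stein_sol z y - stein_sol z x"
    and "stein_sol z y - stein_sol z x \<le> (y - x) * (y * stein_sol z y + of_bool (x \<le> z) - Phi z)"
proof -
  let ?g = "\<lambda>w. w * stein_sol z w"
  consider "y \<le> z" | "z < x" | "x \<le> z" "z < y" using assms by linarith
  then have "(y - x) * (?g x + of_bool (y \<le> z) - Phi z) \<le> stein_sol z y - stein_sol z x \<and>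
      stein_sol z y - stein_sol z x \<le> (y - x) * (?g y + of_bool (x \<le> z) - Phi z)"
  proof cases
    case 1
    then show ?thesis using stein_sol_diff_left[OF assms, of z] assms by simp
  next
    case 2
    then show ?thesis using stein_sol_diff_right[OF assms, of z] assms by simp
  next
    \<comment> \<open>The interval straddles \<open>z\<close>: it is cut there and the two one-sided
      bounds are added.\<close>
    case 3
    have g: "?g x \<le> ?g z" "?g z \<le> ?g y"
      using 3 by (auto intro: monoD[OF mono_times_stein_sol])
    have 1: "(z - x) * (?g x - Phi z) \<le> (z - x) * (?g x + 1 - Phi z)"
      and 2: "(y - z) * (?g x - Phi z) \<le> (y - z) * (?g z - Phi z)"
      and 3: "(z - x) * (?g z + 1 - Phi z) \<le> (z - x) * (?g y + 1 - Phi z)"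
      and 4: "(y - z) * (?g y - Phi z) \<le> (y - z) * (?g y + 1 - Phi z)"
      using 3 g by (auto intro!: mult_left_mono)
    have split: "(y - x) * c = (z - x) * c + (y - z) * c" for c by (simp add: algebra_simps)
    have ob: "of_bool (y \<le> z) = (0::real)" "of_bool (x \<le> z) = (1::real)"
      using \<open>x \<le> z\<close> \<open>z < y\<close> by auto
    show ?thesis
      unfolding ob split add_0_right
      using 1 2 3 4 stein_sol_diff_left[of x z z] stein_sol_diff_right[of z y z] \<open>x \<le> z\<close> \<open>z < y\<close>
      by (intro conjI) linarith+
  qed
  then show "(y - x) * (?g x + of_bool (y \<le> z) - Phi z) \<le> stein_sol z y - stein_sol z x"
    "stein_sol z y - stein_sol z x \<le> (y - x) * (?g y + of_bool (x \<le> z) - Phi z)" by auto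
qed

text \<open>
  The derivative \<open>w f(w) + 1(w \<le> z) - \<Phi>(z)\<close> is the sum of a monotone and an antitone function, so
  the error of the trapezoidal rule is controlled by the increment of a bounded monotone function.
\<close>

definition stein_deriv :: "real \<Rightarrow> real \<Rightarrow> real" where
  "stein_deriv z w = w * stein_sol z w + of_bool (w \<le> z) - Phi z"

text \<open>Increasing part minus decreasing part of \<open>stein_deriv\<close>; the change of sign
  makes the whole function monotone.\<close>

definition stein_envelope :: "real \<Rightarrow> real \<Rightarrow> real" where
  "stein_envelope z w = w * stein_sol z w - of_bool (w \<le> z)"

text \<open>The trapezoidal value is the midpoint of the two bounds of
  \<open>stein_sol_diff\<close>, and the right side is half their distance. The right side is
  symmetric in \<open>x\<close> and \<open>y\<close>, which matters because the order of the values
  of \<open>W\<close> before and after a flip is unknown.\<close>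

lemma stein_trapezoid:
  "\<bar>stein_sol z y - stein_sol z x - (y - x) * (stein_deriv z x + stein_deriv z y) / 2\<bar>
    \<le> (y - x) * (stein_envelope z y - stein_envelope z x) / 2"
proof -
  have *: "\<bar>stein_sol z y - stein_sol z x - (y - x) * (stein_deriv z x + stein_deriv z y) / 2\<bar>
    \<le> (y - x) * (stein_envelope z y - stein_envelope z x) / 2" if "x \<le> y" for x y
    using stein_sol_diff[OF that, of z] unfolding stein_deriv_def stein_envelope_def
    by (simp add: abs_le_iff field_simps)
  show ?thesis
  proof (cases "x \<le> y")
    case False
    have "stein_sol z y - stein_sol z x - (y - x) * (stein_deriv z x + stein_deriv z y) / 2
        = - (stein_sol z x - stein_sol z y - (x - y) * (stein_deriv z y + stein_deriv z x) / 2)"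
      "(y - x) * (stein_envelope z y - stein_envelope z x) = (x - y) * (stein_envelope z x - stein_envelope z y)"
      by (simp_all add: field_simps)
    then show ?thesis
      using *[of y x] False by (simp only: abs_minus_cancel)
  qed (rule *)
qed

lemma abs_stein_deriv_le: "\<bar>stein_deriv z w\<bar> \<le> 2"
  using abs_times_stein_sol_le[of w z] Phi_bounds[of z] unfolding stein_deriv_def
  by (auto simp: abs_le_iff)

lemma abs_stein_envelope_le: "\<bar>stein_envelope z w\<bar> \<le> 2"
  using abs_times_stein_sol_le[of w z] unfolding stein_envelope_def
  by (auto simp: abs_le_iff)

section \<open>Stein's method on a product of Bernoulli spaces\<close>

definition discrete_deriv :: "'e \<Rightarrow> (('e \<Rightarrow> bool) \<Rightarrow> real) \<Rightarrow> ('e \<Rightarrow> bool) \<Rightarrow> real" where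
  "discrete_deriv e X v = X (v(e := True)) - X (v(e := False))"

lemma discrete_deriv_eq: "discrete_deriv e X = (\<lambda>v. X (v(e := True)) - X (v(e := False)))"
  by (simp add: fun_eq_iff discrete_deriv_def)

definition free_of :: "'e \<Rightarrow> (('e \<Rightarrow> bool) \<Rightarrow> real) \<Rightarrow> bool" where
  "free_of e X \<longleftrightarrow> (\<forall>v b. X (v(e := b)) = X v)"

lemma free_ofD: "free_of e X \<Longrightarrow> X (v(e := b)) = X v"
  by (simp add: free_of_def)

lemma free_of_discrete_deriv: "free_of e (discrete_deriv e X)"
  by (simp add: free_of_def discrete_deriv_def)

lemma free_of_discrete_deriv': "free_of f X \<Longrightarrow> free_of f (discrete_deriv e X)"
  by (cases "e = f") (auto simp: free_of_discrete_deriv free_of_def discrete_deriv_def fun_upd_twist)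

lemma free_of_mult: "free_of e X \<Longrightarrow> free_of e Y \<Longrightarrow> free_of e (\<lambda>v. X v * Y v)"
  by (simp add: free_of_def)

lemma discrete_deriv_mult_free:
  "free_of e X \<Longrightarrow> discrete_deriv e (\<lambda>v. X v * Y v) = (\<lambda>v. X v * discrete_deriv e Y v)"
  by (simp add: free_ofD discrete_deriv_eq right_diff_distrib)

lemma expectation_Pi_pmf_insert_bernoulli:
  fixes X :: "('e \<Rightarrow> bool) \<Rightarrow> real"
  assumes "finite A" "e \<notin> A" "0 \<le> p" "p \<le> 1"
  shows "measure_pmf.expectation (Pi_pmf (insert e A) False (\<lambda>_. bernoulli_pmf p)) X =
    measure_pmf.expectation (Pi_pmf A False (\<lambda>_. bernoulli_pmf p))
      (\<lambda>v. p * X (v(e := True)) + (1 - p) * X (v(e := False)))"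
proof -
  let ?M = "Pi_pmf A False (\<lambda>_. bernoulli_pmf p)"
  have fin: "finite (set_pmf ?M)"
    by (rule finite_subset[OF set_Pi_pmf_subset'[OF assms(1)]]) (use assms(1) in auto)
  note [simp] = integrable_measure_pmf_finite[OF fin]
  have "Pi_pmf (insert e A) False (\<lambda>_. bernoulli_pmf p) =
      bernoulli_pmf p \<bind> (\<lambda>b. map_pmf (\<lambda>v. v(e := b)) ?M)"
    using assms by (simp add: Pi_pmf_insert' map_pmf_def)
  then have "measure_pmf.expectation (Pi_pmf (insert e A) False (\<lambda>_. bernoulli_pmf p)) X =
      (\<Sum>b\<in>UNIV. pmf (bernoulli_pmf p) b *\<^sub>R measure_pmf.expectation (map_pmf (\<lambda>v. v(e := b)) ?M) X)"
    using fin by (simp add: pmf_expectation_bind[where A = UNIV])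
  also have "\<dots> = p * measure_pmf.expectation ?M (\<lambda>v. X (v(e := True)))
      + (1 - p) * measure_pmf.expectation ?M (\<lambda>v. X (v(e := False)))"
    using assms by (simp add: UNIV_bool)
  finally show ?thesis by simp
qed

locale bernoulli_cube =
  fixes I :: "'e set" and p :: real
  assumes finite_I: "finite I" and p_pos: "0 < p" and p_less: "p < 1"
begin

abbreviation M :: "('e \<Rightarrow> bool) pmf" where
  "M \<equiv> Pi_pmf I False (\<lambda>_. bernoulli_pmf p)"

abbreviation expect :: "(('e \<Rightarrow> bool) \<Rightarrow> real) \<Rightarrow> real" where
  "expect X \<equiv> measure_pmf.expectation M X"

definition xi :: "'e \<Rightarrow> ('e \<Rightarrow> bool) \<Rightarrow> real" where
  "xi e v = of_bool (v e) - p"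

definition var1 :: real where
  "var1 = p * (1 - p)"

lemma var1_pos: "0 < var1" and var1_le_1: "var1 \<le> 1"
  using p_pos p_less mult_mono[of p 1 "1 - p" 1] by (auto simp: var1_def)

lemma finite_set_M: "finite (set_pmf M)"
  by (rule finite_subset[OF set_Pi_pmf_subset'[OF finite_I]]) (use finite_I in auto)

lemma integrable_M [simp]: "integrable (measure_pmf M) (X :: _ \<Rightarrow> real)"
  by (rule integrable_measure_pmf_finite[OF finite_set_M])

lemma expect_mono: "(\<And>v. X v \<le> Y v) \<Longrightarrow> expect X \<le> expect Y"
  by (intro integral_mono) auto

lemma expect_nonneg: "(\<And>v. 0 \<le> X v) \<Longrightarrow> 0 \<le> expect X"
  by (rule integral_nonneg_AE) auto

lemma abs_expect_le: "(\<And>v. \<bar>X v\<bar> \<le> Y v) \<Longrightarrow> \<bar>expect X\<bar> \<le> expect Y"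
  by (rule order_trans[OF integral_abs_bound]) (rule expect_mono)

lemma square_expect_le: "(expect X)\<^sup>2 \<le> expect (\<lambda>v. (X v)\<^sup>2)"
proof -
  have "0 \<le> expect (\<lambda>v. (X v - expect X)\<^sup>2)" by (rule expect_nonneg) simp
  also have "\<dots> = expect (\<lambda>v. (X v)\<^sup>2) - (expect X)\<^sup>2"
    by (simp add: power2_diff algebra_simps power2_eq_square)
  finally show ?thesis by simp
qed

lemma expect_abs_le_sqrt: "expect (\<lambda>v. \<bar>X v\<bar>) \<le> sqrt (expect (\<lambda>v. (X v)\<^sup>2))"
  using square_expect_le[of "\<lambda>v. \<bar>X v\<bar>"] by (intro real_le_rsqrt) simp

text \<open>Redrawing one coordinate independently preserves the law.\<close>

lemma expect_resample:
  assumes "e \<in> I"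
  shows "expect X = expect (\<lambda>v. p * X (v(e := True)) + (1 - p) * X (v(e := False)))"
proof -
  have I: "I = insert e (I - {e})" using assms by auto
  have *: "expect X = measure_pmf.expectation (Pi_pmf (I - {e}) False (\<lambda>_. bernoulli_pmf p))
      (\<lambda>v. p * X (v(e := True)) + (1 - p) * X (v(e := False)))" for X
    by (subst I, subst expectation_Pi_pmf_insert_bernoulli)
       (use finite_I p_pos p_less in auto)
  show ?thesis
    unfolding *[of X]
    by (subst *) (simp add: algebra_simps)
qed

text \<open>Discrete integration by parts: \<open>xi\<close> takes the values \<open>1 - p\<close>
  and \<open>- p\<close> with weights \<open>p\<close> and \<open>1 - p\<close>, so the two
  conditional values of \<open>X\<close> receive the weights \<open>var1\<close> and
  \<open>- var1\<close>.\<close>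

lemma expect_xi_mult:
  assumes "e \<in> I"
  shows "expect (\<lambda>v. xi e v * X v) = var1 * expect (discrete_deriv e X)"
  by (subst expect_resample[OF assms])
     (simp add: xi_def discrete_deriv_eq var1_def algebra_simps)

lemma expect_xi_mult_free:
  assumes "e \<in> I" and "free_of e h"
  shows "expect (\<lambda>v. xi e v * h v * Y v) = var1 * expect (\<lambda>v. h v * discrete_deriv e Y v)"
  using expect_xi_mult[OF assms(1), of "\<lambda>v. h v * Y v"]
  unfolding discrete_deriv_mult_free[OF assms(2)] mult.assoc .

lemma expect_xi_square_mult:
  assumes "e \<in> I" "free_of e X"
  shows "expect (\<lambda>v. (xi e v)\<^sup>2 * X v) = var1 * expect X"
proof -
  have "expect (\<lambda>v. (xi e v)\<^sup>2 * X v) = expect (\<lambda>v. var1 * X v)"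
    by (subst expect_resample[OF assms(1)])
       (simp add: xi_def var1_def free_ofD[OF assms(2)] algebra_simps power2_eq_square)
  then show ?thesis by simp
qed

text \<open>
  Integration by parts turns \<open>E[W f(W)]\<close> into \<open>E[K f'(W)]\<close> with
  \<open>2 K = \<Sum>\<^sub>e a\<^sub>e c\<^sub>e E[(\<xi>\<^sub>e - \<xi>'\<^sub>e)\<^sup>2 | \<xi>]\<close>; a second integration by parts absorbs the error of the
  trapezoidal rule.
\<close>

theorem stein_kolmogorov_bound:
  assumes W: "\<And>v. W v = (\<Sum>e\<in>I. xi e v * a e v)"
    and free: "\<And>e. e \<in> I \<Longrightarrow> free_of e (a e)"
  defines "c \<equiv> \<lambda>e. discrete_deriv e W"
  shows "\<bar>measure_pmf.prob M {v. W v \<le> z} - Phi z\<bar> \<le>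
      2 * expect (\<lambda>v. \<bar>1 - var1 * (\<Sum>e\<in>I. a e v * c e v)\<bar>)
      + expect (\<lambda>v. \<bar>\<Sum>e\<in>I. xi e v * (a e v * c e v)\<bar>)
      + expect (\<lambda>v. \<bar>\<Sum>e\<in>I. xi e v * (\<bar>a e v\<bar> * c e v)\<bar>)"
proof -
  let ?f = "stein_sol z" and ?f' = "stein_deriv z" and ?G = "stein_envelope z"
  define S where "S = (\<lambda>v. \<Sum>e\<in>I. a e v * c e v)"
  define S' where "S' = (\<lambda>v. \<Sum>e\<in>I. xi e v * (a e v * c e v))"
  define Z where "Z = (\<lambda>v. \<Sum>e\<in>I. xi e v * (\<bar>a e v\<bar> * c e v))"
  \<comment> \<open>Half of the conditional mean of the squared jump is
    \<open>((xi e v)^2 + var1) / 2\<close>, and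
    \<open>(xi e v)^2 = (1 - 2 * p) * xi e v + var1\<close>. This gives the factor
    \<open>var1 + (1 - 2 * p) / 2 * xi e v\<close> per edge.\<close>
  define K where "K = (\<lambda>v. var1 * S v + (1 - 2 * p) / 2 * S' v)"
  have freec: "free_of e (c e)" for e by (simp add: c_def free_of_discrete_deriv)
  have step: "\<bar>expect (\<lambda>v. xi e v * a e v * ?f (W v))
      - expect (\<lambda>v. (var1 + (1 - 2 * p) / 2 * xi e v) * (a e v * c e v) * ?f' (W v))\<bar>
      \<le> expect (\<lambda>v. xi e v * (\<bar>a e v\<bar> * c e v) * ?G (W v)) / 2" if e: "e \<in> I" for e
  proof -
    let ?W1 = "\<lambda>v. W (v(e := True))" and ?W0 = "\<lambda>v. W (v(e := False))"
    have fa: "free_of e (\<lambda>v. \<bar>a e v\<bar> * c e v)"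
      using free[OF e] freec[of e] by (simp add: free_of_def)
    have 1: "expect (\<lambda>v. xi e v * a e v * ?f (W v)) = expect (\<lambda>v. var1 * (a e v * (?f (?W1 v) - ?f (?W0 v))))"
      using expect_xi_mult[OF e, of "\<lambda>v. a e v * ?f (W v)"]
      by (simp add: discrete_deriv_eq free_ofD[OF free[OF e]] right_diff_distrib mult.assoc)
    \<comment> \<open>The factor in front was chosen for this identity: after averaging over the
      coordinate, both endpoint slopes receive the weight \<open>var1 / 2\<close>, which is exactly
      the trapezoidal rule.\<close>
    have 2: "expect (\<lambda>v. (var1 + (1 - 2 * p) / 2 * xi e v) * (a e v * c e v) * ?f' (W v))
        = expect (\<lambda>v. var1 * (a e v * ((?W1 v - ?W0 v) * (?f' (?W0 v) + ?f' (?W1 v)) / 2)))"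
      by (subst expect_resample[OF e], rule arg_cong[of _ _ expect], rule ext)
         (simp add: free_ofD[OF free[OF e]] free_ofD[OF freec] xi_def var1_def,
          simp add: c_def discrete_deriv_def field_simps)
    \<comment> \<open>Second integration by parts, now read backwards: the trapezoidal error
      weighted with \<open>\<bar>a e v\<bar>\<close> is the derivative term of a divergence tested
      against the envelope.\<close>
    have 3: "expect (\<lambda>v. xi e v * (\<bar>a e v\<bar> * c e v) * ?G (W v)) / 2 =
        expect (\<lambda>v. var1 * (\<bar>a e v\<bar> * ((?W1 v - ?W0 v) * (?G (?W1 v) - ?G (?W0 v)) / 2)))"
      unfolding expect_xi_mult_free[OF e fa] by (simp add: c_def discrete_deriv_def mult.assoc)
    have eq: "expect (\<lambda>v. xi e v * a e v * ?f (W v))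
      - expect (\<lambda>v. (var1 + (1 - 2 * p) / 2 * xi e v) * (a e v * c e v) * ?f' (W v))
      = expect (\<lambda>v. var1 * (a e v * (?f (?W1 v) - ?f (?W0 v)
           - (?W1 v - ?W0 v) * (?f' (?W0 v) + ?f' (?W1 v)) / 2)))"
      unfolding 1 2 Bochner_Integration.integral_diff[OF integrable_M integrable_M, symmetric]
        right_diff_distrib[symmetric] ..
    show ?thesis
      unfolding eq 3
      by (rule abs_expect_le, unfold abs_mult)
         (intro mult_mono stein_trapezoid, use var1_pos in auto)
  qed
  have "W v * ?f (W v) = (\<Sum>e\<in>I. xi e v * a e v * ?f (W v))" for v
    unfolding sum_distrib_right[symmetric] using W[of v] by (rule arg_cong[of _ _ "\<lambda>x. x * _"])
  then have W': "expect (\<lambda>v. W v * ?f (W v)) = (\<Sum>e\<in>I. expect (\<lambda>v. xi e v * a e v * ?f (W v)))"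
    by (simp only: Bochner_Integration.integral_sum[OF integrable_M])
  have "K v = (\<Sum>e\<in>I. (var1 + (1 - 2 * p) / 2 * xi e v) * (a e v * c e v))" for v
    by (simp only: K_def S_def S'_def sum_distrib_left sum.distrib[symmetric] distrib_right mult.assoc)
  then have K': "expect (\<lambda>v. K v * ?f' (W v)) =
      (\<Sum>e\<in>I. expect (\<lambda>v. (var1 + (1 - 2 * p) / 2 * xi e v) * (a e v * c e v) * ?f' (W v)))"
    by (simp only: sum_distrib_right Bochner_Integration.integral_sum[OF integrable_M])
  have "\<bar>expect (\<lambda>v. W v * ?f (W v)) - expect (\<lambda>v. K v * ?f' (W v))\<bar>
      \<le> (\<Sum>e\<in>I. expect (\<lambda>v. xi e v * (\<bar>a e v\<bar> * c e v) * ?G (W v)) / 2)"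
    unfolding W' K' sum_subtractf[symmetric] by (rule order_trans[OF sum_abs]) (rule sum_mono[OF step])
  also have "\<dots> = expect (\<lambda>v. Z v * ?G (W v)) / 2"
    by (subst sum_divide_distrib[symmetric], subst Bochner_Integration.integral_sum[symmetric])
       (simp_all add: Z_def sum_distrib_right)
  also have "\<dots> \<le> expect (\<lambda>v. \<bar>Z v\<bar> * 2) / 2"
  proof (intro divide_right_mono expect_mono)
    fix v
    have "Z v * ?G (W v) \<le> \<bar>Z v\<bar> * \<bar>?G (W v)\<bar>"
      unfolding abs_mult[symmetric] by (rule abs_ge_self)
    also have "\<dots> \<le> \<bar>Z v\<bar> * 2"
      by (intro mult_left_mono abs_stein_envelope_le) simp
    finally show "Z v * ?G (W v) \<le> \<bar>Z v\<bar> * 2" .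
  qed simp
  finally have WK: "\<bar>expect (\<lambda>v. W v * ?f (W v)) - expect (\<lambda>v. K v * ?f' (W v))\<bar> \<le> expect (\<lambda>v. \<bar>Z v\<bar>)"
    by simp
  have prob: "measure_pmf.prob M {v. W v \<le> z} - Phi z = expect (\<lambda>v. of_bool (W v \<le> z) - Phi z)"
  proof -
    have "(\<lambda>v. of_bool (W v \<le> z)) = indicat_real {v. W v \<le> z}"
      by (auto simp: fun_eq_iff)
    then show ?thesis by simp
  qed
  \<comment> \<open>Stein's equation, evaluated at \<open>W v\<close>.\<close>
  have "expect (\<lambda>v. of_bool (W v \<le> z) - Phi z) = expect (\<lambda>v. ?f' (W v)) - expect (\<lambda>v. W v * ?f (W v))"
    by (subst Bochner_Integration.integral_diff[symmetric]) (simp_all add: stein_deriv_def)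
  also have "\<dots> = expect (\<lambda>v. (1 - K v) * ?f' (W v)) - (expect (\<lambda>v. W v * ?f (W v)) - expect (\<lambda>v. K v * ?f' (W v)))"
    by (simp add: left_diff_distrib)
  finally have "measure_pmf.prob M {v. W v \<le> z} - Phi z =
      expect (\<lambda>v. (1 - K v) * ?f' (W v)) - (expect (\<lambda>v. W v * ?f (W v)) - expect (\<lambda>v. K v * ?f' (W v)))"
    unfolding prob .
  then have "\<bar>measure_pmf.prob M {v. W v \<le> z} - Phi z\<bar> \<le> \<bar>expect (\<lambda>v. (1 - K v) * ?f' (W v))\<bar>
      + \<bar>expect (\<lambda>v. W v * ?f (W v)) - expect (\<lambda>v. K v * ?f' (W v))\<bar>"
    by (simp only: abs_triangle_ineq4)
  also have "\<dots> \<le> expect (\<lambda>v. \<bar>1 - K v\<bar> * 2) + expect (\<lambda>v. \<bar>Z v\<bar>)"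
    by (intro add_mono WK abs_expect_le)
       (auto simp: abs_mult intro!: mult_left_mono abs_stein_deriv_le)
  also have "\<dots> \<le> expect (\<lambda>v. 2 * \<bar>1 - var1 * S v\<bar> + \<bar>S' v\<bar>) + expect (\<lambda>v. \<bar>Z v\<bar>)"
  \<comment> \<open>Since \<open>\<bar>1 - 2 * p\<bar> \<le> 1\<close>, the divergence inside
    \<open>K\<close> carries at most a factor 1/2, which cancels the bound 2 on the Stein
    derivative.\<close>
  proof (intro add_right_mono expect_mono)
    have *: "\<bar>1 - (x + y)\<bar> * 2 \<le> 2 * \<bar>1 - x\<bar> + s" if "\<bar>y\<bar> \<le> 1 / 2 * s" for x y s :: real
      using that abs_triangle_ineq4[of "1 - x" y] by (simp add: diff_diff_eq)
    fix v
    have "\<bar>(1 - 2 * p) / 2 * S' v\<bar> \<le> 1 / 2 * \<bar>S' v\<bar>"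
      unfolding abs_mult using p_pos p_less by (intro mult_right_mono) auto
    then show "\<bar>1 - K v\<bar> * 2 \<le> 2 * \<bar>1 - var1 * S v\<bar> + \<bar>S' v\<bar>"
      unfolding K_def by (rule *)
  qed
  finally show ?thesis by (simp add: S_def S'_def Z_def)
qed

text \<open>Discrete analogue of the isometry for Skorohod integrals. For distinct coordinates, two
  integrations by parts turn the mixed moment into the product of the two cross derivatives; the
  inequality between geometric and arithmetic means separates them, and the two resulting double
  sums coincide by symmetry.\<close>

lemma expect_square_sum_xi_le:
  assumes free: "\<And>e. e \<in> I \<Longrightarrow> free_of e (h e)"
  shows "expect (\<lambda>v. (\<Sum>e\<in>I. xi e v * h e v)\<^sup>2) \<le>
    (\<Sum>e\<in>I. expect (\<lambda>v. (h e v)\<^sup>2)) + (\<Sum>e\<in>I. \<Sum>f\<in>I - {e}. expect (\<lambda>v. (discrete_deriv f (h e) v)\<^sup>2))"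
proof -
  define d where "d = (\<lambda>e f. expect (\<lambda>v. (discrete_deriv f (h e) v)\<^sup>2))"
  have diag: "expect (\<lambda>v. (xi e v * h e v) * (xi e v * h e v)) \<le> expect (\<lambda>v. (h e v)\<^sup>2)" if "e \<in> I" for e
  proof -
    have "expect (\<lambda>v. (xi e v * h e v) * (xi e v * h e v)) = expect (\<lambda>v. (xi e v)\<^sup>2 * (h e v)\<^sup>2)"
      by (simp add: power2_eq_square mult_ac)
    also have "\<dots> = var1 * expect (\<lambda>v. (h e v)\<^sup>2)"
      using free[OF that] by (intro expect_xi_square_mult that) (simp add: free_of_def)
    also have "\<dots> \<le> expect (\<lambda>v. (h e v)\<^sup>2)"
      using var1_le_1 expect_nonneg[of "\<lambda>v. (h e v)\<^sup>2"] by (intro mult_left_le_one_le) (use var1_pos in auto)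
    finally show ?thesis .
  qed
  have off: "expect (\<lambda>v. (xi e v * h e v) * (xi f v * h f v)) \<le> (d e f + d f e) / 2"
    if "e \<in> I" "f \<in> I - {e}" for e f
  proof -
    have ef: "f \<in> I" "f \<noteq> e" using that by auto
    have "expect (\<lambda>v. (xi e v * h e v) * (xi f v * h f v)) = expect (\<lambda>v. xi e v * ((xi f v * h e v) * h f v))"
      by (simp add: mult_ac)
    also have "\<dots> = var1 * expect (\<lambda>v. (xi f v * h e v) * discrete_deriv e (h f) v)"
    proof -
      have "free_of e (\<lambda>v. xi f v * h e v)"
        using free[OF that(1)] ef by (simp add: free_of_def xi_def)
      then show ?thesis
        by (subst expect_xi_mult[OF that(1)])
           (simp add: discrete_deriv_mult_free)
    qed
    also have "\<dots> = var1 * expect (\<lambda>v. xi f v * (discrete_deriv e (h f) v * h e v))"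
      by (simp add: mult_ac)
    also have "\<dots> = var1 * (var1 * expect (\<lambda>v. discrete_deriv e (h f) v * discrete_deriv f (h e) v))"
      by (subst expect_xi_mult[OF ef(1)])
         (simp add: discrete_deriv_mult_free free_of_discrete_deriv' free ef)
    also have "\<dots> = expect (\<lambda>v. (var1 * var1) * (discrete_deriv e (h f) v * discrete_deriv f (h e) v))"
      by simp
    also have "\<dots> \<le> expect (\<lambda>v. ((discrete_deriv f (h e) v)\<^sup>2 + (discrete_deriv e (h f) v)\<^sup>2) / 2)"
    proof (rule expect_mono)
      fix v
      let ?x = "discrete_deriv e (h f) v" and ?y = "discrete_deriv f (h e) v"
      have "(var1 * var1) * (?x * ?y) \<le> \<bar>var1 * var1 * (?x * ?y)\<bar>" by simp
      also have "\<dots> \<le> 1 * \<bar>?x * ?y\<bar>"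
        unfolding abs_mult[of "var1 * var1"] using var1_pos var1_le_1
        by (intro mult_right_mono) (auto simp: mult_le_one)
      also have "\<dots> \<le> (?y\<^sup>2 + ?x\<^sup>2) / 2"
        using sum_squares_bound[of "\<bar>?x\<bar>" "\<bar>?y\<bar>"] by (simp add: abs_mult)
      finally show "(var1 * var1) * (?x * ?y) \<le> (?y\<^sup>2 + ?x\<^sup>2) / 2" .
    qed
    also have "\<dots> = (d e f + d f e) / 2" by (simp add: d_def)
    finally show ?thesis .
  qed
  have swap: "(\<Sum>e\<in>I. \<Sum>f\<in>I - {e}. d f e) = (\<Sum>e\<in>I. \<Sum>f\<in>I - {e}. d e f)"
  proof -
    have "(\<Sum>e\<in>I. \<Sum>f\<in>I - {e}. g e f) = (\<Sum>e\<in>I. \<Sum>f\<in>I. if e = f then 0 else g e f)" for g :: "'e \<Rightarrow> 'e \<Rightarrow> real"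
      by (intro sum.cong sum.mono_neutral_cong_left) (auto simp: finite_I)
    moreover have "(\<Sum>e\<in>I. \<Sum>f\<in>I. if e = f then 0 else d f e) = (\<Sum>e\<in>I. \<Sum>f\<in>I. if e = f then 0 else d e f)"
      by (subst sum.swap) (intro sum.cong, auto)
    ultimately show ?thesis by simp
  qed
  have "expect (\<lambda>v. (\<Sum>e\<in>I. xi e v * h e v)\<^sup>2) =
      (\<Sum>e\<in>I. \<Sum>f\<in>I. expect (\<lambda>v. (xi e v * h e v) * (xi f v * h f v)))"
    by (simp add: power2_eq_square sum_product)
  also have "\<dots> = (\<Sum>e\<in>I. expect (\<lambda>v. (xi e v * h e v) * (xi e v * h e v)) +
      (\<Sum>f\<in>I - {e}. expect (\<lambda>v. (xi e v * h e v) * (xi f v * h f v))))"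
    by (intro sum.cong refl sum.remove finite_I)
  also have "\<dots> \<le> (\<Sum>e\<in>I. expect (\<lambda>v. (h e v)\<^sup>2) + (\<Sum>f\<in>I - {e}. (d e f + d f e) / 2))"
    by (intro sum_mono add_mono diag off)
  also have "\<dots> = (\<Sum>e\<in>I. expect (\<lambda>v. (h e v)\<^sup>2)) + (\<Sum>e\<in>I. \<Sum>f\<in>I - {e}. d e f)"
    using swap by (simp add: sum.distrib sum_divide_distrib[symmetric])
  finally show ?thesis by (simp add: d_def)
qed

end

text \<open>Induction on the coordinates by the law of total variance: the induction hypothesis
  bounds the variance given the new coordinate, and the two conditional means contribute
  \<open>p * (1 - p)\<close> times their squared difference, at most the mean squared derivative. It
  is stated outside the locale because the index set changes in the induction.\<close>

lemma bernoulli_poincare: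
  fixes X :: "('e \<Rightarrow> bool) \<Rightarrow> real"
  assumes "finite I" "0 < p" "p < 1"
  defines "E \<equiv> \<lambda>J. measure_pmf.expectation (Pi_pmf J False (\<lambda>_. bernoulli_pmf p))"
  shows "E I (\<lambda>v. (X v)\<^sup>2) \<le> (E I X)\<^sup>2 + p * (1 - p) * (\<Sum>e\<in>I. E I (\<lambda>v. (discrete_deriv e X v)\<^sup>2))"
  using assms(1)
proof (induction I arbitrary: X)
  case empty
  then show ?case by (simp add: E_def)
next
  case (insert e J)
  interpret J: bernoulli_cube J p
    by standard (use insert assms in auto)
  note ins = expectation_Pi_pmf_insert_bernoulli[OF insert.hyps(1,2), of p]
  let ?X = "\<lambda>b v. X (v(e := b))"
  let ?D = "\<lambda>b. \<Sum>f\<in>J. E J (\<lambda>v. (discrete_deriv f (?X b) v)\<^sup>2)"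
  have split: "E (insert e J) Y = p * E J (\<lambda>v. Y (v(e := True))) + (1 - p) * E J (\<lambda>v. Y (v(e := False)))" for Y
    using ins[of Y] assms(2,3) by (simp add: E_def)
  have IH: "E J (\<lambda>v. (?X b v)\<^sup>2) \<le> (E J (?X b))\<^sup>2 + p * (1 - p) * ?D b" for b
    by (rule insert.IH)
  have D_e: "E (insert e J) (\<lambda>v. (discrete_deriv e X v)\<^sup>2) = E J (\<lambda>v. (?X True v - ?X False v)\<^sup>2)"
    unfolding split by (simp add: discrete_deriv_def algebra_simps)
  have D_f: "(\<Sum>f\<in>J. E (insert e J) (\<lambda>v. (discrete_deriv f X v)\<^sup>2)) = p * ?D True + (1 - p) * ?D False"
  proof -
    have "E (insert e J) (\<lambda>v. (discrete_deriv f X v)\<^sup>2) =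
        p * E J (\<lambda>v. (discrete_deriv f (?X True) v)\<^sup>2) + (1 - p) * E J (\<lambda>v. (discrete_deriv f (?X False) v)\<^sup>2)"
      if "f \<in> J" for f
    proof -
      have "f \<noteq> e" using that insert.hyps by auto
      then show ?thesis unfolding split by (simp add: discrete_deriv_def fun_upd_twist[of e f])
    qed
    then show ?thesis by (simp add: sum.distrib sum_distrib_left)
  qed
  have "(E J (?X True) - E J (?X False))\<^sup>2 \<le> E J (\<lambda>v. (?X True v - ?X False v)\<^sup>2)"
    using J.square_expect_le[of "\<lambda>v. ?X True v - ?X False v"] by (simp add: E_def)
  then have *: "p * (1 - p) * (E J (?X True) - E J (?X False))\<^sup>2 \<le> p * (1 - p) * E J (\<lambda>v. (?X True v - ?X False v)\<^sup>2)"
    using assms by (intro mult_left_mono) auto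
  have "E (insert e J) (\<lambda>v. (X v)\<^sup>2) = p * E J (\<lambda>v. (?X True v)\<^sup>2) + (1 - p) * E J (\<lambda>v. (?X False v)\<^sup>2)"
    by (rule split)
  also have "\<dots> \<le> p * ((E J (?X True))\<^sup>2 + p * (1 - p) * ?D True) + (1 - p) * ((E J (?X False))\<^sup>2 + p * (1 - p) * ?D False)"
    using assms by (intro add_mono mult_left_mono IH) auto
  also have "\<dots> = (p * E J (?X True) + (1 - p) * E J (?X False))\<^sup>2 + p * (1 - p) * (E J (?X True) - E J (?X False))\<^sup>2
      + p * (1 - p) * (p * ?D True + (1 - p) * ?D False)"
    by (simp add: power2_eq_square algebra_simps)
  also have "\<dots> \<le> (E (insert e J) X)\<^sup>2 + p * (1 - p) * (E (insert e J) (\<lambda>v. (discrete_deriv e X v)\<^sup>2)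
      + (\<Sum>f\<in>J. E (insert e J) (\<lambda>v. (discrete_deriv f X v)\<^sup>2)))"
    unfolding D_e D_f split[of X] using * by (simp add: algebra_simps)
  also have "\<dots> = (E (insert e J) X)\<^sup>2 + p * (1 - p) * (\<Sum>f\<in>insert e J. E (insert e J) (\<lambda>v. (discrete_deriv f X v)\<^sup>2))"
    using insert.hyps by simp
  finally show ?case .
qed

section \<open>Walsh expansions\<close>

context bernoulli_cube
begin

definition chi :: "'e set \<Rightarrow> ('e \<Rightarrow> bool) \<Rightarrow> real" where
  "chi A v = (\<Prod>e\<in>A. xi e v)"

lemma chi_empty [simp]: "chi {} v = 1"
  by (simp add: chi_def)

lemma chi_insert: "finite A \<Longrightarrow> e \<notin> A \<Longrightarrow> chi (insert e A) v = xi e v * chi A v"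
  by (simp add: chi_def)

lemma chi_remove: "finite A \<Longrightarrow> e \<in> A \<Longrightarrow> chi A v = xi e v * chi (A - {e}) v"
  by (simp add: chi_def prod.remove)

lemma chi_Un_disjoint:
  "finite A \<Longrightarrow> finite B \<Longrightarrow> A \<inter> B = {} \<Longrightarrow> chi (A \<union> B) v = chi A v * chi B v"
  by (simp add: chi_def prod.union_disjoint)

lemma free_of_chi: "e \<notin> A \<Longrightarrow> free_of e (chi A)"
  by (auto simp: free_of_def chi_def xi_def intro!: prod.cong)

lemma abs_xi_le_1: "\<bar>xi e v\<bar> \<le> 1"
  using p_pos p_less by (auto simp: xi_def)

lemma abs_chi_le_1: "\<bar>chi A v\<bar> \<le> 1"
  unfolding chi_def abs_prod by (rule prod_le_1) (auto simp: abs_xi_le_1)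

lemma discrete_deriv_chi:
  assumes "finite A"
  shows "discrete_deriv e (chi A) v = (if e \<in> A then chi (A - {e}) v else 0)"
proof (cases "e \<in> A")
  case True
  then show ?thesis
    using free_ofD[OF free_of_chi[of e "A - {e}"]]
    by (simp add: discrete_deriv_def chi_remove[OF assms True] xi_def algebra_simps)
next
  case False
  then show ?thesis
    by (simp add: discrete_deriv_def free_ofD[OF free_of_chi])
qed

text \<open>Orthogonality: a coordinate occurring in only one of the two sets integrates to
  zero.\<close>

lemma expect_chi_mult:
  assumes "A \<subseteq> I" "B \<subseteq> I"
  shows "expect (\<lambda>v. chi A v * chi B v) = (if A = B then var1 ^ card A else 0)"
proof -
  have zero: "expect (\<lambda>v. chi A v * chi B v) = 0" if "A \<subseteq> I" "e \<in> A" "e \<notin> B" for A B e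
  proof -
    have fin: "finite A" using that finite_I finite_subset by auto
    have "free_of e (\<lambda>v. chi (A - {e}) v * chi B v)"
      using that by (intro free_of_mult free_of_chi) auto
    then have "discrete_deriv e (\<lambda>v. chi (A - {e}) v * chi B v) = (\<lambda>_. 0)"
      unfolding discrete_deriv_eq by (simp only: free_ofD[of e "\<lambda>v. chi (A - {e}) v * chi B v"] diff_self)
    moreover have "(\<lambda>v. chi A v * chi B v) = (\<lambda>v. xi e v * (chi (A - {e}) v * chi B v))"
      using chi_remove[OF fin that(2)] by (simp add: mult.assoc)
    ultimately show ?thesis
      using expect_xi_mult[of e] that by auto
  qed
  have diag: "expect (\<lambda>v. chi A v * chi A v) = var1 ^ card A" if "finite A" "A \<subseteq> I" for A
    using that
  proof (induction A)
    case (insert e A)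
    have "expect (\<lambda>v. chi (insert e A) v * chi (insert e A) v) =
        expect (\<lambda>v. (xi e v)\<^sup>2 * (chi A v * chi A v))"
      using insert.hyps by (simp add: chi_insert power2_eq_square mult_ac)
    also have "\<dots> = var1 * expect (\<lambda>v. chi A v * chi A v)"
      using insert by (intro expect_xi_square_mult free_of_mult free_of_chi) auto
    finally show ?case using insert by simp
  qed simp
  show ?thesis
  proof (cases "A = B")
    case True
    then show ?thesis using diag[of A] assms finite_subset[OF _ finite_I] by auto
  next
    case False
    then consider e where "e \<in> A" "e \<notin> B" | e where "e \<in> B" "e \<notin> A" by auto
    then show ?thesis
      using zero[of A _ B] zero[of B _ A] assms False by cases (auto simp: mult.commute)
  qed
qed

lemma expect_chi: "A \<subseteq> I \<Longrightarrow> expect (chi A) = (if A = {} then 1 else 0)"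
  using expect_chi_mult[of A "{}"] by simp

text \<open>On every shared coordinate the square of \<open>xi\<close> is
  \<open>(1 - 2 * p) * xi + var1\<close>. The set \<open>R\<close> records the shared coordinates at
  which the linear term is chosen.\<close>

lemma chi_mult_chi:
  assumes "finite A" "finite B"
  shows "chi A v * chi B v =
    (\<Sum>R\<in>Pow (A \<inter> B). (1 - 2 * p) ^ card R * var1 ^ card (A \<inter> B - R) * chi ((A - B) \<union> (B - A) \<union> R) v)"
proof -
  have sq: "xi e v * xi e v = (1 - 2 * p) * xi e v + var1" for e
    by (auto simp: xi_def var1_def algebra_simps)
  have "chi C v = chi (C - D) v * chi (C \<inter> D) v" if "finite C" for C D
    using chi_Un_disjoint[of "C - D" "C \<inter> D" v] that Un_Diff_Int[of C D]
    by (simp add: disjoint_iff)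
  from this[of A B] this[of B A]
  have split: "chi A v = chi (A - B) v * chi (A \<inter> B) v" "chi B v = chi (B - A) v * chi (A \<inter> B) v"
    using assms by (simp_all add: Int_commute)
  have "chi A v * chi B v = chi (A - B) v * chi (B - A) v * (\<Prod>e\<in>A \<inter> B. xi e v * xi e v)"
    unfolding split by (simp add: chi_def[of "A \<inter> B"] prod.distrib)
  also have "(\<Prod>e\<in>A \<inter> B. xi e v * xi e v) =
      (\<Sum>R\<in>Pow (A \<inter> B). (\<Prod>e\<in>R. (1 - 2 * p) * xi e v) * (\<Prod>e\<in>A \<inter> B - R. var1))"
    unfolding sq by (rule prod_add) (use assms in simp)
  also have "chi (A - B) v * chi (B - A) v * \<dots> =
      (\<Sum>R\<in>Pow (A \<inter> B). (1 - 2 * p) ^ card R * var1 ^ card (A \<inter> B - R) * chi ((A - B) \<union> (B - A) \<union> R) v)"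
    unfolding sum_distrib_left
  proof (rule sum.cong[OF refl])
    fix R assume "R \<in> Pow (A \<inter> B)"
    then have R: "R \<subseteq> A \<inter> B" "finite R" using assms finite_subset by auto
    have "chi ((A - B) \<union> (B - A) \<union> R) v = chi (A - B) v * chi (B - A) v * chi R v"
    proof -
      have "(A - B \<union> (B - A)) \<inter> R = {}" "(A - B) \<inter> (B - A) = {}" using R by auto
      then show ?thesis using R assms by (simp add: chi_Un_disjoint)
    qed
    then show "chi (A - B) v * chi (B - A) v * ((\<Prod>e\<in>R. (1 - 2 * p) * xi e v) * (\<Prod>e\<in>A \<inter> B - R. var1)) =
        (1 - 2 * p) ^ card R * var1 ^ card (A \<inter> B - R) * chi ((A - B) \<union> (B - A) \<union> R) v"
      by (simp add: prod.distrib chi_def)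
  qed
  finally show ?thesis .
qed

lemma expect_square_sum_chi:
  assumes "finite J" "inj_on S J" "\<And>j. j \<in> J \<Longrightarrow> S j \<subseteq> I"
  shows "expect (\<lambda>v. (\<Sum>j\<in>J. c j * chi (S j) v)\<^sup>2) = (\<Sum>j\<in>J. (c j)\<^sup>2 * var1 ^ card (S j))"
proof -
  have "expect (\<lambda>v. (\<Sum>j\<in>J. c j * chi (S j) v)\<^sup>2) =
      expect (\<lambda>v. \<Sum>j\<in>J. \<Sum>i\<in>J. c j * c i * (chi (S j) v * chi (S i) v))"
    by (simp add: power2_eq_square sum_product mult_ac)
  also have "\<dots> = (\<Sum>j\<in>J. \<Sum>i\<in>J. c j * c i * expect (\<lambda>v. chi (S j) v * chi (S i) v))"
    by simp
  also have "\<dots> = (\<Sum>j\<in>J. \<Sum>i\<in>J. if j = i then (c j)\<^sup>2 * var1 ^ card (S j) else 0)"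
    using assms by (intro sum.cong refl) (auto simp: expect_chi_mult power2_eq_square dest: inj_onD)
  also have "\<dots> = (\<Sum>j\<in>J. (c j)\<^sup>2 * var1 ^ card (S j))"
    using assms(1) by (intro sum.cong refl) simp
  finally show ?thesis .
qed

text \<open>Different indices may produce the same Walsh function, so coefficients are first
  collected by \<open>T = S j\<close>; orthogonality then applies. The empty set is the mean and
  drops out.\<close>

lemma variance_sum_chi_le:
  fixes c :: "'j \<Rightarrow> real" and S :: "'j \<Rightarrow> 'e set"
  assumes "finite J" "\<And>j. j \<in> J \<Longrightarrow> S j \<subseteq> I"
  defines "Y \<equiv> \<lambda>v. \<Sum>j\<in>J. c j * chi (S j) v"
  shows "expect (\<lambda>v. (Y v - expect Y)\<^sup>2) \<le> (\<Sum>T\<in>S ` J - {{}}. (\<Sum>j | j \<in> J \<and> S j = T. \<bar>c j\<bar>)\<^sup>2)"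
proof -
  define d where "d = (\<lambda>T. \<Sum>j | j \<in> J \<and> S j = T. c j)"
  have Y: "Y v = (\<Sum>T\<in>S ` J. d T * chi T v)" for v
    unfolding Y_def d_def sum.image_gen[OF assms(1), of _ S] sum_distrib_right
    by (intro sum.cong refl) auto
  have SI: "T \<subseteq> I" if "T \<in> S ` J" for T using that assms by auto
  have fin: "finite (S ` J)" using assms by simp
  have "expect Y = (\<Sum>T\<in>S ` J. d T * expect (chi T))"
    unfolding Y[abs_def] by simp
  also have "\<dots> = (\<Sum>T\<in>S ` J. if T = {} then d {} else 0)"
    by (intro sum.cong refl) (auto simp: expect_chi[OF SI])
  also have "\<dots> = (if {} \<in> S ` J then d {} else 0)"
    using fin by simp
  finally have "Y v - expect Y = (\<Sum>T\<in>S ` J - {{}}. d T * chi T v)" for v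
    unfolding Y using fin by (auto simp: sum_diff1)
  then have "expect (\<lambda>v. (Y v - expect Y)\<^sup>2) = (\<Sum>T\<in>S ` J - {{}}. (d T)\<^sup>2 * var1 ^ card T)"
    using expect_square_sum_chi[of "S ` J - {{}}" "\<lambda>T. T" d] fin SI by auto
  also have "\<dots> \<le> (\<Sum>T\<in>S ` J - {{}}. (\<Sum>j | j \<in> J \<and> S j = T. \<bar>c j\<bar>)\<^sup>2)"
  proof (rule sum_mono)
    fix T
    have "(d T)\<^sup>2 * var1 ^ card T \<le> (d T)\<^sup>2 * 1"
      using var1_pos var1_le_1 by (intro mult_left_mono power_le_one) auto
    also have "\<bar>d T\<bar> \<le> (\<Sum>j | j \<in> J \<and> S j = T. \<bar>c j\<bar>)"
      unfolding d_def by (rule sum_abs)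
    then have "(d T)\<^sup>2 * 1 \<le> (\<Sum>j | j \<in> J \<and> S j = T. \<bar>c j\<bar>)\<^sup>2"
      using power_mono[of "\<bar>d T\<bar>" _ 2] by simp
    finally show "(d T)\<^sup>2 * var1 ^ card T \<le> (\<Sum>j | j \<in> J \<and> S j = T. \<bar>c j\<bar>)\<^sup>2" .
  qed
  finally show ?thesis .
qed

section \<open>Walsh series and their discrete derivatives\<close>

definition walsh :: "('e set \<Rightarrow> real) \<Rightarrow> ('e \<Rightarrow> bool) \<Rightarrow> real" where
  "walsh w v = (\<Sum>A\<in>Pow I. w A * chi A v)"

text \<open>With the coefficients \<open>w\<close> this is the discrete derivative of the series;
  with \<open>w A / card A\<close> it is the factor \<open>a\<close> of the Stein bound. Keeping the
  coefficients as a parameter treats both at once.\<close>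

definition slice :: "('e set \<Rightarrow> real) \<Rightarrow> 'e \<Rightarrow> ('e \<Rightarrow> bool) \<Rightarrow> real" where
  "slice w e v = (\<Sum>A | A \<subseteq> I \<and> e \<in> A. w A * chi (A - {e}) v)"

lemma finite_subsets_I: "finite {A. A \<subseteq> I \<and> P A}"
  by (rule finite_subset[of _ "Pow I"]) (auto simp: finite_I)

lemma discrete_deriv_walsh: "discrete_deriv e (walsh w) = slice w e"
proof
  fix v
  have "discrete_deriv e (walsh w) v = (\<Sum>A\<in>Pow I. w A * discrete_deriv e (chi A) v)"
    by (simp add: discrete_deriv_def walsh_def sum_subtractf right_diff_distrib)
  also have "\<dots> = slice w e v"
    unfolding slice_def using finite_subset[OF _ finite_I]
    by (intro sum.mono_neutral_cong_right) (auto simp: discrete_deriv_chi finite_I)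
  finally show "discrete_deriv e (walsh w) v = slice w e v" .
qed

lemma free_of_slice: "free_of e (slice w e)"
  unfolding discrete_deriv_walsh[symmetric] by (rule free_of_discrete_deriv)

lemma abs_discrete_deriv_slice_le:
  "\<bar>discrete_deriv f (slice w e) v\<bar> \<le> (\<Sum>A | A \<subseteq> I \<and> e \<in> A \<and> f \<in> A. \<bar>w A\<bar>)"
proof -
  have "discrete_deriv f (slice w e) v =
      (\<Sum>A | A \<subseteq> I \<and> e \<in> A. w A * discrete_deriv f (chi (A - {e})) v)"
    by (simp add: discrete_deriv_def slice_def sum_subtractf right_diff_distrib)
  also have "\<bar>\<dots>\<bar> \<le> (\<Sum>A | A \<subseteq> I \<and> e \<in> A. \<bar>w A * discrete_deriv f (chi (A - {e})) v\<bar>)"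
    by (rule sum_abs)
  also have "\<dots> \<le> (\<Sum>A | A \<subseteq> I \<and> e \<in> A. if f \<in> A then \<bar>w A\<bar> else 0)"
  proof (rule sum_mono)
    fix A assume "A \<in> {A. A \<subseteq> I \<and> e \<in> A}"
    then have "finite A" using finite_subset[OF _ finite_I] by auto
    then show "\<bar>w A * discrete_deriv f (chi (A - {e})) v\<bar> \<le> (if f \<in> A then \<bar>w A\<bar> else 0)"
      using mult_left_mono[OF abs_chi_le_1[of "A - {e} - {f}" v], of "\<bar>w A\<bar>"]
      by (auto simp: discrete_deriv_chi abs_mult)
  qed
  also have "\<dots> = (\<Sum>A | A \<subseteq> I \<and> e \<in> A \<and> f \<in> A. \<bar>w A\<bar>)"
    by (intro sum.mono_neutral_cong_right) (auto simp: finite_subsets_I)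
  finally show ?thesis .
qed

lemma expect_slice_square_le:
  "expect (\<lambda>v. (slice w e v)\<^sup>2) \<le> (\<Sum>A | A \<subseteq> I \<and> e \<in> A. (w A)\<^sup>2)"
proof -
  have "expect (\<lambda>v. (slice w e v)\<^sup>2) = (\<Sum>A | A \<subseteq> I \<and> e \<in> A. (w A)\<^sup>2 * var1 ^ card (A - {e}))"
    unfolding slice_def
    by (rule expect_square_sum_chi) (auto simp: finite_subsets_I inj_on_def)
  also have "\<dots> \<le> (\<Sum>A | A \<subseteq> I \<and> e \<in> A. (w A)\<^sup>2)"
    using var1_pos var1_le_1 by (intro sum_mono mult_left_le power_le_one) auto
  finally show ?thesis .
qed

text \<open>On the right each \<open>chi A\<close> appears once for every \<open>e\<close> in
  \<open>A\<close>, and division by \<open>card A\<close> undoes this multiplicity. The empty set is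
  never reached, so its coefficient has to vanish.\<close>

lemma walsh_eq_sum_xi:
  assumes "w {} = 0"
  shows "walsh w v = (\<Sum>e\<in>I. xi e v * slice (\<lambda>A. w A / card A) e v)"
proof -
  have "(\<Sum>e\<in>I. xi e v * slice (\<lambda>A. w A / card A) e v) =
      (\<Sum>e\<in>I. \<Sum>A | A \<subseteq> I \<and> e \<in> A. w A / card A * chi A v)"
    unfolding slice_def sum_distrib_left
    using finite_subset[OF _ finite_I] by (intro sum.cong refl) (auto simp: chi_remove)
  also have "\<dots> = (\<Sum>A\<in>Pow I. \<Sum>e | e \<in> I \<and> e \<in> A. w A / card A * chi A v)"
    using sum.swap_restrict[of I "Pow I" "\<lambda>e A. w A / card A * chi A v" "\<lambda>e A. e \<in> A"] finite_I
    by (simp add: Pow_def)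
  also have "\<dots> = (\<Sum>A\<in>Pow I. w A * chi A v)"
  proof (rule sum.cong[OF refl])
    fix A assume A: "A \<in> Pow I"
    then have "{e. e \<in> I \<and> e \<in> A} = A" "finite A" using finite_subset[OF _ finite_I] by auto
    then show "(\<Sum>e | e \<in> I \<and> e \<in> A. w A / card A * chi A v) = w A * chi A v"
      using assms by (cases "A = {}") auto
  qed
  finally show ?thesis by (simp add: walsh_def)
qed

lemma expect_walsh_square: "expect (\<lambda>v. (walsh w v)\<^sup>2) = (\<Sum>A\<in>Pow I. (w A)\<^sup>2 * var1 ^ card A)"
  unfolding walsh_def by (rule expect_square_sum_chi) (auto simp: finite_I)

lemma expect_walsh: "expect (walsh w) = w {}"
proof -
  have "expect (walsh w) = (\<Sum>A\<in>Pow I. w A * expect (chi A))"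
    unfolding walsh_def by simp
  also have "\<dots> = (\<Sum>A\<in>Pow I. if A = {} then w {} else 0)"
    by (intro sum.cong refl) (auto simp: expect_chi)
  finally show ?thesis using finite_I by simp
qed

text \<open>Integration by parts in \<open>E[W\<^sup>2]\<close>.\<close>

lemma expect_sum_slice_product:
  assumes "w {} = 0"
  shows "var1 * expect (\<lambda>v. \<Sum>e\<in>I. slice (\<lambda>A. w A / card A) e v * slice w e v) =
    (\<Sum>A\<in>Pow I. (w A)\<^sup>2 * var1 ^ card A)"
proof -
  have "expect (\<lambda>v. (walsh w v)\<^sup>2) =
      expect (\<lambda>v. \<Sum>e\<in>I. xi e v * slice (\<lambda>A. w A / card A) e v * walsh w v)"
    by (simp add: power2_eq_square sum_distrib_right[symmetric] walsh_eq_sum_xi[where w = w, OF assms, symmetric])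
  also have "\<dots> = (\<Sum>e\<in>I. expect (\<lambda>v. xi e v * slice (\<lambda>A. w A / card A) e v * walsh w v))"
    by simp
  also have "\<dots> = (\<Sum>e\<in>I. var1 * expect (\<lambda>v. slice (\<lambda>A. w A / card A) e v * slice w e v))"
    by (intro sum.cong refl) (simp only: expect_xi_mult_free[OF _ free_of_slice] discrete_deriv_walsh)
  finally show ?thesis
    by (simp add: expect_walsh_square sum_distrib_left)
qed

text \<open>Both values of a coordinate have probability at least \<open>var1\<close>, so forcing
  the value multiplies a nonnegative mean by at most \<open>1 / var1\<close>.\<close>

lemma expect_conditional_le:
  assumes "f \<in> I" "\<And>v. 0 \<le> X v"
  shows "expect (\<lambda>v. X (v(f := True)) + X (v(f := False))) \<le> expect X / var1"
proof -
  have "expect (\<lambda>v. X (v(f := True)) + X (v(f := False)))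
      \<le> expect (\<lambda>v. (p * X (v(f := True)) + (1 - p) * X (v(f := False))) / var1)"
  proof (rule expect_mono)
    fix v
    have "1 \<le> p / var1" "1 \<le> (1 - p) / var1"
      using p_pos p_less by (simp_all add: var1_def)
    then have "X (v(f := True)) * 1 \<le> X (v(f := True)) * (p / var1)"
      "X (v(f := False)) * 1 \<le> X (v(f := False)) * ((1 - p) / var1)"
      by (intro mult_left_mono assms(2); simp)+
    then show "X (v(f := True)) + X (v(f := False))
      \<le> (p * X (v(f := True)) + (1 - p) * X (v(f := False))) / var1"
      by (simp add: add_divide_distrib mult.commute)
  qed
  also have "\<dots> = expect X / var1"
    by (subst expect_resample[OF assms(1), of X]) (rule integral_divide_zero)
  finally show ?thesis .
qed

end

section \<open>Kolmogorov bounds for weighted sums over edge sets\<close>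

lemma sum_fibres_le:
  fixes G :: "'b \<Rightarrow> real"
  assumes "finite J" "\<And>j. j \<in> J \<Longrightarrow> 0 \<le> G (D j)"
    and "\<And>j. j \<in> J \<Longrightarrow> real (card {i \<in> J. D i = D j}) \<le> m"
  shows "(\<Sum>j\<in>J. G (D j)) \<le> m * (\<Sum>d\<in>D ` J. G d)"
proof -
  have "(\<Sum>j\<in>J. G (D j)) = (\<Sum>d\<in>D ` J. \<Sum>j | j \<in> J \<and> D j = d. G (D j))"
    by (rule sum.image_gen[OF assms(1)])
  also have "\<dots> = (\<Sum>d\<in>D ` J. real (card {j \<in> J. D j = d}) * G d)"
    by (intro sum.cong refl) simp
  also have "\<dots> \<le> (\<Sum>d\<in>D ` J. m * G d)"
    using assms by (intro sum_mono mult_right_mono) auto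
  finally show ?thesis by (simp add: sum_distrib_left)
qed

lemma powr_minus_nat: "0 < x \<Longrightarrow> x powr (- real m) = (1 / x) ^ m"
  by (simp add: powr_minus powr_realpow power_inverse divide_inverse)

lemma power2_le_of_abs_le: "\<bar>x\<bar> \<le> d \<Longrightarrow> x\<^sup>2 \<le> d\<^sup>2" for x d :: real
  using abs_le_square_iff[of x d] by linarith

text \<open>Writing \<open>U\<close> as \<open>V\<close> plus added vertices, the sum factors into
  \<open>n powr - card V\<close> times at most \<open>(1 + 1 / n) ^ n\<close>, which is below
  Euler's number and hence below 3.\<close>

lemma sum_powr_supersets_le:
  assumes "1 \<le> n"
  shows "(\<Sum>U | U \<subseteq> {1..n} \<and> V \<subseteq> U. real n powr (- real (card U))) \<le> 3 * real n powr (- real (card V))"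
proof (cases "V \<subseteq> {1..n}")
  case True
  have fin: "finite V" using True finite_subset by auto
  have n: "0 < real n" using assms by simp
  have "(\<Prod>x\<in>{1..n} - V. 1 / real n + 1) \<le> (1 / real n + 1) ^ n"
    using card_mono[of "{1..n}" "{1..n} - V"] by (auto intro!: power_increasing)
  also have "\<dots> \<le> exp (1 / real n) ^ n"
    using exp_ge_add_one_self[of "1 / real n"] by (intro power_mono) (auto simp: add.commute)
  also have "\<dots> = exp 1"
    using n by (simp add: exp_of_nat_mult[symmetric])
  also have "\<dots> \<le> 3" by (rule exp_le)
  finally have prod_le: "(\<Prod>x\<in>{1..n} - V. 1 / real n + 1) \<le> 3" .
  have "(\<Sum>U | U \<subseteq> {1..n} \<and> V \<subseteq> U. real n powr (- real (card U))) =
      (\<Sum>D\<in>Pow ({1..n} - V). real n powr (- real (card (V \<union> D))))"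
    by (rule sum.reindex_bij_witness[of _ "\<lambda>D. V \<union> D" "\<lambda>U. U - V"]) (use True in \<open>auto simp: Un_absorb1\<close>)
  also have "\<dots> = (\<Sum>D\<in>Pow ({1..n} - V). real n powr (- real (card V)) * ((\<Prod>x\<in>D. 1 / real n) * (\<Prod>x\<in>{1..n} - V - D. 1)))"
  proof (rule sum.cong[OF refl])
    fix D assume "D \<in> Pow ({1..n} - V)"
    then have "finite D" "V \<inter> D = {}" using finite_subset by auto
    then show "real n powr (- real (card (V \<union> D))) =
        real n powr (- real (card V)) * ((\<Prod>x\<in>D. 1 / real n) * (\<Prod>x\<in>{1..n} - V - D. 1))"
      using fin n by (simp add: card_Un_disjoint powr_minus_nat power_add del: of_nat_add)
  qed
  also have "\<dots> = real n powr (- real (card V)) * (\<Prod>x\<in>{1..n} - V. 1 / real n + 1)"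
    by (subst prod_add) (auto simp: sum_distrib_left)
  also have "\<dots> \<le> real n powr (- real (card V)) * 3"
    by (intro mult_left_mono prod_le) simp
  finally show ?thesis by (simp add: mult.commute)
next
  case False
  then have "{U. U \<subseteq> {1..n} \<and> V \<subseteq> U} = {}" by auto
  then show ?thesis by (simp only: sum.empty) simp
qed

text \<open>The 3 comes from the sum over vertex sets; \<open>2 ^ (2 ^ L)\<close> bounds the number
  of edge sets covering one given set of at most \<open>L\<close> vertices.\<close>

definition edge_set_const :: "nat \<Rightarrow> real" where
  "edge_set_const L = 3 * 2 ^ (2 ^ L)"

lemma edge_set_const_nonneg: "0 \<le> edge_set_const L"
  by (simp add: edge_set_const_def)

text \<open>The power counting principle: edge sets are grouped by the vertices they cover, and a
  vertex outside \<open>V\<close> costs nothing because its n choices balance its factor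
  1/n.\<close>

lemma sum_powr_edge_sets_le:
  assumes "1 \<le> n"
  shows "(\<Sum>A | A \<subseteq> nsets {1..n} 2 \<and> V \<subseteq> \<Union>A \<and> card (\<Union>A) \<le> L. real n powr (- real (card (\<Union>A))))
    \<le> edge_set_const L * real n powr (- real (card V))"
proof -
  let ?J = "{A. A \<subseteq> nsets {1..n} 2 \<and> V \<subseteq> \<Union>A \<and> card (\<Union>A) \<le> L}"
  let ?G = "\<lambda>U. real n powr (- real (card U))"
  have finJ: "finite ?J"
    by (rule finite_subset[of _ "Pow (nsets {1..n} 2)"]) (auto simp: finite_imp_finite_nsets)
  have sub: "\<Union>A \<subseteq> {1..n}" if "A \<subseteq> nsets {1..n} 2" for A
    using that by (auto simp: nsets_def)
  have "(\<Sum>A\<in>?J. ?G (\<Union>A)) \<le> 2 ^ (2 ^ L) * (\<Sum>U\<in>Union ` ?J. ?G U)"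
  proof (rule sum_fibres_le[OF finJ])
    fix A assume A: "A \<in> ?J"
    have fin: "finite (\<Union>A)" by (rule finite_subset[OF sub]) (use A in auto)
    have "card {B \<in> ?J. \<Union>B = \<Union>A} \<le> card (Pow (Pow (\<Union>A)))"
      by (rule card_mono) (use fin in auto)
    also have "\<dots> = 2 ^ (2 ^ card (\<Union>A))" using fin by (simp add: card_Pow)
    also have "\<dots> \<le> 2 ^ (2 ^ L)" using A by (intro power_increasing) auto
    finally have "real (card {B \<in> ?J. \<Union>B = \<Union>A}) \<le> real (2 ^ (2 ^ L))" by (rule of_nat_mono)
    then show "real (card {B \<in> ?J. \<Union>B = \<Union>A}) \<le> 2 ^ (2 ^ L)" by simp
  qed simp
  also have "\<dots> \<le> 2 ^ (2 ^ L) * (\<Sum>U | U \<subseteq> {1..n} \<and> V \<subseteq> U. ?G U)"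
    using sub by (intro mult_left_mono sum_mono2) auto
  also have "\<dots> \<le> 2 ^ (2 ^ L) * (3 * ?G V)"
    by (intro mult_left_mono sum_powr_supersets_le assms) simp
  finally show ?thesis by (simp add: edge_set_const_def)
qed

definition second_moment_const :: "nat \<Rightarrow> real \<Rightarrow> real" where
  "second_moment_const k C = C\<^sup>2 * edge_set_const k"

text \<open>The argument 4 bounds the number of vertices of two edges.\<close>

definition deriv_const :: "nat \<Rightarrow> real \<Rightarrow> real" where
  "deriv_const k C = (C * edge_set_const k)\<^sup>2 * edge_set_const 4"

definition fourth_moment_const :: "nat \<Rightarrow> real \<Rightarrow> real" where
  "fourth_moment_const k C = (second_moment_const k C)\<^sup>2 + 2 * deriv_const k C * second_moment_const k C"

definition divergence_const :: "nat \<Rightarrow> real \<Rightarrow> real \<Rightarrow> real" where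
  "divergence_const k p C = fourth_moment_const k C + 4 * deriv_const k C * second_moment_const k C / (p * (1 - p))"

lemma divergence_const_nonneg: "0 < p \<Longrightarrow> p < 1 \<Longrightarrow> 0 \<le> divergence_const k p C"
  by (auto intro!: add_nonneg_nonneg mult_nonneg_nonneg divide_nonneg_nonneg
      simp: divergence_const_def fourth_moment_const_def deriv_const_def second_moment_const_def edge_set_const_nonneg)

text \<open>The tower \<open>2 ^ (4 * 2 ^ (2 * k))\<close> bounds the number of quadruples
  \<open>(e, A, B, R)\<close> with a given union \<open>A \<union> B\<close>, an edge set on at most
  \<open>2 * k\<close> vertices.\<close>

definition variance_const :: "nat \<Rightarrow> real \<Rightarrow> real" where
  "variance_const k C = (C\<^sup>2 * (2 ^ (4 * 2 ^ (2 * k)) * edge_set_const (2 * k)))\<^sup>2 * edge_set_const (2 * k)"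

text \<open>
  In the last assumption, \<open>S\<close> ranges over the edge sets occurring in the expansion of
  \<open>\<chi>\<^bsub>A - e\<^esub> \<chi>\<^bsub>B - e\<^esub>\<close>. A pair \<open>(A, B)\<close> whose union covers \<open>u\<close> vertices has weight about
  \<open>n powr (g - |\<Union>A| - |\<Union>B|)\<close>, and each \<open>S\<close> is produced by \<open>n ^ (u - |\<Union>S|)\<close> such pairs.
\<close>

locale graph_weights =
  fixes n k g :: nat and p C \<theta> :: real and w :: "nat set set \<Rightarrow> real"
  assumes p: "0 < p" "p < 1" and n: "1 \<le> n" and g: "2 \<le> g" "g \<le> 3" and C: "0 \<le> C"
    and weight_le: "\<And>A. A \<subseteq> nsets {1..n} 2 \<Longrightarrow> \<bar>w A\<bar> \<le> C * real n powr (real g / 2 - real (card (\<Union>A)))"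
    and weight_support: "\<And>A. A \<subseteq> nsets {1..n} 2 \<Longrightarrow> w A \<noteq> 0 \<Longrightarrow> g \<le> card (\<Union>A) \<and> card (\<Union>A) \<le> k"
    and weight_normalized: "(\<Sum>A\<in>Pow (nsets {1..n} 2). (w A)\<^sup>2 * (p * (1 - p)) ^ card A) = 1"
    and overlap: "\<And>A B e S. A \<subseteq> nsets {1..n} 2 \<Longrightarrow> B \<subseteq> nsets {1..n} 2 \<Longrightarrow> w A \<noteq> 0 \<Longrightarrow> w B \<noteq> 0 \<Longrightarrow>
      e \<in> A \<Longrightarrow> e \<in> B \<Longrightarrow> S \<subseteq> A \<union> B - {e} \<Longrightarrow> (A - B) \<union> (B - A) \<subseteq> S \<Longrightarrow> S \<noteq> {} \<Longrightarrow>
      2 * real g + 2 * \<theta> \<le> real (card (\<Union>S)) + 2 * real (card (\<Union>A \<inter> \<Union>B))"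
begin

sublocale bernoulli_cube "nsets {1..n} 2" p
  by unfold_locales (use p in \<open>auto simp: finite_imp_finite_nsets\<close>)

declare One_nat_def [simp del]

abbreviation I :: "nat set set" where "I \<equiv> nsets {1..n} 2"

abbreviation N :: real where "N \<equiv> real n"

lemma N_ge_1: "1 \<le> N" and N_pos: "0 < N"
  using n by auto

lemma Union_subset: "A \<subseteq> I \<Longrightarrow> \<Union>A \<subseteq> {1..n}"
  by (auto simp: nsets_def)

lemma finite_Union: "A \<subseteq> I \<Longrightarrow> finite (\<Union>A)"
  by (rule finite_subset[OF Union_subset]) auto

lemma card_edge: "e \<in> I \<Longrightarrow> card e = 2"
  by (auto simp: nsets_def)

lemma finite_edge: "e \<in> I \<Longrightarrow> finite e"
  by (auto simp: nsets_def)

text \<open>Power counting in the form used below. Vanishing terms are exempt from the conditions,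
  so that the support of the weights can supply the bound on the number of vertices.\<close>

lemma sum_weights_le:
  assumes "\<A> \<subseteq> Pow I" "0 \<le> D" "\<And>A. A \<in> \<A> \<Longrightarrow> 0 \<le> F A"
    and "\<And>A. A \<in> \<A> \<Longrightarrow> F A \<noteq> 0 \<Longrightarrow> V \<subseteq> \<Union>A \<and> card (\<Union>A) \<le> L \<and> F A \<le> D * N powr (- real (card (\<Union>A)))"
  shows "(\<Sum>A\<in>\<A>. F A) \<le> D * edge_set_const L * N powr (- real (card V))"
proof -
  have fin: "finite \<A>" using assms(1) finite_I by (auto intro: finite_subset)
  have "(\<Sum>A\<in>\<A>. F A) = (\<Sum>A\<in>{A \<in> \<A>. F A \<noteq> 0}. F A)"
    using fin by (intro sum.mono_neutral_right) auto
  also have "\<dots> \<le> (\<Sum>A\<in>{A \<in> \<A>. F A \<noteq> 0}. D * N powr (- real (card (\<Union>A))))"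
    using assms by (intro sum_mono) auto
  also have "\<dots> \<le> (\<Sum>A | A \<subseteq> I \<and> V \<subseteq> \<Union>A \<and> card (\<Union>A) \<le> L. D * N powr (- real (card (\<Union>A))))"
  proof (intro sum_mono2 finite_subsets_I)
    show "{A \<in> \<A>. F A \<noteq> 0} \<subseteq> {A. A \<subseteq> I \<and> V \<subseteq> \<Union>A \<and> card (\<Union>A) \<le> L}"
      using assms(1,4) by blast
  qed (use assms(2) in simp)
  also have "\<dots> = D * (\<Sum>A | A \<subseteq> I \<and> V \<subseteq> \<Union>A \<and> card (\<Union>A) \<le> L. N powr (- real (card (\<Union>A))))"
    by (simp add: sum_distrib_left)
  also have "\<dots> \<le> D * (edge_set_const L * N powr (- real (card V)))"
    using assms(2) by (intro mult_left_mono sum_powr_edge_sets_le n)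
  finally show ?thesis by (simp add: mult.assoc)
qed

text \<open>The squared weight has exponent g - 2m for m covered vertices, and m is at least g on
  the support.\<close>

lemma square_weight_le:
  assumes "A \<subseteq> I"
  shows "(w A)\<^sup>2 \<le> C\<^sup>2 * N powr (- real (card (\<Union>A)))"
proof (cases "w A = 0")
  case False
  have "(w A)\<^sup>2 \<le> (C * N powr (real g / 2 - real (card (\<Union>A))))\<^sup>2"
    by (rule power2_le_of_abs_le[OF weight_le[OF assms]])
  also have "\<dots> = C\<^sup>2 * N powr (real g - 2 * real (card (\<Union>A)))"
    using N_pos by (simp add: power_mult_distrib power2_eq_square powr_add[symmetric])
  also have "\<dots> \<le> C\<^sup>2 * N powr (- real (card (\<Union>A)))"
    using weight_support[OF assms False] N_ge_1 by (intro mult_left_mono powr_mono) auto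
  finally show ?thesis .
qed simp

text \<open>Covers both coefficient families that occur, \<open>w A\<close> and
  \<open>w A / card A\<close>.\<close>

definition dominated :: "(nat set set \<Rightarrow> real) \<Rightarrow> bool" where
  "dominated u \<longleftrightarrow> (\<forall>A. \<bar>u A\<bar> \<le> \<bar>w A\<bar>)"

lemma second_moment_slice_le:
  assumes "dominated u" "e \<in> I"
  shows "expect (\<lambda>v. (slice u e v)\<^sup>2) \<le> second_moment_const k C * N powr (- 2)"
proof -
  have u: "\<bar>u A\<bar> \<le> \<bar>w A\<bar>" for A using assms by (simp add: dominated_def)
  have "expect (\<lambda>v. (slice u e v)\<^sup>2) \<le> (\<Sum>A | A \<subseteq> I \<and> e \<in> A. (u A)\<^sup>2)"
    by (rule expect_slice_square_le)
  also have "\<dots> \<le> C\<^sup>2 * edge_set_const k * N powr (- real (card e))"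
  proof (rule sum_weights_le)
    fix A assume A: "A \<in> {A. A \<subseteq> I \<and> e \<in> A}" and "(u A)\<^sup>2 \<noteq> 0"
    then have "w A \<noteq> 0" using u[of A] by auto
    moreover have "(u A)\<^sup>2 \<le> (w A)\<^sup>2" using u[of A] by (simp add: abs_le_square_iff)
    ultimately show "e \<subseteq> \<Union>A \<and> card (\<Union>A) \<le> k \<and> (u A)\<^sup>2 \<le> C\<^sup>2 * N powr (- real (card (\<Union>A)))"
      using A weight_support[of A] square_weight_le[of A] by auto
  qed auto
  finally show ?thesis using card_edge[OF assms(2)] by (simp add: second_moment_const_def)
qed

definition deriv_bound :: "nat set \<Rightarrow> nat set \<Rightarrow> real" where
  "deriv_bound e f = C * edge_set_const k * N powr (real g / 2 - real (card (e \<union> f)))"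

lemma abs_deriv_slice_le:
  assumes "dominated u"
  shows "\<bar>discrete_deriv f (slice u e) v\<bar> \<le> deriv_bound e f"
proof -
  have u: "\<bar>u A\<bar> \<le> \<bar>w A\<bar>" for A using assms by (simp add: dominated_def)
  have "\<bar>discrete_deriv f (slice u e) v\<bar> \<le> (\<Sum>A | A \<subseteq> I \<and> e \<in> A \<and> f \<in> A. \<bar>u A\<bar>)"
    by (rule abs_discrete_deriv_slice_le)
  also have "\<dots> \<le> (C * N powr (real g / 2)) * edge_set_const k * N powr (- real (card (e \<union> f)))"
  proof (rule sum_weights_le)
    fix A assume A: "A \<in> {A. A \<subseteq> I \<and> e \<in> A \<and> f \<in> A}" and "\<bar>u A\<bar> \<noteq> 0"
    then have "w A \<noteq> 0" using u[of A] by auto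
    moreover have "C * N powr (real g / 2) * N powr (- real (card (\<Union>A))) = C * N powr (real g / 2 - real (card (\<Union>A)))"
      by (simp add: powr_add[symmetric])
    moreover have "\<bar>u A\<bar> \<le> C * N powr (real g / 2 - real (card (\<Union>A)))"
      using order_trans[OF u weight_le] A by blast
    ultimately show "e \<union> f \<subseteq> \<Union>A \<and> card (\<Union>A) \<le> k \<and>
        \<bar>u A\<bar> \<le> C * N powr (real g / 2) * N powr (- real (card (\<Union>A)))"
      using A weight_support[of A] by (simp only:) blast
  qed (use C in auto)
  also have "\<dots> = deriv_bound e f"
    using powr_add[of N "real g / 2" "- real (card (e \<union> f))"] by (simp add: deriv_bound_def)
  finally show ?thesis .
qed

text \<open>The squared bound has exponent g - 2m with m the number of vertices of
  \<open>e \<union> f\<close>. Two distinct edges have m at least 3, so g <= 3 brings the exponent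
  down to -m, and summing over \<open>f\<close> leaves the two vertices of \<open>e\<close>.\<close>

lemma sum_square_deriv_bound_le:
  assumes "e \<in> I"
  shows "(\<Sum>f\<in>I - {e}. (deriv_bound e f)\<^sup>2) \<le> deriv_const k C * N powr (- 2)"
proof -
  have card: "3 \<le> card (e \<union> f)" "card (e \<union> f) \<le> 4" if "f \<in> I - {e}" for f
  proof -
    have f: "f \<in> I" "f \<noteq> e" using that by auto
    show "card (e \<union> f) \<le> 4" using card_Un_le[of e f] card_edge[OF assms] card_edge[OF f(1)] by simp
    have "\<not> f \<subseteq> e"
      using f card_edge[OF assms] card_edge[OF f(1)] finite_edge[OF assms] card_subset_eq[of e f] by auto
    then have "e \<subset> e \<union> f" by auto
    then have "card e < card (e \<union> f)"
      using finite_edge[OF assms] finite_edge[OF f(1)] by (intro psubset_card_mono) auto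
    then show "3 \<le> card (e \<union> f)" using card_edge[OF assms] by simp
  qed
  have "(\<Sum>f\<in>I - {e}. (deriv_bound e f)\<^sup>2) \<le> (\<Sum>f\<in>I - {e}. (C * edge_set_const k)\<^sup>2 * N powr (- real (card (\<Union>{e, f}))))"
  proof (rule sum_mono)
    fix f assume f: "f \<in> I - {e}"
    have "(deriv_bound e f)\<^sup>2 = (C * edge_set_const k)\<^sup>2 * N powr (real g - 2 * real (card (e \<union> f)))"
      unfolding deriv_bound_def using N_pos
      by (simp add: power_mult_distrib power2_eq_square powr_add[symmetric])
    also have "\<dots> \<le> (C * edge_set_const k)\<^sup>2 * N powr (- real (card (\<Union>{e, f})))"
      using card[OF f] g N_ge_1 by (intro mult_left_mono powr_mono) auto
    finally show "(deriv_bound e f)\<^sup>2 \<le> (C * edge_set_const k)\<^sup>2 * N powr (- real (card (\<Union>{e, f})))" .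
  qed
  \<comment> \<open>The edge \<open>f\<close> is encoded by the edge set \<open>{e, f}\<close>, to
    which power counting applies.\<close>
  also have "\<dots> = (\<Sum>A\<in>(\<lambda>f. {e, f}) ` (I - {e}). (C * edge_set_const k)\<^sup>2 * N powr (- real (card (\<Union>A))))"
    by (subst sum.reindex) (auto simp: inj_on_def doubleton_eq_iff)
  also have "\<dots> \<le> (C * edge_set_const k)\<^sup>2 * edge_set_const 4 * N powr (- real (card e))"
  proof (rule sum_weights_le)
    fix A assume "A \<in> (\<lambda>f. {e, f}) ` (I - {e})"
    then obtain f where f: "f \<in> I - {e}" "A = {e, f}" by auto
    then show "e \<subseteq> \<Union>A \<and> card (\<Union>A) \<le> 4 \<and>
        (C * edge_set_const k)\<^sup>2 * N powr (- real (card (\<Union>A))) \<le> (C * edge_set_const k)\<^sup>2 * N powr (- real (card (\<Union>A)))"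
      using card(2)[OF f(1)] by simp
  qed (use assms in auto)
  finally show ?thesis using card_edge[OF assms] by (simp add: deriv_const_def)
qed

text \<open>The Poincare inequality is applied to the square of the slice. The derivative of a
  square is the derivative times the sum of the two values; the former has a deterministic bound, so
  only second moments remain.\<close>

lemma fourth_moment_slice_le:
  assumes "dominated u" "e \<in> I"
  shows "expect (\<lambda>v. ((slice u e v)\<^sup>2)\<^sup>2) \<le> fourth_moment_const k C * N powr (- 4)"
proof -
  define X where "X = slice u e"
  define s where "s = expect (\<lambda>v. (X v)\<^sup>2)"
  have s: "0 \<le> s" "s \<le> second_moment_const k C * N powr (- 2)"
    using second_moment_slice_le[OF assms] by (auto simp: s_def X_def expect_nonneg)
  have D: "var1 * expect (\<lambda>v. (discrete_deriv f (\<lambda>v. (X v)\<^sup>2) v)\<^sup>2) \<le> 2 * (deriv_bound e f)\<^sup>2 * s" if "f \<in> I" for f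
  proof -
    have "expect (\<lambda>v. (discrete_deriv f (\<lambda>v. (X v)\<^sup>2) v)\<^sup>2) \<le>
        expect (\<lambda>v. 2 * (deriv_bound e f)\<^sup>2 * ((X (v(f := True)))\<^sup>2 + (X (v(f := False)))\<^sup>2))"
    proof (rule expect_mono)
      fix v
      let ?x = "X (v(f := True))" and ?y = "X (v(f := False))"
      have "(discrete_deriv f (\<lambda>v. (X v)\<^sup>2) v)\<^sup>2 = (?x - ?y)\<^sup>2 * (?x + ?y)\<^sup>2"
        by (simp add: discrete_deriv_def power2_eq_square algebra_simps)
      also have "\<dots> \<le> (deriv_bound e f)\<^sup>2 * (2 * (?x\<^sup>2 + ?y\<^sup>2))"
      proof (intro mult_mono)
        have "\<bar>?x - ?y\<bar> \<le> deriv_bound e f"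
          using abs_deriv_slice_le[OF assms(1), of f e v] by (simp add: discrete_deriv_def X_def)
        then show "(?x - ?y)\<^sup>2 \<le> (deriv_bound e f)\<^sup>2"
          by (rule power2_le_of_abs_le)
        show "(?x + ?y)\<^sup>2 \<le> 2 * (?x\<^sup>2 + ?y\<^sup>2)"
          using sum_squares_bound[of ?x ?y] by (simp add: power2_sum)
      qed auto
      finally show "(discrete_deriv f (\<lambda>v. (X v)\<^sup>2) v)\<^sup>2 \<le> 2 * (deriv_bound e f)\<^sup>2 * (?x\<^sup>2 + ?y\<^sup>2)"
        by (simp add: algebra_simps)
    qed
    also have "\<dots> = 2 * (deriv_bound e f)\<^sup>2 * expect (\<lambda>v. (X (v(f := True)))\<^sup>2 + (X (v(f := False)))\<^sup>2)"
      by (rule integral_mult_right_zero)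
    also have "\<dots> \<le> 2 * (deriv_bound e f)\<^sup>2 * (s / var1)"
      unfolding s_def by (intro mult_left_mono expect_conditional_le that) auto
    finally show ?thesis using var1_pos by (simp add: field_simps)
  qed
  \<comment> \<open>The slice does not involve coordinate \<open>e\<close>, so the sum runs over
    \<open>f \<noteq> e\<close> only, as in \<open>sum_square_deriv_bound_le\<close>.\<close>
  have D0: "var1 * expect (\<lambda>v. (discrete_deriv e (\<lambda>v. (X v)\<^sup>2) v)\<^sup>2) = 0"
    by (simp add: discrete_deriv_def X_def free_ofD[OF free_of_slice])
  have "expect (\<lambda>v. ((X v)\<^sup>2)\<^sup>2) \<le> s\<^sup>2 + var1 * (\<Sum>f\<in>I. expect (\<lambda>v. (discrete_deriv f (\<lambda>v. (X v)\<^sup>2) v)\<^sup>2))"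
    using bernoulli_poincare[OF finite_I p, of "\<lambda>v. (X v)\<^sup>2"] by (simp add: s_def var1_def)
  also have "\<dots> = s\<^sup>2 + (\<Sum>f\<in>I - {e}. var1 * expect (\<lambda>v. (discrete_deriv f (\<lambda>v. (X v)\<^sup>2) v)\<^sup>2))"
    unfolding sum_distrib_left using D0 assms(2) finite_I by (subst sum.remove[of I e]) auto
  also have "\<dots> \<le> s\<^sup>2 + (\<Sum>f\<in>I - {e}. 2 * (deriv_bound e f)\<^sup>2 * s)"
    by (intro add_left_mono sum_mono D) auto
  also have "\<dots> = s\<^sup>2 + 2 * (\<Sum>f\<in>I - {e}. (deriv_bound e f)\<^sup>2) * s"
    by (simp add: sum_distrib_left sum_distrib_right)
  also have "\<dots> \<le> (second_moment_const k C * N powr (- 2))\<^sup>2 +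
      2 * (deriv_const k C * N powr (- 2)) * (second_moment_const k C * N powr (- 2))"
    using s sum_square_deriv_bound_le[OF assms(2)]
    by (intro add_mono power_mono mult_mono) (auto intro!: sum_nonneg mult_nonneg_nonneg simp: deriv_const_def edge_set_const_nonneg)
  also have "\<dots> = fourth_moment_const k C * (N powr (- 2) * N powr (- 2))"
    by (simp add: fourth_moment_const_def power2_eq_square algebra_simps)
  finally show ?thesis by (simp add: X_def powr_add[symmetric])
qed

lemma card_I_le: "real (card I) \<le> N powr 2"
proof -
  have "real (card I) \<le> N ^ 2"
    using binomial_le_pow[of 2 n] by (cases "2 \<le> n") (auto simp flip: of_nat_power simp: binomial_eq_0)
  then show ?thesis using N_pos by (simp add: powr_numeral)
qed

text \<open>The assumptions on \<open>\<psi>\<close> are what identity and absolute value share. In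
  the isometry bound the diagonal has about n^2 edges with fourth moments of order n^-4; off the
  diagonal each edge contributes a second moment of order n^-2 times squared derivative bounds
  summing to order n^-2. Both parts are of order n^-2.\<close>

lemma divergence_square_le:
  assumes u: "dominated u"
    and lip: "\<And>x y. \<bar>\<psi> x - \<psi> y\<bar> \<le> \<bar>x - y\<bar>" and zero: "\<psi> 0 = 0"
  shows "expect (\<lambda>v. (\<Sum>e\<in>I. xi e v * (\<psi> (slice u e v) * slice w e v))\<^sup>2)
    \<le> divergence_const k p C * N powr (- 2)"
proof -
  let ?a = "slice u" and ?c = "slice w"
  define h where "h = (\<lambda>e v. \<psi> (?a e v) * ?c e v)"
  have w: "dominated w" by (simp add: dominated_def)
  have abs\<psi>: "\<bar>\<psi> x\<bar> \<le> \<bar>x\<bar>" for x using lip[of x 0] zero by simp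
  have free: "free_of e (h e)" for e
    by (simp add: free_of_def h_def free_ofD[OF free_of_slice])
  have h2: "expect (\<lambda>v. (h e v)\<^sup>2) \<le> fourth_moment_const k C * N powr (- 4)" if "e \<in> I" for e
  proof -
    have "expect (\<lambda>v. (h e v)\<^sup>2) \<le> expect (\<lambda>v. (((?a e v)\<^sup>2)\<^sup>2 + ((?c e v)\<^sup>2)\<^sup>2) / 2)"
    proof (rule expect_mono)
      fix v
      have "(h e v)\<^sup>2 \<le> (?a e v)\<^sup>2 * (?c e v)\<^sup>2"
        unfolding h_def power_mult_distrib using abs\<psi>[of "?a e v"]
        by (intro mult_right_mono) (auto simp: abs_le_square_iff)
      also have "\<dots> \<le> (((?a e v)\<^sup>2)\<^sup>2 + ((?c e v)\<^sup>2)\<^sup>2) / 2"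
        using sum_squares_bound[of "(?a e v)\<^sup>2" "(?c e v)\<^sup>2"] by simp
      finally show "(h e v)\<^sup>2 \<le> (((?a e v)\<^sup>2)\<^sup>2 + ((?c e v)\<^sup>2)\<^sup>2) / 2" .
    qed
    also have "\<dots> = (expect (\<lambda>v. ((?a e v)\<^sup>2)\<^sup>2) + expect (\<lambda>v. ((?c e v)\<^sup>2)\<^sup>2)) / 2" by simp
    finally show ?thesis
      using fourth_moment_slice_le[OF u that] fourth_moment_slice_le[OF w that] by simp
  qed
  define s where "s = second_moment_const k C * N powr (- 2)"
  have s: "0 \<le> s" by (simp add: s_def second_moment_const_def edge_set_const_nonneg)
  have Dh: "expect (\<lambda>v. (discrete_deriv f (h e) v)\<^sup>2) \<le> 4 * s / var1 * (deriv_bound e f)\<^sup>2"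
    if e: "e \<in> I" and f: "f \<in> I - {e}" for e f
  proof -
    let ?\<delta> = "deriv_bound e f"
    have fI: "f \<in> I" using f by simp
    have "expect (\<lambda>v. (discrete_deriv f (h e) v)\<^sup>2) \<le>
        expect (\<lambda>v. 2 * ?\<delta>\<^sup>2 * (((?a e (v(f := True)))\<^sup>2 + (?a e (v(f := False)))\<^sup>2)
          + ((?c e (v(f := True)))\<^sup>2 + (?c e (v(f := False)))\<^sup>2)))"
    proof (rule expect_mono)
      fix v
      let ?a1 = "?a e (v(f := True))" and ?a0 = "?a e (v(f := False))"
      let ?c1 = "?c e (v(f := True))" and ?c0 = "?c e (v(f := False))"
      have "\<bar>?a1 - ?a0\<bar> \<le> ?\<delta>" "\<bar>?c1 - ?c0\<bar> \<le> ?\<delta>"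
        using abs_deriv_slice_le[OF u, of f e v] abs_deriv_slice_le[OF w, of f e v]
        by (auto simp: discrete_deriv_def)
      then have 1: "(\<psi> ?a1 - \<psi> ?a0)\<^sup>2 \<le> ?\<delta>\<^sup>2" and 2: "(?c1 - ?c0)\<^sup>2 \<le> ?\<delta>\<^sup>2"
        using order_trans[OF lip] by (auto intro: power2_le_of_abs_le)
      have 3: "(\<psi> ?a0)\<^sup>2 \<le> ?a0\<^sup>2" using abs\<psi>[of ?a0] by (simp add: abs_le_square_iff)
      \<comment> \<open>Discrete product rule, with one factor taken at the flipped state and the
        other at the unflipped one.\<close>
      have "(discrete_deriv f (h e) v)\<^sup>2 = ((\<psi> ?a1 - \<psi> ?a0) * ?c1 + \<psi> ?a0 * (?c1 - ?c0))\<^sup>2"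
        by (simp add: discrete_deriv_def h_def algebra_simps)
      also have "\<dots> \<le> 2 * (((\<psi> ?a1 - \<psi> ?a0) * ?c1)\<^sup>2 + (\<psi> ?a0 * (?c1 - ?c0))\<^sup>2)"
        using sum_squares_bound[of "(\<psi> ?a1 - \<psi> ?a0) * ?c1" "\<psi> ?a0 * (?c1 - ?c0)"] by (simp add: power2_sum)
      also have "\<dots> = 2 * ((\<psi> ?a1 - \<psi> ?a0)\<^sup>2 * ?c1\<^sup>2 + (\<psi> ?a0)\<^sup>2 * (?c1 - ?c0)\<^sup>2)"
        by (simp only: power_mult_distrib)
      also have "\<dots> \<le> 2 * (?\<delta>\<^sup>2 * ?c1\<^sup>2 + ?a0\<^sup>2 * ?\<delta>\<^sup>2)"
        using 1 2 3 by (intro mult_left_mono add_mono mult_mono) auto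
      also have "\<dots> = 2 * ?\<delta>\<^sup>2 * (?a0\<^sup>2 + ?c1\<^sup>2)"
        by (simp add: algebra_simps)
      also have "\<dots> \<le> 2 * ?\<delta>\<^sup>2 * ((?a1\<^sup>2 + ?a0\<^sup>2) + (?c1\<^sup>2 + ?c0\<^sup>2))"
        by (intro mult_left_mono) auto
      finally show "(discrete_deriv f (h e) v)\<^sup>2 \<le> 2 * ?\<delta>\<^sup>2 * ((?a1\<^sup>2 + ?a0\<^sup>2) + (?c1\<^sup>2 + ?c0\<^sup>2))" .
    qed
    also have "\<dots> = 2 * ?\<delta>\<^sup>2 * (expect (\<lambda>v. (?a e (v(f := True)))\<^sup>2 + (?a e (v(f := False)))\<^sup>2)
          + expect (\<lambda>v. (?c e (v(f := True)))\<^sup>2 + (?c e (v(f := False)))\<^sup>2))"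
      by simp
    also have "\<dots> \<le> 2 * ?\<delta>\<^sup>2 * (s / var1 + s / var1)"
      using var1_pos second_moment_slice_le[OF u e] second_moment_slice_le[OF w e]
      by (intro mult_left_mono add_mono order_trans[OF expect_conditional_le[OF fI]] divide_right_mono)
         (auto simp: s_def)
    finally show ?thesis by (simp add: mult_ac)
  qed
  have "expect (\<lambda>v. (\<Sum>e\<in>I. xi e v * h e v)\<^sup>2) \<le>
    (\<Sum>e\<in>I. expect (\<lambda>v. (h e v)\<^sup>2)) + (\<Sum>e\<in>I. \<Sum>f\<in>I - {e}. expect (\<lambda>v. (discrete_deriv f (h e) v)\<^sup>2))"
    by (rule expect_square_sum_xi_le[OF free])
  also have "\<dots> \<le> (\<Sum>e\<in>I. fourth_moment_const k C * N powr (- 4)) +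
      (\<Sum>e\<in>I. 4 * s / var1 * (deriv_const k C * N powr (- 2)))"
  proof (intro add_mono sum_mono h2)
    fix e assume e: "e \<in> I"
    have "(\<Sum>f\<in>I - {e}. expect (\<lambda>v. (discrete_deriv f (h e) v)\<^sup>2)) \<le>
        (\<Sum>f\<in>I - {e}. 4 * s / var1 * (deriv_bound e f)\<^sup>2)"
      by (intro sum_mono Dh e)
    also have "\<dots> = 4 * s / var1 * (\<Sum>f\<in>I - {e}. (deriv_bound e f)\<^sup>2)"
      by (simp add: sum_distrib_left)
    also have "\<dots> \<le> 4 * s / var1 * (deriv_const k C * N powr (- 2))"
      using s var1_pos by (intro mult_left_mono sum_square_deriv_bound_le e) auto
    finally show "(\<Sum>f\<in>I - {e}. expect (\<lambda>v. (discrete_deriv f (h e) v)\<^sup>2)) \<le>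
        4 * s / var1 * (deriv_const k C * N powr (- 2))" .
  qed
  also have "\<dots> = real (card I) * (divergence_const k p C * (N powr (- 2) * N powr (- 2)))"
    by (simp add: divergence_const_def s_def var1_def powr_add[symmetric] algebra_simps add_divide_distrib)
  also have "\<dots> \<le> N powr 2 * (divergence_const k p C * (N powr (- 2) * N powr (- 2)))"
  proof (intro mult_right_mono card_I_le mult_nonneg_nonneg)
    show "0 \<le> divergence_const k p C"
      using p by (intro divergence_const_nonneg) auto
  qed auto
  also have "\<dots> = divergence_const k p C * (N powr 2 * N powr (- 2) * N powr (- 2))"
    by simp
  also have "N powr 2 * N powr (- 2) = 1"
    by (subst powr_add[symmetric]) (use N_pos in simp)
  finally show ?thesis by (simp add: h_def)
qed

text \<open>The products of slices are expanded into Walsh functions indexed by quadruples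
  \<open>(e, A, B, R)\<close>. Power counting is used twice: over the unions
  \<open>A \<union> B\<close> that produce a fixed Walsh function, then over the Walsh functions
  themselves.\<close>

lemma variance_sum_slice_product_le:
  assumes u: "dominated u"
  defines "Y \<equiv> \<lambda>v. \<Sum>e\<in>I. slice u e v * slice w e v"
  shows "expect (\<lambda>v. (Y v - expect Y)\<^sup>2) \<le> variance_const k C * N powr (- 2 * \<theta>)"
proof -
  define Q where "Q = (\<lambda>e. {A. A \<subseteq> I \<and> e \<in> A})"
  define J where "J = (SIGMA e:I. SIGMA A:Q e. SIGMA B:Q e. Pow ((A - {e}) \<inter> (B - {e})))"
  define S where "S = (\<lambda>(e :: nat set, A, B, R). ((A - {e}) - (B - {e})) \<union> ((B - {e}) - (A - {e})) \<union> R)"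
  define c where "c = (\<lambda>(e :: nat set, A, B, R). u A * w B *
    ((1 - 2 * p) ^ card R * var1 ^ card ((A - {e}) \<inter> (B - {e}) - R)))"
  define D where "D = (\<lambda>(e :: nat set, A, B, R :: nat set set). A \<union> B :: nat set set)"
  define m :: real where "m = 2 ^ (4 * 2 ^ (2 * k))"
  have finQ: "finite (Q e)" for e unfolding Q_def by (rule finite_subsets_I)
  have finA: "finite A" if "A \<in> Q e" for A e
    using that finite_subset[OF _ finite_I] by (auto simp: Q_def)
  have finJ: "finite J"
    unfolding J_def by (intro finite_SigmaI finite_I finQ) (auto dest: finA)
  have Y1: "Y v = (\<Sum>e\<in>I. \<Sum>A\<in>Q e. \<Sum>B\<in>Q e. \<Sum>R\<in>Pow ((A - {e}) \<inter> (B - {e})). c (e, A, B, R) * chi (S (e, A, B, R)) v)" for v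
  proof -
    have Y': "Y v = (\<Sum>e\<in>I. \<Sum>A\<in>Q e. \<Sum>B\<in>Q e. u A * chi (A - {e}) v * (w B * chi (B - {e}) v))"
      by (simp only: Y_def slice_def sum_product Q_def)
    show ?thesis
      unfolding Y'
    proof (intro sum.cong refl)
    fix e A B assume AB: "A \<in> Q e" "B \<in> Q e"
    have "u A * chi (A - {e}) v * (w B * chi (B - {e}) v) = u A * w B * (chi (A - {e}) v * chi (B - {e}) v)"
      by (simp add: mult_ac)
    also have "\<dots> = (\<Sum>R\<in>Pow ((A - {e}) \<inter> (B - {e})). c (e, A, B, R) * chi (S (e, A, B, R)) v)"
      using finA[OF AB(1)] finA[OF AB(2)] by (subst chi_mult_chi) (auto simp: sum_distrib_left c_def S_def mult.assoc)
    finally show "u A * chi (A - {e}) v * (w B * chi (B - {e}) v) =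
        (\<Sum>R\<in>Pow ((A - {e}) \<inter> (B - {e})). c (e, A, B, R) * chi (S (e, A, B, R)) v)" .
    qed
  qed
  have Y: "Y = (\<lambda>v. \<Sum>j\<in>J. c j * chi (S j) v)"
  proof
    fix v
    show "Y v = (\<Sum>j\<in>J. c j * chi (S j) v)"
      unfolding Y1 J_def using finQ finA finite_I
      by (simp add: sum.Sigma split_def)
  qed
  have S_sub: "S j \<subseteq> I" if "j \<in> J" for j
    using that by (auto simp: J_def S_def Q_def)
  have c_le: "\<bar>c (e, A, B, R)\<bar> \<le> \<bar>w A\<bar> * \<bar>w B\<bar>" for e A B R
  proof -
    have "\<bar>1 - 2 * p\<bar> ^ card R \<le> 1" using p by (intro power_le_one) auto
    then have "\<bar>1 - 2 * p\<bar> ^ card R * var1 ^ card ((A - {e}) \<inter> (B - {e}) - R) \<le> 1 * 1"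
      using var1_pos var1_le_1 by (intro mult_mono) (auto intro!: power_le_one)
    then have "\<bar>u A\<bar> * \<bar>w B\<bar> * (\<bar>1 - 2 * p\<bar> ^ card R * var1 ^ card ((A - {e}) \<inter> (B - {e}) - R)) \<le> \<bar>w A\<bar> * \<bar>w B\<bar> * 1"
      using u var1_pos by (intro mult_mono) (auto simp: dominated_def)
    then show ?thesis using var1_pos by (simp add: c_def abs_mult power_abs)
  qed
  have main: "\<Union>(S j) \<subseteq> \<Union>(D j) \<and> card (\<Union>(D j)) \<le> 2 * k \<and> D j \<subseteq> I \<and>
      \<bar>c j\<bar> \<le> C\<^sup>2 * N powr (- \<theta> + real (card (\<Union>(S j))) / 2) * N powr (- real (card (\<Union>(D j))))"
    if "j \<in> J" "c j \<noteq> 0" "S j \<noteq> {}" for j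
  proof -
    obtain e A B R where j: "j = (e, A, B, R)" by (cases j) auto
    have AB: "A \<subseteq> I" "B \<subseteq> I" "e \<in> A" "e \<in> B" "R \<subseteq> (A - {e}) \<inter> (B - {e})"
      using that(1) by (auto simp: j J_def Q_def)
    have w: "w A \<noteq> 0" "w B \<noteq> 0"
      using that(2) c_le[of e A B R] by (auto simp: j)
    have Sj: "S j \<subseteq> A \<union> B - {e}" "(A - B) \<union> (B - A) \<subseteq> S j"
      using AB by (auto simp: j S_def)
    have Dj: "D j = A \<union> B" by (simp add: D_def j)
    have ineq: "2 * real g + 2 * \<theta> \<le> real (card (\<Union>(S j))) + 2 * real (card (\<Union>A \<inter> \<Union>B))"
      by (rule overlap[OF AB(1,2) w AB(3,4) Sj that(3)])
    have "card (\<Union>A) + card (\<Union>B) = card (\<Union>A \<union> \<Union>B) + card (\<Union>A \<inter> \<Union>B)"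
      by (rule card_Un_Int) (use AB finite_Union in auto)
    then have sum: "real (card (\<Union>A)) + real (card (\<Union>B)) = real (card (\<Union>(D j))) + real (card (\<Union>A \<inter> \<Union>B))"
      unfolding Dj Union_Un_distrib by linarith
    have "\<bar>c j\<bar> \<le> \<bar>w A\<bar> * \<bar>w B\<bar>" unfolding j by (rule c_le)
    also have "\<dots> \<le> (C * N powr (real g / 2 - real (card (\<Union>A)))) * (C * N powr (real g / 2 - real (card (\<Union>B))))"
      using C by (intro mult_mono weight_le AB) auto
    also have "\<dots> = C\<^sup>2 * N powr ((real g / 2 - real (card (\<Union>A))) + (real g / 2 - real (card (\<Union>B))))"
      unfolding powr_add by (simp add: power2_eq_square)
    \<comment> \<open>The exponent g minus the two vertex numbers is rewritten through union and
      intersection; \<open>overlap\<close> then trades the intersection for half the vertex number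
      of \<open>S j\<close> and the gain \<open>\<theta>\<close>.\<close>
    also have "\<dots> \<le> C\<^sup>2 * N powr ((- \<theta> + real (card (\<Union>(S j))) / 2) + - real (card (\<Union>(D j))))"
      using ineq sum N_ge_1 by (intro mult_left_mono powr_mono) auto
    finally have "\<bar>c j\<bar> \<le> C\<^sup>2 * N powr (- \<theta> + real (card (\<Union>(S j))) / 2) * N powr (- real (card (\<Union>(D j))))"
      unfolding powr_add by simp
    moreover have "card (\<Union>(D j)) \<le> 2 * k"
      using weight_support[OF AB(1) w(1)] weight_support[OF AB(2) w(2)] card_Un_le[of "\<Union>A" "\<Union>B"]
      by (simp add: Dj Union_Un_distrib)
    moreover have "\<Union>(S j) \<subseteq> \<Union>(D j)" "D j \<subseteq> I" using Sj AB unfolding Dj by auto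
    ultimately show ?thesis by blast
  qed
  let ?m = "C\<^sup>2 * (m * edge_set_const (2 * k))" and ?s = "\<lambda>T. \<Sum>j | j \<in> J \<and> S j = T. \<bar>c j\<bar>"
  \<comment> \<open>Summing over all \<open>D j\<close> whose vertices include those of
    \<open>T\<close> costs one factor 1/n per vertex of \<open>T\<close>, which changes the exponent
    from plus to minus half the number of these vertices.\<close>
  have inner: "?s T \<le> ?m * N powr (- \<theta> - real (card (\<Union>T)) / 2)"
    if T: "T \<noteq> {}" for T
  proof -
    define J' where "J' = {j \<in> J. S j = T \<and> c j \<noteq> 0}"
    let ?x = "C\<^sup>2 * N powr (- \<theta> + real (card (\<Union>T)) / 2)"
    have finJ': "finite J'" using finJ by (simp add: J'_def)
    have J': "\<Union>T \<subseteq> \<Union>(D j)" "card (\<Union>(D j)) \<le> 2 * k" "D j \<subseteq> I"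
      "\<bar>c j\<bar> \<le> ?x * N powr (- real (card (\<Union>(D j))))" if "j \<in> J'" for j
      using main[of j] that T by (auto simp: J'_def)
    have fibre: "real (card {i \<in> J'. D i = D j}) \<le> m" if "j \<in> J'" for j
    proof -
      have fin: "finite (D j)" using J'(3)[OF that] finite_I finite_subset by blast
      have "D j \<subseteq> Pow (\<Union>(D j))" by auto
      then have "card (D j) \<le> card (Pow (\<Union>(D j)))"
        using finite_Union[OF J'(3)[OF that]] by (intro card_mono) auto
      also have "\<dots> = 2 ^ card (\<Union>(D j))"
        using finite_Union[OF J'(3)[OF that]] by (simp add: card_Pow)
      also have "\<dots> \<le> 2 ^ (2 * k)"
        using J'(2)[OF that] by (intro power_increasing) auto
      finally have cardD: "card (D j) \<le> 2 ^ (2 * k)" .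
      \<comment> \<open>Once the union is fixed, the edge is one of its elements and
        \<open>A\<close>, \<open>B\<close>, \<open>R\<close> are subsets of it.\<close>
      have "{i \<in> J'. D i = D j} \<subseteq> D j \<times> Pow (D j) \<times> Pow (D j) \<times> Pow (D j)"
        by (auto simp: J'_def J_def Q_def D_def)
      then have "card {i \<in> J'. D i = D j} \<le> card (D j \<times> Pow (D j) \<times> Pow (D j) \<times> Pow (D j))"
        using fin by (intro card_mono) auto
      also have "\<dots> = card (D j) * (2 ^ card (D j)) ^ 3"
        using fin by (simp add: card_cartesian_product card_Pow power3_eq_cube)
      also have "\<dots> \<le> 2 ^ card (D j) * (2 ^ card (D j)) ^ 3"
        by (intro mult_right_mono less_imp_le less_exp) auto
      also have "\<dots> = 2 ^ (4 * card (D j))"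
        by (simp add: power_mult[symmetric] power_add[symmetric])
      also have "\<dots> \<le> 2 ^ (4 * 2 ^ (2 * k))"
        using cardD by (intro power_increasing) auto
      finally have "real (card {i \<in> J'. D i = D j}) \<le> real (2 ^ (4 * 2 ^ (2 * k)))"
        by (rule of_nat_mono)
      then show ?thesis by (simp add: m_def)
    qed
    have "?s T = (\<Sum>j\<in>J'. \<bar>c j\<bar>)"
      using finJ by (intro sum.mono_neutral_right) (auto simp: J'_def)
    also have "\<dots> \<le> (\<Sum>j\<in>J'. ?x * N powr (- real (card (\<Union>(D j)))))"
      by (intro sum_mono J'(4))
    also have "\<dots> \<le> m * (\<Sum>d\<in>D ` J'. ?x * N powr (- real (card (\<Union>d))))"
      by (rule sum_fibres_le[OF finJ']) (use fibre in auto)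
    also have "\<dots> \<le> m * (?x * edge_set_const (2 * k) * N powr (- real (card (\<Union>T))))"
    proof (intro mult_left_mono sum_weights_le)
      show "D ` J' \<subseteq> Pow I" using J'(3) by blast
      fix d assume "d \<in> D ` J'"
      then obtain j where j: "j \<in> J'" and d: "d = D j" by blast
      show "\<Union>T \<subseteq> \<Union>d \<and> card (\<Union>d) \<le> 2 * k \<and>
          ?x * N powr (- real (card (\<Union>d))) \<le> ?x * N powr (- real (card (\<Union>d)))"
        unfolding d by (intro conjI J'(1,2)[OF j] order_refl)
    qed (auto simp: m_def)
    also have "\<dots> = ?m * (N powr (- \<theta> + real (card (\<Union>T)) / 2) * N powr (- real (card (\<Union>T))))"
      by simp
    also have "N powr (- \<theta> + real (card (\<Union>T)) / 2) * N powr (- real (card (\<Union>T))) =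
        N powr (- \<theta> - real (card (\<Union>T)) / 2)"
      unfolding powr_add[symmetric] by (rule arg_cong[of _ _ "(powr) N"]) simp
    finally show ?thesis .
  qed
  have "expect (\<lambda>v. (Y v - expect Y)\<^sup>2) \<le> (\<Sum>T\<in>S ` J - {{}}. (?s T)\<^sup>2)"
    unfolding Y by (rule variance_sum_chi_le[OF finJ S_sub])
  \<comment> \<open>Squaring leaves exactly one factor 1/n per vertex of \<open>T\<close>, so the
    sum over all \<open>T\<close>, with no vertex prescribed, is bounded.\<close>
  also have "\<dots> \<le> ((?m)\<^sup>2 * N powr (- 2 * \<theta>)) * edge_set_const (2 * k) * N powr (- real (card ({} :: nat set)))"
  proof (rule sum_weights_le)
    fix T assume T: "T \<in> S ` J - {{}}" and "(?s T)\<^sup>2 \<noteq> 0"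
    then have "?s T \<noteq> 0" by simp
    then obtain j where j: "j \<in> J" "S j = T" "c j \<noteq> 0"
      by (auto elim: sum.not_neutral_contains_not_neutral)
    have Dj: "\<Union>T \<subseteq> \<Union>(D j)" "card (\<Union>(D j)) \<le> 2 * k" "D j \<subseteq> I"
      using main[OF j(1,3)] j T by auto
    then have "card (\<Union>T) \<le> 2 * k"
      using card_mono[OF finite_Union[OF Dj(3)] Dj(1)] by simp
    moreover have "(?s T)\<^sup>2 \<le>
        (?m * N powr (- \<theta> - real (card (\<Union>T)) / 2))\<^sup>2"
      using T by (intro power_mono inner sum_nonneg) auto
    moreover have "(?m * N powr (- \<theta> - real (card (\<Union>T)) / 2))\<^sup>2 =
        ((?m)\<^sup>2 * N powr (- 2 * \<theta>)) * N powr (- real (card (\<Union>T)))"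
      unfolding power_mult_distrib mult.assoc
      by (simp add: power2_eq_square powr_add[symmetric])
    ultimately show "{} \<subseteq> \<Union>T \<and> card (\<Union>T) \<le> 2 * k \<and> (?s T)\<^sup>2 \<le>
        ((?m)\<^sup>2 * N powr (- 2 * \<theta>)) * N powr (- real (card (\<Union>T)))"
      by simp
  next
    show "S ` J - {{}} \<subseteq> Pow I" using S_sub by blast
  qed auto
  also have "\<dots> = variance_const k C * N powr (- 2 * \<theta>)"
    using N_pos by (simp add: variance_const_def m_def)
  finally show ?thesis .
qed

lemma sqrt_const_powr: "0 \<le> c \<Longrightarrow> sqrt (c * N powr (- 2 * t)) = sqrt c * N powr (- t)"
proof (rule real_sqrt_unique)
  assume "0 \<le> c"
  moreover have "(N powr (- t))\<^sup>2 = N powr (- 2 * t)"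
    by (simp add: power2_eq_square powr_add[symmetric])
  ultimately show "(sqrt c * N powr (- t))\<^sup>2 = c * N powr (- 2 * t)"
    by (simp add: power_mult_distrib)
qed simp

text \<open>The three terms of the Stein bound are estimated by the variance and divergence bounds.
  The divergences always give 1/n, which is why \<open>\<theta>\<close> is capped at 1.\<close>

theorem walsh_kolmogorov_bound:
  assumes "\<theta> \<le> 1"
  shows "\<bar>measure_pmf.prob M {v. walsh w v \<le> z} - Phi z\<bar> \<le>
    (2 * sqrt (variance_const k C) + 2 * sqrt (divergence_const k p C)) * N powr (- \<theta>)"
proof -
  let ?u = "\<lambda>A. w A / real (card A)"
  let ?a = "slice ?u" and ?c = "slice w"
  define Y where "Y = (\<lambda>v. \<Sum>e\<in>I. ?a e v * ?c e v)"
  have w0: "w {} = 0" using weight_support[of "{}"] g by auto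
  have u: "dominated ?u"
    unfolding dominated_def
  proof
    fix A :: "nat set set"
    show "\<bar>w A / real (card A)\<bar> \<le> \<bar>w A\<bar>"
      by (cases "card A = 0") (auto simp: divide_le_eq mult_le_cancel_left1)
  qed
  have div: "expect (\<lambda>v. \<bar>\<Sum>e\<in>I. xi e v * (\<psi> (?a e v) * ?c e v)\<bar>) \<le> sqrt (divergence_const k p C) * N powr (- \<theta>)"
    if lip: "\<And>x y. \<bar>\<psi> x - \<psi> y\<bar> \<le> \<bar>x - y\<bar>" and zero: "\<psi> 0 = 0" for \<psi>
  proof -
    have dc: "0 \<le> divergence_const k p C"
      using p by (intro divergence_const_nonneg) auto
    have "expect (\<lambda>v. \<bar>\<Sum>e\<in>I. xi e v * (\<psi> (?a e v) * ?c e v)\<bar>) \<le> sqrt (divergence_const k p C * N powr (- 2))"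
      by (rule order_trans[OF expect_abs_le_sqrt]) (intro real_sqrt_le_mono divergence_square_le u lip zero)
    also have "\<dots> = sqrt (divergence_const k p C) * N powr (- 1)"
      using sqrt_const_powr[OF dc, of 1] by simp
    also have "\<dots> \<le> sqrt (divergence_const k p C) * N powr (- \<theta>)"
      using assms N_ge_1 dc by (intro mult_left_mono powr_mono) auto
    finally show ?thesis .
  qed
  \<comment> \<open>Integration by parts identifies this mean with the second moment of
    \<open>walsh w\<close>, normalized to 1. The first Stein term therefore only measures
    fluctuations of \<open>Y\<close>.\<close>
  have EY: "var1 * expect Y = 1"
    unfolding Y_def using expect_sum_slice_product[of w, OF w0] weight_normalized by (simp add: var1_def)
  have "expect (\<lambda>v. \<bar>1 - var1 * Y v\<bar>) \<le> expect (\<lambda>v. \<bar>Y v - expect Y\<bar>)"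
  proof (rule expect_mono)
    fix v
    have "1 - var1 * Y v = var1 * (expect Y - Y v)" using EY by (simp add: right_diff_distrib)
    then have "\<bar>1 - var1 * Y v\<bar> = var1 * \<bar>Y v - expect Y\<bar>"
      using var1_pos by (simp add: abs_mult abs_minus_commute)
    also have "\<dots> \<le> \<bar>Y v - expect Y\<bar>"
      using var1_pos var1_le_1 by (intro mult_left_le_one_le) auto
    finally show "\<bar>1 - var1 * Y v\<bar> \<le> \<bar>Y v - expect Y\<bar>" .
  qed
  also have "\<dots> \<le> sqrt (variance_const k C * N powr (- 2 * \<theta>))"
    unfolding Y_def
    by (rule order_trans[OF expect_abs_le_sqrt]) (intro real_sqrt_le_mono variance_sum_slice_product_le u)
  also have "\<dots> = sqrt (variance_const k C) * N powr (- \<theta>)"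
    by (rule sqrt_const_powr) (simp add: variance_const_def edge_set_const_nonneg)
  finally have var: "expect (\<lambda>v. \<bar>1 - var1 * Y v\<bar>) \<le> sqrt (variance_const k C) * N powr (- \<theta>)" .
  have "\<bar>measure_pmf.prob M {v. walsh w v \<le> z} - Phi z\<bar> \<le>
      2 * expect (\<lambda>v. \<bar>1 - var1 * Y v\<bar>)
      + expect (\<lambda>v. \<bar>\<Sum>e\<in>I. xi e v * (?a e v * ?c e v)\<bar>)
      + expect (\<lambda>v. \<bar>\<Sum>e\<in>I. xi e v * (\<bar>?a e v\<bar> * ?c e v)\<bar>)"
    using stein_kolmogorov_bound[where W = "walsh w" and a = ?a, OF walsh_eq_sum_xi[of w, OF w0] free_of_slice]
    by (simp add: discrete_deriv_walsh Y_def)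
  also have "\<dots> \<le> 2 * (sqrt (variance_const k C) * N powr (- \<theta>))
      + sqrt (divergence_const k p C) * N powr (- \<theta>) + sqrt (divergence_const k p C) * N powr (- \<theta>)"
    using div[of "\<lambda>x. x"] div[of abs] by (intro add_mono mult_left_mono var) (auto simp: abs_triangle_ineq3)
  also have "\<dots> = (2 * sqrt (variance_const k C) + 2 * sqrt (divergence_const k p C)) * N powr (- \<theta>)"
    by (simp add: algebra_simps)
  finally show ?thesis .
qed

end

section \<open>Counting in small graphs\<close>

lemma edge_cases:
  assumes "f \<in> nsets V 2" "x \<in> f"
  obtains x' where "f = {x, x'}" "x' \<noteq> x"
  using assms by (auto elim!: nsets2_E)

lemma edge_subset_edge_eq: "f \<in> nsets V 2 \<Longrightarrow> e \<in> nsets V 2 \<Longrightarrow> f \<subseteq> e \<Longrightarrow> f = e"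
  using card_subset_eq[of e f] by (simp add: nsets_def)

lemma overlap_ge_2:
  assumes "finite V" "A \<subseteq> nsets V 2" "B \<subseteq> nsets V 2" "e \<in> A" "e \<in> B" "S \<subseteq> A \<union> B" "S \<noteq> {}"
  shows "2 \<le> card (\<Union>S)" "2 \<le> card (\<Union>A \<inter> \<Union>B)"
proof -
  have fin: "finite (\<Union>(A \<union> B))"
    by (rule finite_subset[OF _ assms(1)]) (use assms(2,3) in \<open>auto simp: nsets_def\<close>)
  obtain f where "f \<in> S" using assms by auto
  then have "card f \<le> card (\<Union>S)"
    using finite_subset[OF Union_mono[OF assms(6)] fin] by (intro card_mono) auto
  moreover have "card f = 2" using \<open>f \<in> S\<close> assms by (auto simp: nsets_def)
  ultimately show "2 \<le> card (\<Union>S)" by simp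
  have "card e \<le> card (\<Union>A \<inter> \<Union>B)"
    using fin assms(4,5) by (intro card_mono) auto
  moreover have "card e = 2" using assms by (auto simp: nsets_def)
  ultimately show "2 \<le> card (\<Union>A \<inter> \<Union>B)" by simp
qed

text \<open>The critical case is that \<open>A\<close> and \<open>B\<close> meet only in the
  vertices of \<open>e\<close>. Each has a vertex outside \<open>e\<close>, hence an edge there
  which belongs to \<open>S\<close>. Two such edges cover at least three vertices, and exactly three
  only if they hang on the same end of \<open>e\<close>; if \<open>A\<close> is not a 2-star, a
  further edge of \<open>A\<close> then supplies a fourth vertex. The values 7 and 8 are 3 + 2 * 2
  and 4 + 2 * 2.\<close>

lemma overlap_three_vertices:
  assumes V: "finite V" and A: "A \<subseteq> nsets V 2" and B: "B \<subseteq> nsets V 2" and e: "e \<in> A" "e \<in> B"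
    and S: "S \<subseteq> A \<union> B - {e}" "(A - B) \<union> (B - A) \<subseteq> S" "S \<noteq> {}"
    and three: "3 \<le> card (\<Union>A)" "3 \<le> card (\<Union>B)"
  shows "7 \<le> card (\<Union>S) + 2 * card (\<Union>A \<inter> \<Union>B)"
    and "(\<And>x y z. x \<noteq> y \<Longrightarrow> y \<noteq> z \<Longrightarrow> x \<noteq> z \<Longrightarrow> A \<noteq> {{x, y}, {y, z}}) \<Longrightarrow>
      8 \<le> card (\<Union>S) + 2 * card (\<Union>A \<inter> \<Union>B)"
proof -
  have ge: "2 \<le> card (\<Union>S)" "2 \<le> card (\<Union>A \<inter> \<Union>B)"
    using overlap_ge_2[OF V A B e, of S] S by auto
  have fin: "finite (\<Union>A)" "finite (\<Union>B)" "finite (\<Union>S)"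
    by (rule finite_subset[OF _ V], use A B S(1) in \<open>auto simp: nsets_def\<close>)+
  have eV: "e \<in> nsets V 2" using A e by auto
  have card_e: "card e = 2" "finite e" using eV by (auto simp: nsets_def)
  have "7 \<le> card (\<Union>S) + 2 * card (\<Union>A \<inter> \<Union>B) \<and>
      ((\<forall>x y z. x \<noteq> y \<longrightarrow> y \<noteq> z \<longrightarrow> x \<noteq> z \<longrightarrow> A \<noteq> {{x, y}, {y, z}}) \<longrightarrow>
        8 \<le> card (\<Union>S) + 2 * card (\<Union>A \<inter> \<Union>B))"
  proof (cases "card (\<Union>A \<inter> \<Union>B) = 2")
    case False
    \<comment> \<open>With at least three common vertices the count is already at least 2 + 2 *
      3.\<close>
    then show ?thesis using ge by linarith
  next
    case True
    have AB: "\<Union>A \<inter> \<Union>B = e"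
      using card_subset_eq[of "\<Union>A \<inter> \<Union>B" e] True card_e e fin by auto
    \<comment> \<open>Only \<open>e\<close> can be common to \<open>A\<close> and \<open>B\<close>,
      so every other edge lies in the symmetric difference and hence in \<open>S\<close>.\<close>
    have AIB: "f = e" if "f \<in> A" "f \<in> B" for f
      using edge_subset_edge_eq[of f V e] that A eV AB by auto
    have pick: "\<exists>x x'. x \<notin> e \<and> x' \<noteq> x \<and> {x, x'} \<in> D" if D: "D \<subseteq> nsets V 2" "3 \<le> card (\<Union>D)" for D
    proof -
      have "\<not> \<Union>D \<subseteq> e"
        using card_mono[OF card_e(2), of "\<Union>D"] card_e(1) D(2) by auto
      then obtain x f where x: "x \<notin> e" "x \<in> f" "f \<in> D" by auto
      then obtain x' where "f = {x, x'}" "x' \<noteq> x" using edge_cases[of f V x] D(1) by auto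
      then show ?thesis using x by auto
    qed
    obtain x x' where x: "x \<notin> e" "x' \<noteq> x" "{x, x'} \<in> A" using pick[OF A three(1)] by auto
    obtain y y' where y: "y \<notin> e" "y' \<noteq> y" "{y, y'} \<in> B" using pick[OF B three(2)] by auto
    have xB: "x \<notin> \<Union>B" and yA: "y \<notin> \<Union>A" using AB x y by blast+
    have S_mem: "f \<in> S" if "f \<in> A \<union> B" "f \<noteq> e" for f
      using S(2) AIB that by auto
    have "{x, x'} \<in> S" "{y, y'} \<in> S" using x y by (auto intro!: S_mem)
    then have sub: "{x, x', y, y'} \<subseteq> \<Union>S" by auto
    have neq: "x \<noteq> y" "x' \<noteq> y" "x \<noteq> y'" using xB yA x y by auto
    have "card {x, x', y} = 3" using neq x by simp
    then have c3: "3 \<le> card (\<Union>S)"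
      using card_mono[OF fin(3), of "{x, x', y}"] sub by auto
    have c4: "4 \<le> card (\<Union>S)"
      if nc: "\<forall>x y z. x \<noteq> y \<longrightarrow> y \<noteq> z \<longrightarrow> x \<noteq> z \<longrightarrow> A \<noteq> {{x, y}, {y, z}}"
    proof (cases "x' = y'")
      case False
      then have "card {x, x', y, y'} = 4" using neq x y by auto
      then show ?thesis using card_mono[OF fin(3) sub] by simp
    next
      case u: True
      \<comment> \<open>The common end is a vertex of both \<open>A\<close> and \<open>B\<close>, so
        it lies on \<open>e\<close>, and \<open>e\<close> with \<open>{x', x}\<close> forms a 2-star
        inside \<open>A\<close>. Since this cannot be all of \<open>A\<close>, a third edge
        exists.\<close>
      then have "x' \<in> e" using AB x y by blast
      then obtain v where v: "e = {x', v}" "v \<noteq> x'" by (rule edge_cases[OF eV])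
      have "v \<noteq> x" using x(1) v by auto
      then have "A \<noteq> {e, {x', x}}"
        using nc[rule_format, of v x' x] v x(2) by (simp add: insert_commute)
      moreover have "{e, {x', x}} \<subseteq> A" using e x by (simp add: insert_commute)
      ultimately obtain f where f: "f \<in> A" "f \<noteq> e" "f \<noteq> {x', x}" by auto
      have "{x', x} \<in> nsets V 2" using subsetD[OF A x(3)] by (simp only: insert_commute)
      then have "\<not> f \<subseteq> {x', x}" using edge_subset_edge_eq[of f V "{x', x}"] f A by auto
      then obtain t where t: "t \<in> f" "t \<noteq> x'" "t \<noteq> x" by auto
      have "t \<noteq> y" using t f yA by auto
      then have "card {x, x', y, t} = 4" using t neq x by auto
      moreover have "{x, x', y, t} \<subseteq> \<Union>S" using sub S_mem[of f] f t by auto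
      ultimately show ?thesis using card_mono[OF fin(3), of "{x, x', y, t}"] by simp
    qed
    show ?thesis using c3 c4 True by auto
  qed
  then show "7 \<le> card (\<Union>S) + 2 * card (\<Union>A \<inter> \<Union>B)"
    and "(\<And>x y z. x \<noteq> y \<Longrightarrow> y \<noteq> z \<Longrightarrow> x \<noteq> z \<Longrightarrow> A \<noteq> {{x, y}, {y, z}}) \<Longrightarrow>
      8 \<le> card (\<Union>S) + 2 * card (\<Union>A \<inter> \<Union>B)"
    by auto
qed

section \<open>Counting vertex subsets and increasing index maps\<close>

lemma card_nsets_superset:
  assumes "U \<subseteq> {1..n}" "card U \<le> k"
  shows "card {K \<in> nsets {1..n} k. U \<subseteq> K} = (n - card U) choose (k - card U)"
proof -
  have fin: "finite U" using assms finite_subset by auto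
  have "card {K \<in> nsets {1..n} k. U \<subseteq> K} = card {D. D \<subseteq> {1..n} - U \<and> card D = k - card U}"
  proof (rule bij_betw_same_card)
    show "bij_betw (\<lambda>K. K - U) {K \<in> nsets {1..n} k. U \<subseteq> K} {D. D \<subseteq> {1..n} - U \<and> card D = k - card U}"
    proof (rule bij_betw_byWitness[where f' = "\<lambda>D. D \<union> U"])
      show "(\<lambda>K. K - U) ` {K \<in> nsets {1..n} k. U \<subseteq> K} \<subseteq> {D. D \<subseteq> {1..n} - U \<and> card D = k - card U}"
        using fin by (auto simp: nsets_def card_Diff_subset)
      show "(\<lambda>D. D \<union> U) ` {D. D \<subseteq> {1..n} - U \<and> card D = k - card U} \<subseteq> {K \<in> nsets {1..n} k. U \<subseteq> K}"
      proof clarify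
        fix D assume D: "D \<subseteq> {1..n} - U" "card D = k - card U"
        then have "finite D" "D \<inter> U = {}" using finite_subset by auto
        then show "D \<union> U \<in> nsets {1..n} k \<and> U \<subseteq> D \<union> U"
          using D fin assms by (auto simp: nsets_def card_Un_disjoint)
      qed
    qed auto
  qed
  also have "\<dots> = (n - card U) choose (k - card U)"
    using assms fin by (simp add: n_subsets card_Diff_subset)
  finally show ?thesis .
qed

text \<open>An increasing map is recovered from its range by sorting, so index maps can be counted
  as \<open>k\<close>-subsets.\<close>

lemma bij_betw_increasing_indices:
  "bij_betw (\<lambda>\<alpha>. \<alpha> ` {1..k}) (increasing_indices k n) (nsets {1..n} k)"
proof (rule bij_betwI')
  fix \<alpha> \<beta> assume \<alpha>: "\<alpha> \<in> increasing_indices k n" and \<beta>: "\<beta> \<in> increasing_indices k n"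
  show "(\<alpha> ` {1..k} = \<beta> ` {1..k}) = (\<alpha> = \<beta>)"
  proof
    assume eq: "\<alpha> ` {1..k} = \<beta> ` {1..k}"
    have sorted: "sorted_wrt (<) (map \<gamma> [1..<Suc k])" if "\<gamma> \<in> increasing_indices k n" for \<gamma>
      using that by (auto simp: increasing_indices_def sorted_wrt_map strict_mono_on_def
          intro!: sorted_wrt_mono_rel[OF _ sorted_wrt_upt] simp del: upt_Suc)
    have "map \<alpha> [1..<Suc k] = map \<beta> [1..<Suc k]"
      by (rule strict_sorted_equal[OF sorted[OF \<beta>] sorted[OF \<alpha>]])
         (use eq in \<open>simp add: atLeastLessThanSuc_atLeastAtMost del: upt_Suc\<close>)
    then have "\<alpha> i = \<beta> i" if "i \<in> {1..k}" for i
      using that by (auto simp del: upt_Suc)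
    moreover have "\<alpha> \<in> {1..k} \<rightarrow>\<^sub>E {1..n}" "\<beta> \<in> {1..k} \<rightarrow>\<^sub>E {1..n}"
      using \<alpha> \<beta> by (simp_all add: increasing_indices_def)
    ultimately show "\<alpha> = \<beta>" by (metis PiE_ext)
  qed simp
next
  fix \<alpha> assume "\<alpha> \<in> increasing_indices k n"
  then have "inj_on \<alpha> {1..k}" "\<alpha> ` {1..k} \<subseteq> {1..n}"
    by (auto simp: increasing_indices_def intro: strict_mono_on_imp_inj_on)
  then show "\<alpha> ` {1..k} \<in> nsets {1..n} k"
    by (auto simp: nsets_def card_image)
next
  fix K assume K: "K \<in> nsets {1..n} k"
  then have finK: "finite K" "card K = k" "K \<subseteq> {1..n}" by (auto simp: nsets_def)
  obtain h where h: "bij_betw h {..<card K} K" "strict_mono_on {..<card K} h"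
    using ex_bij_betw_strict_mono_card[OF finK(1)] by blast
  \<comment> \<open>The enumeration \<open>h\<close> starts at 0 while index maps start at 1, hence
    the shift.\<close>
  define \<alpha> where "\<alpha> = restrict (\<lambda>i. h (i - 1)) {1..k}"
  have img: "\<alpha> ` {1..k} = K"
  proof -
    have "(\<lambda>i. i - 1) ` {1..k} = {..<k}"
      by (auto simp: image_iff intro!: bexI[of _ "Suc _"])
    then have "(\<lambda>i. h (i - 1)) ` {1..k} = K"
      using h(1) finK by (metis bij_betw_imp_surj_on image_image)
    then show ?thesis by (simp add: \<alpha>_def)
  qed
  moreover have "\<alpha> \<in> increasing_indices k n"
    unfolding increasing_indices_def
  proof (intro CollectI conjI)
    show "\<alpha> \<in> {1..k} \<rightarrow>\<^sub>E {1..n}"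
      using img finK(3) by (auto simp: \<alpha>_def)
    show "strict_mono_on {1..k} \<alpha>"
    proof (rule strict_mono_onI)
      fix r s assume "r \<in> {1..k}" "s \<in> {1..k}" "r < s"
      then show "\<alpha> r < \<alpha> s"
        using strict_mono_onD[OF h(2), of "r - 1" "s - 1"] finK(2) by (auto simp: \<alpha>_def)
    qed
  qed
  ultimately show "\<exists>\<alpha>\<in>increasing_indices k n. K = \<alpha> ` {1..k}" by auto
qed

lemma finite_increasing_indices: "finite (increasing_indices k n)"
  using bij_betw_finite[OF bij_betw_increasing_indices] by (simp add: finite_imp_finite_nsets)

lemma card_increasing_indices_superset:
  assumes "U \<subseteq> {1..n}" "card U \<le> k"
  shows "card {\<alpha> \<in> increasing_indices k n. U \<subseteq> \<alpha> ` {1..k}} = (n - card U) choose (k - card U)"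
proof -
  have "bij_betw (\<lambda>\<alpha>. \<alpha> ` {1..k}) {\<alpha> \<in> increasing_indices k n. U \<subseteq> \<alpha> ` {1..k}} {K \<in> nsets {1..n} k. U \<subseteq> K}"
    unfolding bij_betw_def
  proof
    show "inj_on (\<lambda>\<alpha>. \<alpha> ` {1..k}) {\<alpha> \<in> increasing_indices k n. U \<subseteq> \<alpha> ` {1..k}}"
      using bij_betw_imp_inj_on[OF bij_betw_increasing_indices] by (rule inj_on_subset) auto
    show "(\<lambda>\<alpha>. \<alpha> ` {1..k}) ` {\<alpha> \<in> increasing_indices k n. U \<subseteq> \<alpha> ` {1..k}} = {K \<in> nsets {1..n} k. U \<subseteq> K}"
      unfolding bij_betw_imp_surj_on[OF bij_betw_increasing_indices, symmetric] by blast
  qed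
  from bij_betw_same_card[OF this] show ?thesis
    by (simp only: card_nsets_superset[OF assms])
qed

lemma choose_diff_le_pow:
  assumes "k \<le> n" "m \<le> k"
  shows "(n - m) choose (k - m) \<le> n ^ (k - m)"
proof -
  have "(n - m) choose (k - m) \<le> (n - m) ^ (k - m)" using assms by (intro binomial_le_pow) auto
  also have "\<dots> \<le> n ^ (k - m)" by (intro power_mono) auto
  finally show ?thesis .
qed

text \<open>\<open>n ^ m\<close> dominates \<open>n choose m\<close>, whose product with the
  remaining binomial is \<open>(n choose k) * (k choose m)\<close>. This route gives a bound valid
  down to \<open>n = k\<close>.\<close>

lemma choose_diff_ge:
  assumes "k \<le> n" "m \<le> k" "1 \<le> n"
  shows "real n ^ k / real k ^ k \<le> real n ^ m * real ((n - m) choose (k - m))"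
proof -
  have "real n ^ k / real k ^ k \<le> real (n choose k)"
    using binomial_ge_n_over_k_pow_k[OF assms(1), where 'a = real] by (simp add: power_divide)
  also have "\<dots> \<le> real ((n choose k) * (k choose m))"
    using assms(2) by (simp del: of_nat_mult add: zero_less_binomial_iff Suc_le_eq)
  also have "(n choose k) * (k choose m) = (n choose m) * ((n - m) choose (k - m))"
    using assms by (intro choose_mult)
  also have "real \<dots> \<le> real (n ^ m * ((n - m) choose (k - m)))"
    using assms by (intro of_nat_mono mult_right_mono binomial_le_pow) auto
  finally show ?thesis by simp
qed

section \<open>Ordered counts of edges, 2-stars and triangles\<close>

definition ordered_edges :: "'a set \<Rightarrow> 'a set set \<Rightarrow> ('a \<times> 'a) set" where
  "ordered_edges V E = {(x, y). x \<in> V \<and> y \<in> V \<and> x \<noteq> y \<and> {x, y} \<in> E}"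

definition triples :: "'a set \<Rightarrow> ('a \<times> 'a \<times> 'a) set" where
  "triples V = {(x, y, z). x \<in> V \<and> y \<in> V \<and> z \<in> V \<and> x \<noteq> y \<and> y \<noteq> z \<and> x \<noteq> z}"

text \<open>Ordered triples make the later sums of products of indicators plain finite sums; the
  symmetry factors 2 and 6 are accounted for once, in the cardinality lemmas.\<close>

definition ordered_two_stars :: "'a set \<Rightarrow> 'a set set \<Rightarrow> ('a \<times> 'a \<times> 'a) set" where
  "ordered_two_stars V E = {(x, y, z) \<in> triples V. {x, y} \<in> E \<and> {y, z} \<in> E}"

definition ordered_triangles :: "'a set \<Rightarrow> 'a set set \<Rightarrow> ('a \<times> 'a \<times> 'a) set" where
  "ordered_triangles V E = {(x, y, z) \<in> triples V. {x, y} \<in> E \<and> {y, z} \<in> E \<and> {x, z} \<in> E}"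

lemma card_fibres_const:
  assumes "finite X" "\<And>x. x \<in> X \<Longrightarrow> card {y \<in> X. F y = F x} = c"
  shows "card X = c * card (F ` X)"
proof -
  have "card X = (\<Sum>x\<in>X. 1)" by simp
  also have "\<dots> = (\<Sum>d\<in>F ` X. \<Sum>x | x \<in> X \<and> F x = d. 1)"
    by (rule sum.image_gen[OF assms(1)])
  also have "\<dots> = (\<Sum>d\<in>F ` X. c)"
    using assms(2) by (intro sum.cong refl) auto
  finally show ?thesis by (simp add: mult.commute)
qed

lemma finite_triples: "finite V \<Longrightarrow> finite (triples V)"
  by (rule finite_subset[of _ "V \<times> V \<times> V"]) (auto simp: triples_def)

lemma finite_ordered_edges: "finite V \<Longrightarrow> finite (ordered_edges V E)"
  by (rule finite_subset[of _ "V \<times> V"]) (auto simp: ordered_edges_def)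

lemma card_ordered_edges:
  assumes "simple_graph V E"
  shows "card (ordered_edges V E) = 2 * card E"
proof -
  let ?F = "\<lambda>(x, y). {x, y}"
  have "card (ordered_edges V E) = 2 * card (?F ` ordered_edges V E)"
  proof (rule card_fibres_const)
    fix t assume "t \<in> ordered_edges V E"
    then obtain x y where t: "t = (x, y)" "x \<in> V" "y \<in> V" "x \<noteq> y" "{x, y} \<in> E"
      by (auto simp: ordered_edges_def)
    then have "{s \<in> ordered_edges V E. ?F s = ?F t} = {(x, y), (y, x)}"
      by (auto simp: ordered_edges_def doubleton_eq_iff insert_commute)
    then show "card {s \<in> ordered_edges V E. ?F s = ?F t} = 2"
      using t by simp
  qed (use assms in \<open>auto simp: simple_graph_def finite_ordered_edges\<close>)
  also have "?F ` ordered_edges V E = E"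
    using assms by (force simp: simple_graph_def ordered_edges_def elim!: nsets2_E)
  finally show ?thesis .
qed

text \<open>The centre of a 2-star is determined by its edges, so the only freedom in the ordering
  is to reverse it.\<close>

lemma card_ordered_two_stars:
  assumes "simple_graph V E"
  shows "card (ordered_two_stars V E) = 2 * two_star_count V E"
proof -
  let ?F = "\<lambda>(x, y, z). ({x, y, z}, {{x, y}, {y, z}})"
  have "card (ordered_two_stars V E) = 2 * card (?F ` ordered_two_stars V E)"
  proof (rule card_fibres_const)
    fix t assume "t \<in> ordered_two_stars V E"
    then obtain x y z where t: "t = (x, y, z)" "(x, y, z) \<in> ordered_two_stars V E" "x \<noteq> z"
      by (auto simp: ordered_two_stars_def triples_def)
    have "{s \<in> ordered_two_stars V E. ?F s = ?F t} = {(x, y, z), (z, y, x)}" (is "?L = ?R")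
    proof (intro equalityI subsetI)
      fix s assume "s \<in> ?L"
      then obtain a b c where s: "s = (a, b, c)" "a \<noteq> b" "b \<noteq> c" "a \<noteq> c" "{{a, b}, {b, c}} = {{x, y}, {y, z}}"
        using t by (auto simp: ordered_two_stars_def triples_def)
      from s(5) have "{a, b} = {x, y} \<and> {b, c} = {y, z} \<or> {a, b} = {y, z} \<and> {b, c} = {x, y}"
        unfolding doubleton_eq_iff[of "{a, b}"] .
      then show "s \<in> ?R" using s(1-4) t(3) by (auto simp: doubleton_eq_iff)
    next
      fix s assume "s \<in> ?R"
      then consider "s = (x, y, z)" | "s = (z, y, x)" by blast
      moreover have "(z, y, x) \<in> ordered_two_stars V E" "?F (z, y, x) = ?F (x, y, z)"
        using t(2) by (simp_all add: ordered_two_stars_def triples_def insert_commute) blast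
      ultimately show "s \<in> ?L"
        using t(1,2) by cases (simp_all only: mem_Collect_eq simp_thms)
    qed
    then show "card {s \<in> ordered_two_stars V E. ?F s = ?F t} = 2"
      using t by simp
  next
    show "finite (ordered_two_stars V E)"
      by (rule finite_subset[OF _ finite_triples[of V]])
         (use assms in \<open>auto simp: simple_graph_def ordered_two_stars_def\<close>)
  qed
  also have "?F ` ordered_two_stars V E = {(V', E'). V' \<subseteq> V \<and> E' \<subseteq> E \<and> simple_graph V' E' \<and>
      graph_isomorphic {1, 2, 3 :: nat} {{1, 2}, {2, 3}} V' E'}" (is "_ = ?P")
  proof (intro equalityI subsetI)
    fix q assume "q \<in> ?F ` ordered_two_stars V E"
    then obtain x y z where q: "q = ({x, y, z}, {{x, y}, {y, z}})" "(x, y, z) \<in> ordered_two_stars V E" by auto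
    define f where "f i = (if i = 1 then x else if i = 2 then y else z)" for i :: nat
    have "bij_betw f {1, 2, 3} {x, y, z}" "{{x, y}, {y, z}} = (`) f ` {{1, 2}, {2, 3}}"
      using q(2) by (auto simp: ordered_two_stars_def triples_def bij_betw_def inj_on_def f_def)
    then have "graph_isomorphic {1, 2, 3 :: nat} {{1, 2}, {2, 3}} {x, y, z} {{x, y}, {y, z}}"
      unfolding graph_isomorphic_def by blast
    then show "q \<in> ?P"
      using q by (auto simp: ordered_two_stars_def triples_def simple_graph_def)
  next
    fix q assume "q \<in> ?P"
    then obtain V' E' f where q: "q = (V', E')" "V' \<subseteq> V" "E' \<subseteq> E" "bij_betw f {1, 2, 3 :: nat} V'"
      "E' = (`) f ` {{1, 2}, {2, 3}}" by (auto simp: graph_isomorphic_def)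
    have "q = ?F (f 1, f 2, f 3)" using q by (auto simp: bij_betw_def)
    moreover have "(f 1, f 2, f 3) \<in> ordered_two_stars V E"
      using q by (auto simp: ordered_two_stars_def triples_def bij_betw_def inj_on_def)
    ultimately show "q \<in> ?F ` ordered_two_stars V E" by blast
  qed
  finally show ?thesis by (simp add: two_star_count_def subgraph_count_def)
qed

lemma card_ordered_triangles:
  assumes "simple_graph V E"
  shows "card (ordered_triangles V E) = 6 * triangle_count V E"
proof -
  let ?F = "\<lambda>(x, y, z). ({x, y, z}, {{x, y}, {y, z}, {x, z}})"
  have "card (ordered_triangles V E) = 6 * card (?F ` ordered_triangles V E)"
  proof (rule card_fibres_const)
    fix t assume "t \<in> ordered_triangles V E"
    then obtain x y z where t: "t = (x, y, z)" "(x, y, z) \<in> ordered_triangles V E" "x \<noteq> y" "y \<noteq> z" "x \<noteq> z"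
      by (auto simp: ordered_triangles_def triples_def)
    have "{s \<in> ordered_triangles V E. ?F s = ?F t} =
        {(x, y, z), (x, z, y), (y, x, z), (y, z, x), (z, x, y), (z, y, x)}" (is "?L = ?R")
    proof (intro equalityI subsetI)
      fix s assume "s \<in> ?L"
      then obtain a b c where s: "s = (a, b, c)" "a \<noteq> b" "b \<noteq> c" "a \<noteq> c" "{a, b, c} = {x, y, z}"
        using t by (auto simp: ordered_triangles_def triples_def)
      then have "a \<in> {x, y, z}" "b \<in> {x, y, z}" "c \<in> {x, y, z}" by auto
      then show "s \<in> ?R" using s by auto
    next
      fix s assume "s \<in> ?R"
      then show "s \<in> ?L"
        using t by (elim insertE emptyE; simp add: ordered_triangles_def triples_def insert_commute; blast?)
    qed
    then show "card {s \<in> ordered_triangles V E. ?F s = ?F t} = 6"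
      using t by simp
  next
    show "finite (ordered_triangles V E)"
      by (rule finite_subset[OF _ finite_triples[of V]])
         (use assms in \<open>auto simp: simple_graph_def ordered_triangles_def\<close>)
  qed
  also have "?F ` ordered_triangles V E = {(V', E'). V' \<subseteq> V \<and> E' \<subseteq> E \<and> simple_graph V' E' \<and>
      graph_isomorphic {1, 2, 3 :: nat} {{1, 2}, {2, 3}, {1, 3}} V' E'}" (is "_ = ?P")
  proof (intro equalityI subsetI)
    fix q assume "q \<in> ?F ` ordered_triangles V E"
    then obtain x y z where q: "q = ({x, y, z}, {{x, y}, {y, z}, {x, z}})" "(x, y, z) \<in> ordered_triangles V E" by auto
    define f where "f i = (if i = 1 then x else if i = 2 then y else z)" for i :: nat
    have "bij_betw f {1, 2, 3} {x, y, z}" "{{x, y}, {y, z}, {x, z}} = (`) f ` {{1, 2}, {2, 3}, {1, 3}}"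
      using q(2) by (auto simp: ordered_triangles_def triples_def bij_betw_def inj_on_def f_def)
    then have "graph_isomorphic {1, 2, 3 :: nat} {{1, 2}, {2, 3}, {1, 3}} {x, y, z} {{x, y}, {y, z}, {x, z}}"
      unfolding graph_isomorphic_def by blast
    then show "q \<in> ?P"
      using q by (auto simp: ordered_triangles_def triples_def simple_graph_def)
  next
    fix q assume "q \<in> ?P"
    then obtain V' E' f where q: "q = (V', E')" "V' \<subseteq> V" "E' \<subseteq> E" "bij_betw f {1, 2, 3 :: nat} V'"
      "E' = (`) f ` {{1, 2}, {2, 3}, {1, 3}}" by (auto simp: graph_isomorphic_def)
    have "q = ?F (f 1, f 2, f 3)" using q by (auto simp: bij_betw_def)
    moreover have "(f 1, f 2, f 3) \<in> ordered_triangles V E"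
      using q by (auto simp: ordered_triangles_def triples_def bij_betw_def inj_on_def)
    ultimately show "q \<in> ?F ` ordered_triangles V E" by blast
  qed
  finally show ?thesis by (simp add: triangle_count_def subgraph_count_def)
qed

section \<open>Walsh coefficients of induced subgraph counts\<close>

lemma card_triples_edge:
  assumes "finite V" "H \<subseteq> nsets V 2"
  shows "card {(x, y, z) \<in> triples V. {x, y} \<in> H} = 2 * card H * (card V - 2)"
proof -
  have "card {(x, y, z) \<in> triples V. {x, y} \<in> H} =
      card (SIGMA t:ordered_edges V H. V - {fst t, snd t})"
  proof (rule bij_betw_same_card)
    show "bij_betw (\<lambda>(x, y, z). ((x, y), z)) {(x, y, z) \<in> triples V. {x, y} \<in> H}
        (SIGMA t:ordered_edges V H. V - {fst t, snd t})"
      by (rule bij_betw_byWitness[where f' = "\<lambda>((x, y), z). (x, y, z)"])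
         (auto simp: triples_def ordered_edges_def)
  qed
  also have "\<dots> = (\<Sum>t\<in>ordered_edges V H. card (V - {fst t, snd t}))"
    using assms(1) by (intro card_SigmaI) (auto simp: finite_ordered_edges)
  also have "\<dots> = (\<Sum>t\<in>ordered_edges V H. card V - 2)"
    using assms(1) by (intro sum.cong refl) (auto simp: ordered_edges_def card_Diff_subset)
  also have "\<dots> = 2 * card H * (card V - 2)"
    using card_ordered_edges[of V H] assms by (simp add: simple_graph_def)
  finally show ?thesis .
qed

text \<open>The first form matches \<open>card_triples_edge\<close>, so that the hypothesis on the
  number of edges cancels; the second is the form in which the conditions on 2-stars and triangles
  are stated.\<close>

lemma card_triples:
  assumes "finite V"
  shows "card (triples V) = 2 * (card V choose 2) * (card V - 2)"
    and "card (triples V) = 6 * (card V choose 3)"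
proof -
  have "triples V = {(x, y, z) \<in> triples V. {x, y} \<in> nsets V 2}"
    by (auto simp: triples_def)
  then show *: "card (triples V) = 2 * (card V choose 2) * (card V - 2)"
    using card_triples_edge[OF assms order_refl] by simp
  show "card (triples V) = 6 * (card V choose 3)"
  proof (cases "3 \<le> card V")
    case True
    then have "(card V choose 3) * (3 choose 2) = (card V choose 2) * ((card V - 2) choose (3 - 2))"
      by (intro choose_mult) auto
    moreover have "(3 :: nat) choose 2 = 3" by (simp add: numeral_eq_Suc)
    ultimately have "(card V choose 2) * (card V - 2) = 3 * (card V choose 3)" by simp
    then show ?thesis unfolding * mult.assoc by simp
  next
    case False
    then have "card V - 2 = 0 \<or> card V choose 2 = 0" by auto
    then show ?thesis unfolding * using False by auto
  qed
qed

lemma sum_triples_rotate: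
  "(\<Sum>(x, y, z)\<in>triples V. f x y z) = (\<Sum>(x, y, z)\<in>triples V. f y z x)"
  by (rule sum.reindex_bij_witness[of _ "\<lambda>(x, y, z). (y, z, x)" "\<lambda>(x, y, z). (z, x, y)"])
     (auto simp: triples_def)

lemma sum_triples_swap:
  "(\<Sum>(x, y, z)\<in>triples V. f x y z) = (\<Sum>(x, y, z)\<in>triples V. f y x z)"
  by (rule sum.reindex_bij_witness[of _ "\<lambda>(x, y, z). (y, x, z)" "\<lambda>(x, y, z). (y, x, z)"])
     (auto simp: triples_def)

locale random_graph_count =
  fixes V :: "'a set" and E :: "'a set set" and p :: real
  assumes p: "0 < p" "p < 1" and graph: "simple_graph V E"
begin

abbreviation k :: nat where "k \<equiv> card V"

abbreviation K2 :: "nat set set" where "K2 \<equiv> nsets {1..k} 2"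

abbreviation copies :: "nat set set set" where "copies \<equiv> isomorphic_copies V E"

lemma finite_V: "finite V" and E_subset: "E \<subseteq> nsets V 2"
  using graph by (auto simp: simple_graph_def)

lemma finite_K2: "finite K2"
  by (simp add: finite_imp_finite_nsets)

lemma copy_subset: "H \<in> copies \<Longrightarrow> H \<subseteq> K2"
  by (auto simp: isomorphic_copies_def simple_graph_def)

lemma finite_copies: "finite copies"
  by (rule finite_subset[of _ "Pow K2"]) (use copy_subset finite_K2 in auto)

lemma copyE:
  assumes "H \<in> copies"
  obtains f where "bij_betw f V {1..k}" "H = (`) f ` E"
  using assms by (auto simp: isomorphic_copies_def graph_isomorphic_def)

lemma copyI:
  assumes "bij_betw f V {1..k}"
  shows "(`) f ` E \<in> copies"
proof -
  have "(`) f ` E \<subseteq> K2"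
  proof clarify
    fix e assume "e \<in> E"
    then have e: "e \<subseteq> V" "finite e" "card e = 2" using E_subset by (auto simp: nsets_def)
    have "inj_on f e" using assms e(1) by (auto simp: bij_betw_def intro: inj_on_subset)
    then show "f ` e \<in> K2" using e assms by (auto simp: nsets_def card_image bij_betw_def)
  qed
  then show ?thesis
    using assms by (auto simp: isomorphic_copies_def graph_isomorphic_def simple_graph_def)
qed

lemma card_copies_pos: "0 < card copies"
proof -
  obtain f where "bij_betw f V {1..k}"
    using finite_same_card_bij[of V "{1..k}"] finite_V by auto
  then show ?thesis using copyI finite_copies card_gt_0_iff by blast
qed

lemma copy_edge_iff:
  assumes "bij_betw f V {1..k}" "e \<subseteq> V"
  shows "f ` e \<in> (`) f ` E \<longleftrightarrow> e \<in> E"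
proof
  assume "f ` e \<in> (`) f ` E"
  then obtain e' where e': "e' \<in> E" "f ` e = f ` e'" by auto
  have "e' \<subseteq> V" using e'(1) E_subset by (auto simp: nsets_def)
  then have "e = e'"
    using e'(2) assms inj_on_image_eq_iff[of f V e e'] by (auto simp: bij_betw_def)
  then show "e \<in> E" using e' by simp
qed simp

lemma copy_edgeE:
  assumes "H \<in> copies"
  obtains f where "bij_betw f V {1..k}"
    and "\<And>x y. x \<in> V \<Longrightarrow> y \<in> V \<Longrightarrow> {f x, f y} \<in> H \<longleftrightarrow> {x, y} \<in> E"
proof -
  obtain f where f: "bij_betw f V {1..k}" "H = (`) f ` E" using copyE[OF assms] .
  show ?thesis
    by (rule that[OF f(1)]) (use copy_edge_iff[OF f(1), of "{_, _}"] f(2) in simp)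
qed

lemma card_copy:
  assumes "H \<in> copies"
  shows "card H = card E"
proof -
  obtain f where f: "bij_betw f V {1..k}" "H = (`) f ` E" using copyE[OF assms] .
  have "inj_on ((`) f) E"
    using f(1) E_subset by (intro inj_on_subset[OF inj_on_image_Pow]) (auto simp: bij_betw_def nsets_def)
  then show ?thesis using f(2) by (simp add: card_image)
qed

lemma bij_betw_triples:
  assumes f: "bij_betw f V W"
    and P: "\<And>x y z. x \<in> V \<Longrightarrow> y \<in> V \<Longrightarrow> z \<in> V \<Longrightarrow> Q (f x) (f y) (f z) \<longleftrightarrow> P x y z"
  shows "card {(x, y, z) \<in> triples V. P x y z} = card {(x, y, z) \<in> triples W. Q x y z}"
proof (rule bij_betw_same_card)
  let ?g = "inv_into V f"
  have g: "?g w \<in> V" "f (?g w) = w" if "w \<in> W" for w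
    using f that by (auto simp: bij_betw_def inv_into_into f_inv_into_f)
  have g': "?g (f v) = v" "f v \<in> W" if "v \<in> V" for v
    using f that by (auto simp: bij_betw_def)
  have inj: "f x = f y \<longleftrightarrow> x = y" if "x \<in> V" "y \<in> V" for x y
    using f that by (auto simp: bij_betw_def dest: inj_onD)
  have injg: "?g x = ?g y \<longleftrightarrow> x = y" if "x \<in> W" "y \<in> W" for x y
    using g that by metis
  have Q: "P (?g x) (?g y) (?g z) \<longleftrightarrow> Q x y z" if "x \<in> W" "y \<in> W" "z \<in> W" for x y z
    using P[of "?g x" "?g y" "?g z"] g that by simp
  show "bij_betw (\<lambda>(x, y, z). (f x, f y, f z)) {(x, y, z) \<in> triples V. P x y z}
      {(x, y, z) \<in> triples W. Q x y z}"
    by (rule bij_betw_byWitness[where f' = "\<lambda>(x, y, z). (?g x, ?g y, ?g z)"])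
       (auto simp: triples_def g g' inj injg P Q)
qed

lemma card_ordered_two_stars_copy:
  assumes "H \<in> copies"
  shows "card (ordered_two_stars {1..k} H) = 2 * two_star_count V E"
proof -
  obtain f where f: "bij_betw f V {1..k}"
    and edge: "\<And>x y. x \<in> V \<Longrightarrow> y \<in> V \<Longrightarrow> {f x, f y} \<in> H \<longleftrightarrow> {x, y} \<in> E"
    by (rule copy_edgeE[OF assms]) blast
  have "card (ordered_two_stars V E) = card (ordered_two_stars {1..k} H)"
    unfolding ordered_two_stars_def
    by (rule bij_betw_triples[OF f]) (simp add: edge)
  then show ?thesis using card_ordered_two_stars[OF graph] by simp
qed

lemma card_ordered_triangles_copy:
  assumes "H \<in> copies"
  shows "card (ordered_triangles {1..k} H) = 6 * triangle_count V E"
proof -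
  obtain f where f: "bij_betw f V {1..k}"
    and edge: "\<And>x y. x \<in> V \<Longrightarrow> y \<in> V \<Longrightarrow> {f x, f y} \<in> H \<longleftrightarrow> {x, y} \<in> E"
    by (rule copy_edgeE[OF assms]) blast
  have "card (ordered_triangles V E) = card (ordered_triangles {1..k} H)"
    unfolding ordered_triangles_def
    by (rule bij_betw_triples[OF f]) (simp add: edge)
  then show ?thesis using card_ordered_triangles[OF graph] by simp
qed

text \<open>The value of the Walsh function of \<open>B\<close> at the graph \<open>H\<close>, which
  is the inner product needed for the coefficient.\<close>

definition centred :: "nat set set \<Rightarrow> nat set set \<Rightarrow> real" where
  "centred B H = (\<Prod>e\<in>B. of_bool (e \<in> H) - p)"

definition copy_prob :: real where
  "copy_prob = p ^ card E * (1 - p) ^ (card K2 - card E)"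

text \<open>The coefficient of \<open>\<chi>\<^bsub>B\<^esub>\<close> in the indicator that the graph on \<open>{1..k}\<close> is isomorphic to \<open>(V, E)\<close>.\<close>

definition coeff :: "nat set set \<Rightarrow> real" where
  "coeff B = copy_prob * (\<Sum>H\<in>copies. centred B H) / (p * (1 - p)) ^ card B"

lemma copy_prob_pos: "0 < copy_prob"
  using p by (simp add: copy_prob_def)

text \<open>Relabelling the vertices permutes the copies, so the sum over copies does not
  change.\<close>

lemma coeff_image_bij:
  assumes \<pi>: "bij_betw \<pi> {1..k} {1..k}" and B: "B \<subseteq> K2"
  shows "coeff ((`) \<pi> ` B) = coeff B"
proof -
  let ?\<pi> = "\<lambda>e. \<pi> ` e"
  have inj: "inj_on ?\<pi> (Pow {1..k})"
    using \<pi> by (intro inj_on_image_Pow) (auto simp: bij_betw_def)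
  have K2_Pow: "K2 \<subseteq> Pow {1..k}" by (auto simp: nsets_def)
  have injB: "inj_on ?\<pi> B" using inj B K2_Pow by (rule inj_on_subset[OF _ order_trans])
  have closed: "?\<pi> ` H \<in> copies" if "H \<in> copies" for H
  proof -
    obtain f where f: "bij_betw f V {1..k}" "H = (`) f ` E" by (rule copyE[OF \<open>H \<in> copies\<close>])
    have "(\<lambda>e. (\<pi> \<circ> f) ` e) ` E \<in> copies"
      by (rule copyI) (rule bij_betw_trans[OF f(1) \<pi>])
    then show ?thesis by (simp add: f(2) image_image image_comp)
  qed
  have inj_copies: "inj_on (\<lambda>H. ?\<pi> ` H) copies"
    by (rule inj_on_subset[OF inj_on_image_Pow[OF inj]]) (use copy_subset K2_Pow in blast)
  have surj: "(\<lambda>H. ?\<pi> ` H) ` copies = copies"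
    by (rule endo_inj_surj[OF finite_copies _ inj_copies]) (use closed in blast)
  have "(\<Sum>H\<in>copies. centred (?\<pi> ` B) H) = (\<Sum>H\<in>copies. centred (?\<pi> ` B) (?\<pi> ` H))"
    by (subst surj[symmetric], subst sum.reindex[OF inj_copies]) simp
  also have "\<dots> = (\<Sum>H\<in>copies. centred B H)"
  proof (rule sum.cong[OF refl])
    fix H assume H: "H \<in> copies"
    have "?\<pi> e \<in> ?\<pi> ` H \<longleftrightarrow> e \<in> H" if "e \<in> B" for e
      using inj_on_image_mem_iff[OF inj, of e H] that B copy_subset[OF H] K2_Pow by blast
    then show "centred (?\<pi> ` B) (?\<pi> ` H) = centred B H"
      unfolding centred_def by (subst prod.reindex[OF injB]) simp
  qed
  finally show ?thesis
    by (simp add: coeff_def card_image[OF injB])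
qed

text \<open>The coefficient depends only on the shape of \<open>B\<close>: an injection on its
  vertices extends to a permutation of \<open>{1..k}\<close> because the complements have equal
  size.\<close>

lemma coeff_image:
  assumes B: "B \<subseteq> K2" and f: "inj_on f (\<Union>B)" "f ` \<Union>B \<subseteq> {1..k}"
  shows "coeff ((`) f ` B) = coeff B"
proof -
  have UB: "\<Union>B \<subseteq> {1..k}" using B by (auto simp: nsets_def)
  then have fin: "finite (\<Union>B)" by (rule finite_subset) simp
  have "card ({1..k} - \<Union>B) = card ({1..k} - f ` \<Union>B)"
    using UB f fin by (simp add: card_Diff_subset card_image)
  then obtain h where h: "bij_betw h ({1..k} - \<Union>B) ({1..k} - f ` \<Union>B)"
    using finite_same_card_bij[of "{1..k} - \<Union>B" "{1..k} - f ` \<Union>B"] by auto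
  define \<pi> where "\<pi> x = (if x \<in> \<Union>B then f x else h x)" for x
  have "bij_betw \<pi> (\<Union>B) (f ` \<Union>B)"
    using f(1) by (simp add: bij_betw_def \<pi>_def inj_on_def)
  moreover have "bij_betw \<pi> ({1..k} - \<Union>B) ({1..k} - f ` \<Union>B)"
    using h by (subst bij_betw_cong[of _ _ h]) (auto simp: \<pi>_def)
  ultimately have "bij_betw \<pi> (\<Union>B \<union> ({1..k} - \<Union>B)) (f ` \<Union>B \<union> ({1..k} - f ` \<Union>B))"
    by (rule bij_betw_combine) auto
  moreover have "\<Union>B \<union> ({1..k} - \<Union>B) = {1..k}" "f ` \<Union>B \<union> ({1..k} - f ` \<Union>B) = {1..k}"
    using UB f(2) by auto
  ultimately have "bij_betw \<pi> {1..k} {1..k}" by simp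
  moreover have "(`) f ` B = (`) \<pi> ` B"
    by (intro image_cong refl) (auto simp: \<pi>_def)
  ultimately show ?thesis using coeff_image_bij[OF _ B] by simp
qed

text \<open>Double counting. All placements \<open>S t\<close> of one shape share the coefficient
  \<open>c\<close>, and summing over placements first gives a value \<open>d\<close> that is the
  same for every copy; the remaining factors are nonzero.\<close>

lemma coeff_eq_0_iff:
  assumes "\<And>t. t \<in> X \<Longrightarrow> coeff (S t) = c" "\<And>t. t \<in> X \<Longrightarrow> card (S t) = m" "X \<noteq> {}" "finite X"
    and "\<And>H. H \<in> copies \<Longrightarrow> (\<Sum>t\<in>X. centred (S t) H) = d"
  shows "c = 0 \<longleftrightarrow> d = 0"
proof -
  have "card X * c = (\<Sum>t\<in>X. coeff (S t))" using assms(1) by simp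
  also have "\<dots> = (\<Sum>t\<in>X. copy_prob * (\<Sum>H\<in>copies. centred (S t) H) / (p * (1 - p)) ^ m)"
    using assms(2) by (intro sum.cong refl) (simp add: coeff_def)
  also have "\<dots> = copy_prob * (\<Sum>H\<in>copies. \<Sum>t\<in>X. centred (S t) H) / (p * (1 - p)) ^ m"
    by (subst sum.swap) (simp add: sum_distrib_left sum_divide_distrib)
  also have "\<dots> = copy_prob * (card copies * d) / (p * (1 - p)) ^ m"
    using assms(5) by simp
  finally show ?thesis
    using assms(3,4) p copy_prob_pos card_copies_pos by auto
qed

text \<open>Summed over all ordered pairs, the centred indicators of a copy give twice the excess of
  its edge number over \<open>p * (k choose 2)\<close>.\<close>

lemma coeff_edge_eq_0_iff:
  assumes "x \<in> {1..k}" "y \<in> {1..k}" "x \<noteq> y"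
  shows "coeff {{x, y}} = 0 \<longleftrightarrow> real (card E) = p * real (k choose 2)"
proof -
  let ?X = "ordered_edges {1..k} K2"
  let ?S = "\<lambda>(u, v). {{u, v}}"
  have "coeff {{x, y}} = 0 \<longleftrightarrow> 2 * (real (card E) - p * real (k choose 2)) = 0"
  proof (rule coeff_eq_0_iff[where X = ?X and S = ?S and m = 1])
    fix t assume "t \<in> ?X"
    then obtain u v where t: "t = (u, v)" "u \<in> {1..k}" "v \<in> {1..k}" "u \<noteq> v"
      by (auto simp: ordered_edges_def)
    let ?f = "\<lambda>i. if i = x then u else v"
    show "card (?S t) = 1" using t by simp
    have "coeff ((`) ?f ` {{x, y}}) = coeff {{x, y}}"
      by (rule coeff_image) (use assms t in \<open>auto simp: inj_on_def\<close>)
    moreover have "(`) ?f ` {{x, y}} = ?S t"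
      using assms t by auto
    ultimately show "coeff (?S t) = coeff {{x, y}}" by simp
  next
    show "?X \<noteq> {}" using assms by (auto simp: ordered_edges_def)
    show "finite ?X" by (simp add: finite_ordered_edges)
  next
    fix H assume H: "H \<in> copies"
    have "(\<Sum>t\<in>?X. centred (?S t) H) = (\<Sum>(u, v)\<in>?X. of_bool ({u, v} \<in> H)) - p * card ?X"
      by (simp add: centred_def split_def sum_subtractf)
    also have "(\<Sum>(u, v)\<in>?X. of_bool ({u, v} \<in> H)) = real (card (ordered_edges {1..k} H))"
    proof -
      have "(\<Sum>(u, v)\<in>?X. of_bool ({u, v} \<in> H)) = (\<Sum>t\<in>ordered_edges {1..k} H. 1 :: real)"
      proof (rule sum.mono_neutral_cong_right)
        show "finite ?X" by (simp add: finite_ordered_edges)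
      qed (use copy_subset[OF H] in \<open>auto simp: ordered_edges_def\<close>)
      then show ?thesis by simp
    qed
    also have "card (ordered_edges {1..k} H) = 2 * card E"
      using card_ordered_edges[of "{1..k}" H] copy_subset[OF H] card_copy[OF H] by (simp add: simple_graph_def)
    also have "card ?X = 2 * (k choose 2)"
      using card_ordered_edges[of "{1..k}" K2] by (simp add: simple_graph_def)
    finally show "(\<Sum>t\<in>?X. centred (?S t) H) = 2 * (real (card E) - p * real (k choose 2))"
      by (simp add: algebra_simps)
  qed
  then show ?thesis by auto
qed

abbreviation D3 :: "(nat \<times> nat \<times> nat) set" where "D3 \<equiv> triples {1..k}"

lemma sum_edge_triples:
  assumes "H \<in> copies" "real (card E) = p * real (k choose 2)"
  shows "(\<Sum>(x, y, z)\<in>D3. of_bool ({x, y} \<in> H)) = p * real (card D3)"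
proof -
  have "(\<Sum>(x, y, z)\<in>D3. of_bool ({x, y} \<in> H)) = (\<Sum>t\<in>{(x, y, z) \<in> D3. {x, y} \<in> H}. 1 :: real)"
    by (intro sum.mono_neutral_cong_right) (auto simp: finite_triples)
  also have "\<dots> = real (2 * card H * (k - 2))"
    using card_triples_edge[of "{1..k}" H] copy_subset[OF assms(1)] by simp
  also have "\<dots> = 2 * real (card E) * real (k - 2)"
    using card_copy[OF assms(1)] by simp
  also have "\<dots> = p * real (2 * (k choose 2) * (k - 2))"
    unfolding assms(2) by simp
  also have "2 * (k choose 2) * (k - 2) = card D3"
    using card_triples(1)[of "{1..k}"] by simp
  finally show ?thesis .
qed

lemma sum_two_star_triples:
  assumes "H \<in> copies"
  shows "(\<Sum>(x, y, z)\<in>D3. of_bool ({x, y} \<in> H) * of_bool ({y, z} \<in> H)) = 2 * real (two_star_count V E)"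
proof -
  have "(\<Sum>(x, y, z)\<in>D3. of_bool ({x, y} \<in> H) * of_bool ({y, z} \<in> H)) = (\<Sum>t\<in>ordered_two_stars {1..k} H. 1 :: real)"
    by (intro sum.mono_neutral_cong_right) (auto simp: finite_triples ordered_two_stars_def)
  also have "\<dots> = 2 * real (two_star_count V E)"
    using card_ordered_two_stars_copy[OF assms] by simp
  finally show ?thesis .
qed

lemma sum_triangle_triples:
  assumes "H \<in> copies"
  shows "(\<Sum>(x, y, z)\<in>D3. of_bool ({x, y} \<in> H) * of_bool ({y, z} \<in> H) * of_bool ({x, z} \<in> H)) =
    6 * real (triangle_count V E)"
proof -
  have "(\<Sum>(x, y, z)\<in>D3. of_bool ({x, y} \<in> H) * of_bool ({y, z} \<in> H) * of_bool ({x, z} \<in> H)) =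
      (\<Sum>t\<in>ordered_triangles {1..k} H. 1 :: real)"
    by (intro sum.mono_neutral_cong_right) (auto simp: finite_triples ordered_triangles_def)
  also have "\<dots> = 6 * real (triangle_count V E)"
    using card_ordered_triangles_copy[OF assms] by simp
  finally show ?thesis .
qed

text \<open>With edge density exactly \<open>p\<close>, each of the two linear terms of the centred
  product contributes \<open>- p^2\<close> per triple and the constant \<open>p^2\<close>, leaving
  twice the number of 2-stars minus \<open>p^2\<close> times the number of triples.\<close>

lemma coeff_two_star_eq_0_iff:
  assumes e: "real (card E) = p * real (k choose 2)" and xyz: "(x, y, z) \<in> D3"
  shows "coeff {{x, y}, {y, z}} = 0 \<longleftrightarrow> real (two_star_count V E) = 3 * p\<^sup>2 * real (k choose 3)"
proof -
  let ?S = "\<lambda>(u, v, w). {{u, v}, {v, w}}"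
  have "coeff {{x, y}, {y, z}} = 0 \<longleftrightarrow> 2 * real (two_star_count V E) - p\<^sup>2 * real (card D3) = 0"
  proof (rule coeff_eq_0_iff[where X = D3 and S = ?S and m = 2])
    fix t assume "t \<in> D3"
    then obtain u v w where t: "t = (u, v, w)" "(u, v, w) \<in> D3" by (cases t) auto
    let ?f = "\<lambda>i. if i = x then u else if i = y then v else w"
    show "card (?S t) = 2" using t by (auto simp: triples_def doubleton_eq_iff)
    have "coeff ((`) ?f ` {{x, y}, {y, z}}) = coeff {{x, y}, {y, z}}"
      by (rule coeff_image) (use xyz t in \<open>auto simp: inj_on_def triples_def\<close>)
    moreover have "(`) ?f ` {{x, y}, {y, z}} = ?S t"
      using xyz t by (auto simp: triples_def)
    ultimately show "coeff (?S t) = coeff {{x, y}, {y, z}}" by simp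
  next
    show "D3 \<noteq> {}" "finite D3" using xyz by (auto simp: finite_triples)
  next
    fix H assume H: "H \<in> copies"
    let ?h = "\<lambda>x y. of_bool ({x, y} \<in> H) :: real"
    have "(\<Sum>t\<in>D3. centred (?S t) H) = (\<Sum>(x, y, z)\<in>D3. ?h x y * ?h y z - p * ?h x y - p * ?h y z + p\<^sup>2)"
    proof (rule sum.cong[OF refl], clarify)
      fix x y z assume "(x, y, z) \<in> D3"
      then have "{x, y} \<noteq> {y, z}" by (auto simp: triples_def doubleton_eq_iff)
      then show "centred {{x, y}, {y, z}} H = ?h x y * ?h y z - p * ?h x y - p * ?h y z + p\<^sup>2"
        by (simp add: centred_def power2_eq_square algebra_simps)
    qed
    also have "\<dots> = (\<Sum>(x, y, z)\<in>D3. ?h x y * ?h y z) - p * (\<Sum>(x, y, z)\<in>D3. ?h x y)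
        - p * (\<Sum>(x, y, z)\<in>D3. ?h y z) + p\<^sup>2 * card D3"
      by (simp add: split_def sum.distrib sum_subtractf sum_distrib_left)
    also have "(\<Sum>(x, y, z)\<in>D3. ?h y z) = (\<Sum>(x, y, z)\<in>D3. ?h x y)"
      by (rule sum_triples_rotate[symmetric])
    finally show "(\<Sum>t\<in>D3. centred (?S t) H) = 2 * real (two_star_count V E) - p\<^sup>2 * real (card D3)"
      unfolding sum_edge_triples[OF H e] sum_two_star_triples[OF H] by (simp add: power2_eq_square)
  qed
  then show ?thesis
    unfolding card_triples(2)[OF finite_atLeastAtMost] by auto
qed

text \<open>The condition on 2-stars says that two adjacent edges have density \<open>p^2\<close>
  among triples. The lower terms then contribute \<open>- 3 p^3 + 3 p^3 - p^3\<close> per triple, so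
  only the excess of triangles over density \<open>p^3\<close> remains.\<close>

lemma coeff_triangle_eq_0_iff:
  assumes e: "real (card E) = p * real (k choose 2)"
    and s: "real (two_star_count V E) = 3 * p\<^sup>2 * real (k choose 3)" and xyz: "(x, y, z) \<in> D3"
  shows "coeff {{x, y}, {y, z}, {x, z}} = 0 \<longleftrightarrow> real (triangle_count V E) = p ^ 3 * real (k choose 3)"
proof -
  let ?S = "\<lambda>(u, v, w). {{u, v}, {v, w}, {u, w}}"
  have D: "real (card D3) = 6 * real (k choose 3)"
    using card_triples(2)[of "{1..k}"] by simp
  have "coeff {{x, y}, {y, z}, {x, z}} = 0 \<longleftrightarrow> 6 * real (triangle_count V E) - p ^ 3 * real (card D3) = 0"
  proof (rule coeff_eq_0_iff[where X = D3 and S = ?S and m = 3])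
    fix t assume "t \<in> D3"
    then obtain u v w where t: "t = (u, v, w)" "(u, v, w) \<in> D3" by (cases t) auto
    let ?f = "\<lambda>i. if i = x then u else if i = y then v else w"
    show "card (?S t) = 3" using t by (auto simp: triples_def doubleton_eq_iff)
    have "coeff ((`) ?f ` {{x, y}, {y, z}, {x, z}}) =
        coeff {{x, y}, {y, z}, {x, z}}"
      by (rule coeff_image) (use xyz t in \<open>auto simp: inj_on_def triples_def\<close>)
    moreover have "(`) ?f ` {{x, y}, {y, z}, {x, z}} = ?S t"
      using xyz t by (auto simp: triples_def)
    ultimately show "coeff (?S t) = coeff {{x, y}, {y, z}, {x, z}}" by simp
  next
    show "D3 \<noteq> {}" "finite D3" using xyz by (auto simp: finite_triples)
  next
    fix H assume H: "H \<in> copies"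
    let ?h = "\<lambda>x y. of_bool ({x, y} \<in> H) :: real"
    have comm: "?h x y = ?h y x" for x y by (simp add: insert_commute)
    have "(\<Sum>t\<in>D3. centred (?S t) H) = (\<Sum>(x, y, z)\<in>D3. ?h x y * ?h y z * ?h x z
        - p * (?h x y * ?h y z + ?h x y * ?h x z + ?h y z * ?h x z)
        + p\<^sup>2 * (?h x y + ?h y z + ?h x z) - p ^ 3)"
    proof (rule sum.cong[OF refl], clarify)
      fix x y z assume "(x, y, z) \<in> D3"
      then have "{x, y} \<noteq> {y, z}" "{x, y} \<noteq> {x, z}" "{y, z} \<noteq> {x, z}"
        by (auto simp: triples_def doubleton_eq_iff)
      then show "centred {{x, y}, {y, z}, {x, z}} H = ?h x y * ?h y z * ?h x z
        - p * (?h x y * ?h y z + ?h x y * ?h x z + ?h y z * ?h x z)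
        + p\<^sup>2 * (?h x y + ?h y z + ?h x z) - p ^ 3"
        by (simp add: centred_def power2_eq_square power3_eq_cube algebra_simps)
    qed
    also have "\<dots> = (\<Sum>(x, y, z)\<in>D3. ?h x y * ?h y z * ?h x z)
        - p * ((\<Sum>(x, y, z)\<in>D3. ?h x y * ?h y z) + (\<Sum>(x, y, z)\<in>D3. ?h x y * ?h x z) + (\<Sum>(x, y, z)\<in>D3. ?h y z * ?h x z))
        + p\<^sup>2 * ((\<Sum>(x, y, z)\<in>D3. ?h x y) + (\<Sum>(x, y, z)\<in>D3. ?h y z) + (\<Sum>(x, y, z)\<in>D3. ?h x z)) - p ^ 3 * card D3"
      by (simp add: split_def distrib_left sum.distrib sum_subtractf sum_distrib_left)
    also have "(\<Sum>(x, y, z)\<in>D3. ?h y z) = (\<Sum>(x, y, z)\<in>D3. ?h x y)"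
      by (rule sum_triples_rotate[symmetric])
    also have "(\<Sum>(x, y, z)\<in>D3. ?h x z) = (\<Sum>(x, y, z)\<in>D3. ?h x y)"
      using sum_triples_swap[of "\<lambda>x y z. ?h y z" "{1..k}"] sum_triples_rotate[of "\<lambda>x y z. ?h x y" "{1..k}"] by simp
    also have "(\<Sum>(x, y, z)\<in>D3. ?h x y * ?h x z) = (\<Sum>(x, y, z)\<in>D3. ?h x y * ?h y z)"
      using sum_triples_swap[of "\<lambda>x y z. ?h x y * ?h x z" "{1..k}"] by (simp add: comm)
    also have "(\<Sum>(x, y, z)\<in>D3. ?h y z * ?h x z) = (\<Sum>(x, y, z)\<in>D3. ?h x y * ?h y z)"
      using sum_triples_rotate[of "\<lambda>x y z. ?h x y * ?h y z" "{1..k}"] by (simp add: comm)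
    finally show "(\<Sum>t\<in>D3. centred (?S t) H) = 6 * real (triangle_count V E) - p ^ 3 * real (card D3)"
      unfolding sum_edge_triples[OF H e] sum_two_star_triples[OF H] sum_triangle_triples[OF H] s D
      by (simp add: power2_eq_square power3_eq_cube)
  qed
  then show ?thesis unfolding D by auto
qed

declare One_nat_def [simp del]

section \<open>From coefficients on \<open>{1..k}\<close> to the Walsh series of the count on
  \<open>{1..n}\<close>\<close>

lemma increasing_indicesD:
  assumes "\<alpha> \<in> increasing_indices k n"
  shows "inj_on \<alpha> {1..k}" "\<alpha> ` {1..k} \<subseteq> {1..n}"
  using assms by (auto simp: increasing_indices_def intro: strict_mono_on_imp_inj_on)

lemma K2_Pow: "K2 \<subseteq> Pow {1..k}"
  by (auto simp: nsets_def)

lemma Union_K2: "B \<subseteq> K2 \<Longrightarrow> \<Union>B \<subseteq> {1..k}"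
  using K2_Pow by blast

lemma image_edge:
  assumes "inj_on f (\<Union>B)" "f ` \<Union>B \<subseteq> {1..n}" "B \<subseteq> nsets W 2"
  shows "(`) f ` B \<subseteq> nsets {1..n} 2"
proof clarify
  fix e assume e: "e \<in> B"
  then have "finite e" "card e = 2" using assms(3) by (auto simp: nsets_def)
  moreover have "inj_on f e" using assms(1) e by (auto intro: inj_on_subset)
  ultimately show "f ` e \<in> nsets {1..n} 2"
    using assms(2) e by (auto simp: nsets_def card_image)
qed

lemma inj_on_edge_image: "inj_on f (\<Union>B) \<Longrightarrow> inj_on ((`) f) B"
  by (rule inj_on_subset[OF inj_on_image_Pow]) auto

text \<open>Each factor is affine in \<open>x e\<close>; pulling out its value at 0, which is
  \<open>p\<close> or \<open>1 - p\<close>, leaves 1 plus a multiple of \<open>x e\<close> with the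
  centred indicator of \<open>e\<close> in the numerator. Multiplying out gives the sum over
  \<open>B\<close>.\<close>

lemma copy_indicator_expansion:
  assumes H: "H \<in> copies"
  shows "(\<Prod>e\<in>K2. if e \<in> H then p + x e else 1 - (p + x e)) =
    copy_prob * (\<Sum>B\<in>Pow K2. centred B H / (p * (1 - p)) ^ card B * (\<Prod>e\<in>B. x e))"
proof -
  have "(\<Prod>e\<in>K2. if e \<in> H then p + x e else 1 - (p + x e)) =
      (\<Prod>e\<in>K2. (if e \<in> H then p else 1 - p) * ((of_bool (e \<in> H) - p) / (p * (1 - p)) * x e + 1))"
    using p by (intro prod.cong refl) (auto simp: field_simps)
  also have "\<dots> = (\<Prod>e\<in>K2. if e \<in> H then p else 1 - p) *
      (\<Prod>e\<in>K2. (of_bool (e \<in> H) - p) / (p * (1 - p)) * x e + 1)"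
    by (rule prod.distrib)
  also have "(\<Prod>e\<in>K2. if e \<in> H then p else 1 - p) = copy_prob"
  proof -
    have "K2 \<inter> {e. e \<in> H} = H" "K2 \<inter> - {e. e \<in> H} = K2 - H"
      using copy_subset[OF H] by auto
    then have "(\<Prod>e\<in>K2. if e \<in> H then p else 1 - p) = p ^ card H * (1 - p) ^ card (K2 - H)"
      by (simp only: prod.If_cases[OF finite_K2] prod_constant)
    then show ?thesis
      using copy_subset[OF H] finite_subset[OF copy_subset[OF H] finite_K2]
      by (simp only: copy_prob_def card_copy[OF H] card_Diff_subset)
  qed
  also have "(\<Prod>e\<in>K2. (of_bool (e \<in> H) - p) / (p * (1 - p)) * x e + 1) =
      (\<Sum>B\<in>Pow K2. centred B H / (p * (1 - p)) ^ card B * (\<Prod>e\<in>B. x e))"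
    by (subst prod_add[OF finite_K2]) (simp add: prod.distrib prod_dividef centred_def)
  finally show ?thesis .
qed

lemma copy_indicator_pairs:
  fixes f :: "nat set \<Rightarrow> real"
  shows "(\<Prod>(i, j)\<in>{(i, j). 1 \<le> i \<and> i < j \<and> j \<le> k \<and> {i, j} \<in> H}. f {i, j}) *
    (\<Prod>(i, j)\<in>{(i, j). 1 \<le> i \<and> i < j \<and> j \<le> k \<and> {i, j} \<notin> H}. 1 - f {i, j}) =
    (\<Prod>e\<in>K2. if e \<in> H then f e else 1 - f e)"
proof -
  let ?P = "{(i, j). 1 \<le> i \<and> i < j \<and> j \<le> k}"
  have fin: "finite ?P"
    by (rule finite_subset[of _ "{1..k} \<times> {1..k}"]) auto
  have bij: "bij_betw (\<lambda>(i, j). {i, j}) ?P K2"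
  proof (rule bij_betwI')
    fix s t assume "s \<in> ?P" "t \<in> ?P"
    then show "((\<lambda>(i, j). {i, j}) s = (\<lambda>(i, j). {i, j}) t) = (s = t)"
      by (auto simp: doubleton_eq_iff)
  next
    fix t assume "t \<in> ?P"
    then show "(\<lambda>(i, j). {i, j}) t \<in> K2" by auto
  next
    fix e assume "e \<in> K2"
    then obtain i j where e: "e = {i, j}" "i \<in> {1..k}" "j \<in> {1..k}" "i \<noteq> j"
      by (auto elim: nsets2_E)
    show "\<exists>t\<in>?P. e = (\<lambda>(i, j). {i, j}) t"
    proof (cases "i < j")
      case True
      then show ?thesis using e by (intro bexI[of _ "(i, j)"]) auto
    next
      case False
      then show ?thesis using e by (intro bexI[of _ "(j, i)"]) (auto simp: insert_commute)
    qed
  qed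
  have "(\<Prod>e\<in>K2. if e \<in> H then f e else 1 - f e) =
      (\<Prod>t\<in>?P. if t \<in> {(i, j). {i, j} \<in> H} then (case t of (i, j) \<Rightarrow> f {i, j}) else (case t of (i, j) \<Rightarrow> 1 - f {i, j}))"
    by (subst prod.reindex_bij_betw[OF bij, symmetric]) (auto intro!: prod.cong)
  also have "\<dots> = (\<Prod>(i, j)\<in>?P \<inter> {(i, j). {i, j} \<in> H}. f {i, j}) * (\<Prod>(i, j)\<in>?P \<inter> - {(i, j). {i, j} \<in> H}. 1 - f {i, j})"
    by (subst prod.If_cases[OF fin]) (simp only: Collect_mem_eq)
  also have "?P \<inter> {(i, j). {i, j} \<in> H} = {(i, j). 1 \<le> i \<and> i < j \<and> j \<le> k \<and> {i, j} \<in> H}" by auto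
  also have "?P \<inter> - {(i, j). {i, j} \<in> H} = {(i, j). 1 \<le> i \<and> i < j \<and> j \<le> k \<and> {i, j} \<notin> H}" by auto
  finally show ?thesis by simp
qed

text \<open>The Walsh coefficient of the count at the edge set \<open>A\<close> of
  \<open>{1..n}\<close>, collected over all placements of patterns \<open>B\<close> that land on
  \<open>A\<close>.\<close>

definition tau :: "nat \<Rightarrow> nat set set \<Rightarrow> real" where
  "tau n A = (\<Sum>\<alpha>\<in>increasing_indices k n. \<Sum>B\<in>Pow K2. if (`) \<alpha> ` B = A then coeff B else 0)"

lemma cube: "bernoulli_cube (nsets {1..n :: nat} 2) p"
  by unfold_locales (use p in \<open>auto simp: finite_imp_finite_nsets\<close>)

lemma induced_count_eq_walsh: "induced_count V E n = bernoulli_cube.walsh (nsets {1..n} 2) p (tau n)"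
proof
  fix v :: "nat set \<Rightarrow> bool"
  interpret cube: bernoulli_cube "nsets {1..n} 2" p by (rule cube)
  let ?J = "increasing_indices k n"
  let ?pr = "\<lambda>\<alpha> H. (\<Prod>(i, j)\<in>{(i, j). 1 \<le> i \<and> i < j \<and> j \<le> k \<and> {i, j} \<in> H}. edge_indicator v (\<alpha> i) (\<alpha> j)) *
        (\<Prod>(i, j)\<in>{(i, j). 1 \<le> i \<and> i < j \<and> j \<le> k \<and> {i, j} \<notin> H}. 1 - edge_indicator v (\<alpha> i) (\<alpha> j))"
  have copies_sum: "(\<Sum>H\<in>copies. ?pr \<alpha> H) =
      (\<Sum>B\<in>Pow K2. coeff B * cube.chi ((`) \<alpha> ` B) v)" if \<alpha>: "\<alpha> \<in> ?J" for \<alpha>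
  proof -
    let ?x = "\<lambda>e. cube.xi (\<alpha> ` e) v"
    have chi: "(\<Prod>e\<in>B. ?x e) = cube.chi ((`) \<alpha> ` B) v" if "B \<in> Pow K2" for B
    proof -
      have "inj_on \<alpha> (\<Union>B)"
        using increasing_indicesD(1)[OF \<alpha>] Union_K2[of B] that by (auto intro: inj_on_subset)
      then show ?thesis
        unfolding cube.chi_def by (subst prod.reindex[OF inj_on_edge_image]) auto
    qed
    have "?pr \<alpha> H =
      (\<Prod>e\<in>K2. if e \<in> H then p + ?x e else 1 - (p + ?x e))" for H
      using copy_indicator_pairs[of "\<lambda>e. p + ?x e" H] by (simp add: edge_indicator_def cube.xi_def)
    then have "(\<Sum>H\<in>copies. ?pr \<alpha> H) =
      (\<Sum>H\<in>copies. copy_prob * (\<Sum>B\<in>Pow K2. centred B H / (p * (1 - p)) ^ card B * (\<Prod>e\<in>B. ?x e)))"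
      by (simp add: copy_indicator_expansion)
    also have "\<dots> = (\<Sum>B\<in>Pow K2. \<Sum>H\<in>copies. copy_prob * (centred B H / (p * (1 - p)) ^ card B * (\<Prod>e\<in>B. ?x e)))"
      unfolding sum_distrib_left by (rule sum.swap)
    also have "\<dots> = (\<Sum>B\<in>Pow K2. coeff B * (\<Prod>e\<in>B. ?x e))"
      by (intro sum.cong refl) (simp add: coeff_def sum_distrib_left sum_distrib_right sum_divide_distrib mult_ac)
    finally show ?thesis using chi by simp
  qed
  have sub: "(`) \<alpha> ` B \<in> Pow (nsets {1..n} 2)" if "\<alpha> \<in> ?J" "B \<in> Pow K2" for \<alpha> B
    using image_edge[of \<alpha> B n "{1..k}"] increasing_indicesD[OF that(1)] Union_K2[of B] that(2)
    by (auto intro: inj_on_subset)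
  have "cube.walsh (tau n) v =
      (\<Sum>A\<in>Pow (nsets {1..n} 2). \<Sum>\<alpha>\<in>?J. \<Sum>B\<in>Pow K2. if (`) \<alpha> ` B = A then coeff B * cube.chi A v else 0)"
    unfolding cube.walsh_def tau_def sum_distrib_right by (intro sum.cong refl) simp
  also have "\<dots> = (\<Sum>\<alpha>\<in>?J. \<Sum>A\<in>Pow (nsets {1..n} 2). \<Sum>B\<in>Pow K2. if (`) \<alpha> ` B = A then coeff B * cube.chi A v else 0)"
    by (rule sum.swap)
  also have "\<dots> = (\<Sum>\<alpha>\<in>?J. \<Sum>B\<in>Pow K2. \<Sum>A\<in>Pow (nsets {1..n} 2). if (`) \<alpha> ` B = A then coeff B * cube.chi A v else 0)"
    by (intro sum.cong refl sum.swap)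
  also have "\<dots> = (\<Sum>\<alpha>\<in>?J. \<Sum>B\<in>Pow K2. coeff B * cube.chi ((`) \<alpha> ` B) v)"
    by (intro sum.cong refl, subst sum.delta') (use sub in \<open>auto simp: finite_imp_finite_nsets\<close>)
  also have "\<dots> = induced_count V E n v"
    unfolding induced_count_def by (rule sum.cong[OF refl copies_sum[symmetric]])
  finally show "induced_count V E n v = cube.walsh (tau n) v" ..
qed

definition coeff_bound :: real where
  "coeff_bound = (\<Sum>B\<in>Pow K2. \<bar>coeff B\<bar>)"

lemma coeff_bound_nonneg: "0 \<le> coeff_bound"
  by (simp add: coeff_bound_def sum_nonneg)

lemma tau_nonzeroE:
  assumes "tau n A \<noteq> 0"
  obtains \<alpha> B where "\<alpha> \<in> increasing_indices k n" "B \<subseteq> K2" "(`) \<alpha> ` B = A" "coeff B \<noteq> 0"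
proof -
  let ?t = "\<lambda>\<alpha>. \<Sum>B\<in>Pow K2. if (`) \<alpha> ` B = A then coeff B else 0"
  obtain \<alpha> where \<alpha>: "\<alpha> \<in> increasing_indices k n"
    "?t \<alpha> \<noteq> 0"
    using assms unfolding tau_def by (rule sum.not_neutral_contains_not_neutral)
  then obtain B where "B \<in> Pow K2" "(if (`) \<alpha> ` B = A then coeff B else 0) \<noteq> 0"
    by (elim sum.not_neutral_contains_not_neutral)
  then show ?thesis using that[of \<alpha> B] \<alpha>(1) by (auto split: if_splits)
qed

lemma Union_image: "\<Union>((`) f ` B) = f ` \<Union>B"
  by auto

lemma card_Union_image:
  assumes "\<alpha> \<in> increasing_indices k n" "B \<subseteq> K2"
  shows "card (\<Union>((`) \<alpha> ` B)) = card (\<Union>B)"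
  unfolding Union_image using increasing_indicesD(1)[OF assms(1)] Union_K2[OF assms(2)]
  by (intro card_image) (rule inj_on_subset)

text \<open>Only index maps whose range contains the vertices of \<open>A\<close> contribute; their
  number is what gives the power of \<open>n\<close>.\<close>

lemma tau_eq_restricted:
  "tau n A = (\<Sum>\<alpha> | \<alpha> \<in> increasing_indices k n \<and> \<Union>A \<subseteq> \<alpha> ` {1..k}.
     \<Sum>B\<in>Pow K2. if (`) \<alpha> ` B = A then coeff B else 0)"
  unfolding tau_def
proof (rule sum.mono_neutral_right)
  let ?t = "\<lambda>\<alpha>. \<Sum>B\<in>Pow K2. if (`) \<alpha> ` B = A then coeff B else 0"
  show "\<forall>\<alpha>\<in>increasing_indices k n - {\<alpha> \<in> increasing_indices k n. \<Union>A \<subseteq> \<alpha> ` {1..k}}.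
      ?t \<alpha> = 0"
  proof
    fix \<alpha> assume \<alpha>: "\<alpha> \<in> increasing_indices k n - {\<alpha> \<in> increasing_indices k n. \<Union>A \<subseteq> \<alpha> ` {1..k}}"
    have "(`) \<alpha> ` B \<noteq> A" if "B \<in> Pow K2" for B
    proof
      assume "(`) \<alpha> ` B = A"
      then have "\<Union>A = \<alpha> ` \<Union>B" using Union_image by metis
      then show False using \<alpha> Union_K2[of B] that by auto
    qed
    then show "?t \<alpha> = 0"
      by (intro sum.neutral) simp
  qed
qed (auto simp: finite_increasing_indices)

lemma abs_tau_le:
  assumes "k \<le> n" "\<Union>A \<subseteq> {1..n}" "card (\<Union>A) \<le> k"
  shows "\<bar>tau n A\<bar> \<le> coeff_bound * real n ^ (k - card (\<Union>A))"
proof -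
  let ?t = "\<lambda>\<alpha>. \<Sum>B\<in>Pow K2. if (`) \<alpha> ` B = A then coeff B else 0"
  have "\<bar>tau n A\<bar> \<le> (\<Sum>\<alpha> | \<alpha> \<in> increasing_indices k n \<and> \<Union>A \<subseteq> \<alpha> ` {1..k}. coeff_bound)"
    unfolding tau_eq_restricted
  proof (rule order_trans[OF sum_abs sum_mono])
    fix \<alpha>
    have "\<bar>?t \<alpha>\<bar>
        \<le> (\<Sum>B\<in>Pow K2. \<bar>if (`) \<alpha> ` B = A then coeff B else 0\<bar>)" by (rule sum_abs)
    also have "\<dots> \<le> coeff_bound"
      unfolding coeff_bound_def by (rule sum_mono) simp
    finally show "\<bar>?t \<alpha>\<bar> \<le> coeff_bound" .
  qed
  also have "\<dots> = coeff_bound * real ((n - card (\<Union>A)) choose (k - card (\<Union>A)))"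
    using card_increasing_indices_superset[OF assms(2,3)] by (simp add: mult.commute)
  also have "\<dots> \<le> coeff_bound * real (n ^ (k - card (\<Union>A)))"
    using choose_diff_le_pow[OF assms(1,3)] coeff_bound_nonneg by (intro mult_left_mono of_nat_mono)
  finally show ?thesis by simp
qed

text \<open>No cancellation occurs among index maps: each admissible one sees exactly one pattern
  over \<open>A\<close>, of the same shape as \<open>B\<close>, and hence contributes the same
  coefficient.\<close>

lemma tau_image:
  assumes B: "B \<subseteq> K2" and f: "inj_on f (\<Union>B)" "f ` \<Union>B \<subseteq> {1..n}"
  shows "tau n ((`) f ` B) = real ((n - card (\<Union>B)) choose (k - card (\<Union>B))) * coeff B"
proof -
  let ?A = "(`) f ` B"
  have UB: "\<Union>B \<subseteq> {1..k}" by (rule Union_K2[OF B])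
  have card_le: "card (\<Union>B) \<le> k" using card_mono[OF _ UB] by simp
  have card_A: "card (\<Union>?A) = card (\<Union>B)" unfolding Union_image by (rule card_image[OF f(1)])
  have inner: "(\<Sum>C\<in>Pow K2. if (`) \<alpha> ` C = ?A then coeff C else 0) = coeff B"
    if \<alpha>: "\<alpha> \<in> increasing_indices k n" "\<Union>?A \<subseteq> \<alpha> ` {1..k}" for \<alpha>
  proof -
    note inj = increasing_indicesD(1)[OF \<alpha>(1)]
    \<comment> \<open>The placement \<open>f\<close> is pulled back through \<open>\<alpha>\<close>;
      the pattern over the given edge set is the \<open>h\<close>-image of \<open>B\<close>, unique
      since \<open>\<alpha>\<close> is injective.\<close>
    define h where "h = inv_into {1..k} \<alpha> \<circ> f"
    have fB: "f ` \<Union>B \<subseteq> \<alpha> ` {1..k}" using \<alpha>(2) unfolding Union_image .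
    have h: "inj_on h (\<Union>B)" "h ` \<Union>B \<subseteq> {1..k}"
      using fB inj_on_subset[OF inj_on_inv_into[of "\<alpha> ` {1..k}" \<alpha> "{1..k}"] fB]
      by (auto simp: h_def intro!: comp_inj_on f(1) inv_into_into)
    let ?C = "(`) h ` B"
    have C: "?C \<subseteq> K2" by (rule image_edge[OF h B])
    have \<alpha>h: "\<alpha> (h x) = f x" if "x \<in> \<Union>B" for x
      using fB that by (auto simp: h_def intro!: f_inv_into_f)
    have img: "(`) \<alpha> ` ?C = ?A"
      unfolding image_image by (intro image_cong refl) (use \<alpha>h in auto)
    have uniq: "D = ?C" if "D \<in> Pow K2" "(`) \<alpha> ` D = (`) \<alpha> ` ?C" for D
    proof -
      have "D \<subseteq> Pow {1..k}" "?C \<subseteq> Pow {1..k}"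
        by (rule order_trans[OF _ K2_Pow], use that(1) C in simp)+
      then show ?thesis
        using inj_on_image_eq_iff[OF inj_on_image_Pow[OF inj], of D ?C] that(2) by simp
    qed
    have "(`) \<alpha> ` D = ?A \<longleftrightarrow> D = ?C" if "D \<in> Pow K2" for D
      using uniq[OF that] img by metis
    then have "(\<Sum>D\<in>Pow K2. if (`) \<alpha> ` D = ?A then coeff D else 0) = (\<Sum>D\<in>Pow K2. if D = ?C then coeff D else 0)"
      by (intro sum.cong refl) simp
    also have "\<dots> = coeff ?C" using C finite_K2 by simp
    also have "\<dots> = coeff B" by (rule coeff_image[OF B h])
    finally show ?thesis .
  qed
  have "tau n ?A = (\<Sum>\<alpha> | \<alpha> \<in> increasing_indices k n \<and> \<Union>?A \<subseteq> \<alpha> ` {1..k}. coeff B)"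
    unfolding tau_eq_restricted by (intro sum.cong refl inner) auto
  also have "\<dots> = real (card {\<alpha> \<in> increasing_indices k n. \<Union>?A \<subseteq> \<alpha> ` {1..k}}) * coeff B"
    by simp
  also have "card {\<alpha> \<in> increasing_indices k n. \<Union>?A \<subseteq> \<alpha> ` {1..k}} = (n - card (\<Union>?A)) choose (k - card (\<Union>?A))"
    by (rule card_increasing_indices_superset) (use f card_le card_A in \<open>auto simp only: Union_image\<close>)
  finally show ?thesis by (simp only: card_A)
qed

text \<open>Restricting the variance to the images of one fixed edge set bounds it from below.\<close>

lemma variance_tau_ge:
  assumes B: "B \<subseteq> K2" "B \<noteq> {}" and n: "k \<le> n" "1 \<le> n"
  defines "g \<equiv> card (\<Union>B)"
  shows "(coeff B)\<^sup>2 * (p * (1 - p)) ^ card B / (real g ^ g * (real k ^ k)\<^sup>2) * real n powr (2 * real k - real g)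
    \<le> (\<Sum>A\<in>Pow (nsets {1..n} 2) - {{}}. (tau n A)\<^sup>2 * (p * (1 - p)) ^ card A)"
proof -
  have UB: "\<Union>B \<subseteq> {1..k}" by (rule Union_K2[OF B(1)])
  have finUB: "finite (\<Union>B)" by (rule finite_subset[OF UB]) simp
  have gk: "g \<le> k" using card_mono[OF _ UB] by (simp add: g_def)
  have N: "0 < real n" using n by simp
  have "\<exists>f. bij_betw f (\<Union>B) U" if "U \<in> nsets {1..n} g" for U
    using that finite_same_card_bij[OF finUB, of U] by (auto simp: nsets_def g_def)
  then obtain F where F: "bij_betw (F U) (\<Union>B) U" if "U \<in> nsets {1..n} g" for U
    by metis
  \<comment> \<open>One placement of \<open>B\<close> is chosen on every \<open>g\<close>-subset
    \<open>U\<close>. Placements on different subsets are different edge sets because the covered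
    vertices recover \<open>U\<close>.\<close>
  define A where "A = (\<lambda>U. (\<lambda>e. F U ` e) ` B)"
  have FU: "inj_on (F U) (\<Union>B)" "F U ` \<Union>B = U" "U \<subseteq> {1..n}" if "U \<in> nsets {1..n} g" for U
    using F[OF that] that by (auto simp: bij_betw_def nsets_def)
  have UA: "\<Union>(A U) = U" if "U \<in> nsets {1..n} g" for U
    unfolding A_def Union_image by (rule FU(2)[OF that])
  have injA: "inj_on A (nsets {1..n} g)"
    by (rule inj_onI) (metis UA)
  have cardA: "card (A U) = card B" if "U \<in> nsets {1..n} g" for U
    unfolding A_def by (rule card_image[OF inj_on_edge_image[OF FU(1)[OF that]]])
  have A_sub: "A ` nsets {1..n} g \<subseteq> Pow (nsets {1..n} 2) - {{}}"
  proof
    fix D assume "D \<in> A ` nsets {1..n} g"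
    then obtain U where U: "U \<in> nsets {1..n} g" "D = A U" by auto
    have "A U \<subseteq> nsets {1..n} 2"
      unfolding A_def by (rule image_edge[OF FU(1)[OF U(1)] _ B(1)]) (use FU(2,3)[OF U(1)] in simp)
    moreover have "A U \<noteq> {}" using B(2) by (simp add: A_def)
    ultimately show "D \<in> Pow (nsets {1..n} 2) - {{}}" using U by simp
  qed
  have rearrange: "x / c * (y / d / x)\<^sup>2 * q = q / (c * d\<^sup>2) * (x * y\<^sup>2 / x\<^sup>2)" for x y c d q :: real
    by (simp add: power_divide power_mult_distrib mult_ac)
  define ch where "ch = real ((n - g) choose (k - g))"
  have tau: "tau n (A U) = ch * coeff B" if "U \<in> nsets {1..n} g" for U
    unfolding A_def ch_def g_def by (rule tau_image[OF B(1) FU(1)[OF that]]) (use FU(2,3)[OF that] in simp)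
  have "real n ^ k / real k ^ k \<le> real n ^ g * ch"
    unfolding ch_def by (rule choose_diff_ge[OF n(1) gk n(2)])
  then have "real n ^ k / real k ^ k / real n ^ g \<le> ch"
    by (simp only: pos_divide_le_eq[OF zero_less_power[OF N]] mult.commute)
  then have "(real n ^ k / real k ^ k / real n ^ g)\<^sup>2 \<le> ch\<^sup>2"
    by (rule power_mono) simp
  moreover have "real n ^ g / real g ^ g \<le> real (n choose g)"
    using binomial_ge_n_over_k_pow_k[of g n, where 'a = real] gk n by (simp add: power_divide)
  ultimately have "real n ^ g / real g ^ g * (real n ^ k / real k ^ k / real n ^ g)\<^sup>2 * ((coeff B)\<^sup>2 * (p * (1 - p)) ^ card B)
      \<le> real (n choose g) * ch\<^sup>2 * ((coeff B)\<^sup>2 * (p * (1 - p)) ^ card B)"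
    using p by (intro mult_right_mono mult_mono) auto
  also have "\<dots> = (\<Sum>U\<in>nsets {1..n} g. (tau n (A U))\<^sup>2 * (p * (1 - p)) ^ card (A U))"
    by (simp add: tau cardA power_mult_distrib mult_ac)
  also have "\<dots> = (\<Sum>D\<in>A ` nsets {1..n} g. (tau n D)\<^sup>2 * (p * (1 - p)) ^ card D)"
    by (subst sum.reindex[OF injA]) simp
  also have "\<dots> \<le> (\<Sum>D\<in>Pow (nsets {1..n} 2) - {{}}. (tau n D)\<^sup>2 * (p * (1 - p)) ^ card D)"
    using A_sub p by (intro sum_mono2) (auto simp: finite_imp_finite_nsets)
  also have "real n ^ g / real g ^ g * (real n ^ k / real k ^ k / real n ^ g)\<^sup>2 * ((coeff B)\<^sup>2 * (p * (1 - p)) ^ card B) =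
      (coeff B)\<^sup>2 * (p * (1 - p)) ^ card B / (real g ^ g * (real k ^ k)\<^sup>2) * (real n ^ g * (real n ^ k)\<^sup>2 / (real n ^ g)\<^sup>2)"
    by (rule rearrange)
  also have "real n ^ g * (real n ^ k)\<^sup>2 / (real n ^ g)\<^sup>2 = real n powr (2 * real k - real g)"
  proof -
    have "real n ^ g * (real n ^ k)\<^sup>2 / (real n ^ g)\<^sup>2 = (real n ^ k)\<^sup>2 / real n ^ g"
      using N by (simp add: power2_eq_square)
    also have "\<dots> = real n powr (2 * real k) / real n powr real g"
    proof -
      have "real n powr (2 * real k) = (real n powr real k)\<^sup>2"
        by (simp add: power2_eq_square powr_add[symmetric])
      then show ?thesis by (simp only: powr_realpow[OF N])
    qed
    finally show ?thesis by (simp add: powr_diff)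
  qed
  finally show ?thesis .
qed

text \<open>The pattern \<open>B0\<close> forces the standard deviation to be at least of order
  \<open>n powr (k - g / 2)\<close>, while a coefficient at \<open>m\<close> vertices is at most of
  order \<open>n ^ (k - m)\<close>. The quotient is the weight bound of
  \<open>graph_weights\<close>, uniformly in \<open>n \<ge> k\<close>.\<close>

lemma normal_distance_bound:
  assumes g: "2 \<le> g" "g \<le> 3" and \<theta>: "\<theta> \<le> 1"
    and B0: "B0 \<subseteq> K2" "card (\<Union>B0) = g" "coeff B0 \<noteq> 0"
    and small: "\<And>B. B \<subseteq> K2 \<Longrightarrow> B \<noteq> {} \<Longrightarrow> coeff B \<noteq> 0 \<Longrightarrow> g \<le> card (\<Union>B)"
    and ov: "\<And>n A B e S. A \<subseteq> nsets {1..n} 2 \<Longrightarrow> B \<subseteq> nsets {1..n} 2 \<Longrightarrow> tau n A \<noteq> 0 \<Longrightarrow>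
      g \<le> card (\<Union>A) \<Longrightarrow> g \<le> card (\<Union>B) \<Longrightarrow> e \<in> A \<Longrightarrow> e \<in> B \<Longrightarrow> S \<subseteq> A \<union> B - {e} \<Longrightarrow>
      (A - B) \<union> (B - A) \<subseteq> S \<Longrightarrow> S \<noteq> {} \<Longrightarrow>
      2 * real g + 2 * \<theta> \<le> real (card (\<Union>S)) + 2 * real (card (\<Union>A \<inter> \<Union>B))"
  shows "\<exists>C>0. \<forall>n\<ge>k. normal_distance (random_graph n p) (induced_count V E n) \<le> C * real n powr (- \<theta>)"
proof -
  have gk: "g \<le> k" using card_mono[OF _ Union_K2[OF B0(1)]] B0(2) by simp
  have B0_ne: "B0 \<noteq> {}" using B0(2) g by auto
  define c0 where "c0 = (coeff B0)\<^sup>2 * (p * (1 - p)) ^ card B0 / (real g ^ g * (real k ^ k)\<^sup>2)"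
  have c0: "0 < c0"
    unfolding c0_def using B0(3) p g gk by (intro divide_pos_pos mult_pos_pos) auto
  define C0 where "C0 = coeff_bound / sqrt c0"
  have C0: "0 \<le> C0" unfolding C0_def using c0 coeff_bound_nonneg by simp
  define D where "D = 2 * sqrt (variance_const k C0) + 2 * sqrt (divergence_const k p C0)"
  have bound: "normal_distance (random_graph n p) (induced_count V E n) \<le> D * real n powr (- \<theta>)" if n: "k \<le> n" for n
  proof -
    have n1: "1 \<le> n" using n gk g by simp
    then have N: "0 < real n" by simp
    let ?I = "nsets {1..n} 2"
    define s2 where "s2 = (\<Sum>A\<in>Pow ?I - {{}}. (tau n A)\<^sup>2 * (p * (1 - p)) ^ card A)"
    define \<sigma> where "\<sigma> = sqrt s2"
    \<comment> \<open>The coefficient at the empty set is the mean; removing it centres the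
      series.\<close>
    define w where "w A = (if A = {} then 0 else tau n A / \<sigma>)" for A
    have s2_ge: "c0 * real n powr (2 * real k - real g) \<le> s2"
      using variance_tau_ge[OF B0(1) B0_ne n n1] unfolding c0_def s2_def B0(2) .
    have "sqrt (c0 * real n powr (2 * real k - real g)) = sqrt c0 * real n powr (real k - real g / 2)"
    proof (rule real_sqrt_unique)
      have "(real n powr (real k - real g / 2))\<^sup>2 = real n powr (2 * real k - real g)"
        by (simp add: power2_eq_square powr_add[symmetric])
      then show "(sqrt c0 * real n powr (real k - real g / 2))\<^sup>2 = c0 * real n powr (2 * real k - real g)"
        using c0 by (simp add: power_mult_distrib)
    qed (use c0 in simp)
    then have \<sigma>_ge: "sqrt c0 * real n powr (real k - real g / 2) \<le> \<sigma>"
      unfolding \<sigma>_def using s2_ge by (metis real_sqrt_le_mono)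
    moreover have pos: "0 < sqrt c0 * real n powr (real k - real g / 2)" using c0 N by simp
    ultimately have \<sigma>: "0 < \<sigma>" by linarith
    then have s2: "0 < s2" unfolding \<sigma>_def by simp
    have \<sigma>2: "\<sigma>\<^sup>2 = s2" unfolding \<sigma>_def using s2 by simp
    have tau_props: "g \<le> card (\<Union>A) \<and> card (\<Union>A) \<le> k" if "tau n A \<noteq> 0" "A \<noteq> {}" for A
    proof -
      obtain \<alpha> B where \<alpha>B: "\<alpha> \<in> increasing_indices k n" "B \<subseteq> K2" "(`) \<alpha> ` B = A" "coeff B \<noteq> 0"
        by (rule tau_nonzeroE[OF \<open>tau n A \<noteq> 0\<close>])
      have "card (\<Union>A) = card (\<Union>B)" using card_Union_image[OF \<alpha>B(1,2)] \<alpha>B(3) by simp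
      moreover have "card (\<Union>B) \<le> k" using card_mono[OF _ Union_K2[OF \<alpha>B(2)]] by simp
      moreover have "B \<noteq> {}" using \<alpha>B(3) that(2) by auto
      ultimately show ?thesis using small[OF \<alpha>B(2) _ \<alpha>B(4)] by simp
    qed
    have w_le: "\<bar>w A\<bar> \<le> C0 * real n powr (real g / 2 - real (card (\<Union>A)))" if A: "A \<subseteq> ?I" for A
    proof (cases "A = {} \<or> tau n A = 0")
      case True
      then show ?thesis using C0 by (auto simp: w_def)
    next
      case False
      then have cA: "card (\<Union>A) \<le> k" using tau_props by auto
      have "\<Union>A \<subseteq> {1..n}" using A by (auto simp: nsets_def)
      from abs_tau_le[OF n this cA]
      have "\<bar>tau n A\<bar> \<le> coeff_bound * real n powr (real k - real (card (\<Union>A)))"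
        using N cA by (simp add: powr_realpow[symmetric] of_nat_diff)
      then have "\<bar>tau n A\<bar> / \<sigma> \<le> coeff_bound * real n powr (real k - real (card (\<Union>A))) /
          (sqrt c0 * real n powr (real k - real g / 2))"
        using \<sigma>_ge pos coeff_bound_nonneg by (intro frac_le) auto
      also have "\<dots> = C0 * (real n powr (real k - real (card (\<Union>A))) / real n powr (real k - real g / 2))"
        by (simp add: C0_def)
      also have "\<dots> = C0 * real n powr (real g / 2 - real (card (\<Union>A)))"
        by (simp add: powr_diff[symmetric])
      finally show ?thesis using False \<sigma> by (simp add: w_def)
    qed
    have "(\<Sum>A\<in>Pow ?I. (w A)\<^sup>2 * (p * (1 - p)) ^ card A) = (\<Sum>A\<in>Pow ?I - {{}}. (w A)\<^sup>2 * (p * (1 - p)) ^ card A)"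
      by (intro sum.mono_neutral_right) (auto simp: w_def finite_imp_finite_nsets)
    also have "\<dots> = (\<Sum>A\<in>Pow ?I - {{}}. (tau n A)\<^sup>2 * (p * (1 - p)) ^ card A / s2)"
      by (intro sum.cong refl) (auto simp: w_def power_divide \<sigma>2)
    also have "\<dots> = 1"
      unfolding sum_divide_distrib[symmetric] s2_def[symmetric] using s2 by simp
    finally have norm: "(\<Sum>A\<in>Pow ?I. (w A)\<^sup>2 * (p * (1 - p)) ^ card A) = 1" .
    interpret GW: graph_weights n k g p C0 \<theta> w
    proof
      fix A assume "A \<subseteq> ?I" "w A \<noteq> 0"
      then have "tau n A \<noteq> 0" "A \<noteq> {}" by (auto simp: w_def split: if_splits)
      then show "g \<le> card (\<Union>A) \<and> card (\<Union>A) \<le> k" by (rule tau_props)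
    next
      fix A B e S
      assume AB: "A \<subseteq> ?I" "B \<subseteq> ?I" "w A \<noteq> 0" "w B \<noteq> 0" and rest: "e \<in> A" "e \<in> B"
        "S \<subseteq> A \<union> B - {e}" "(A - B) \<union> (B - A) \<subseteq> S" "S \<noteq> {}"
      have nz: "tau n A \<noteq> 0" "A \<noteq> {}" "tau n B \<noteq> 0" "B \<noteq> {}"
        using AB(3,4) by (auto simp: w_def split: if_splits)
      show "2 * real g + 2 * \<theta> \<le> real (card (\<Union>S)) + 2 * real (card (\<Union>A \<inter> \<Union>B))"
        by (rule ov[OF AB(1,2) nz(1) _ _ rest]) (use tau_props nz in auto)
    qed (use p n1 g C0 w_le norm in auto)
    let ?T = "induced_count V E n"
    have M: "random_graph n p = GW.M" by (simp add: random_graph_def)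
    have T: "?T = GW.walsh (tau n)" by (rule induced_count_eq_walsh)
    have ET: "GW.expect ?T = tau n {}" unfolding T by (rule GW.expect_walsh)
    have centred: "?T v - tau n {} = \<sigma> * GW.walsh w v" for v
    proof -
      have "?T v = tau n {} * GW.chi {} v + (\<Sum>A\<in>Pow ?I - {{}}. tau n A * GW.chi A v)"
        unfolding T GW.walsh_def by (rule sum.remove) (auto simp: finite_imp_finite_nsets)
      moreover have "(\<Sum>A\<in>Pow ?I - {{}}. tau n A * GW.chi A v) = (\<Sum>A\<in>Pow ?I - {{}}. \<sigma> * (w A * GW.chi A v))"
        using \<sigma> by (intro sum.cong refl) (simp add: w_def)
      moreover have "\<dots> = (\<Sum>A\<in>Pow ?I. \<sigma> * (w A * GW.chi A v))"
        by (intro sum.mono_neutral_left) (auto simp: w_def finite_imp_finite_nsets)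
      ultimately show ?thesis by (simp add: GW.walsh_def sum_distrib_left)
    qed
    have "GW.expect (\<lambda>v. (?T v - tau n {})\<^sup>2) = \<sigma>\<^sup>2 * GW.expect (\<lambda>v. (GW.walsh w v)\<^sup>2)"
      unfolding centred power_mult_distrib by (rule integral_mult_right_zero)
    also have "\<dots> = \<sigma>\<^sup>2"
      using norm by (simp add: GW.expect_walsh_square GW.var1_def)
    finally have Var: "sqrt (GW.expect (\<lambda>v. (?T v - GW.expect ?T)\<^sup>2)) = \<sigma>"
      unfolding ET using \<sigma> by simp
    have "normal_distance (random_graph n p) ?T = (SUP z. \<bar>measure_pmf.prob GW.M {v. GW.walsh w v \<le> z} - Phi z\<bar>)"
      unfolding normal_distance_def M Var unfolding ET centred using \<sigma> by simp
    also have "\<dots> \<le> D * real n powr (- \<theta>)"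
      unfolding D_def by (rule cSUP_least) (use GW.walsh_kolmogorov_bound[OF \<theta>] in auto)
    finally show ?thesis .
  qed
  have "0 \<le> D"
  proof -
    have "0 \<le> variance_const k C0" by (simp add: variance_const_def edge_set_const_nonneg)
    moreover have "0 \<le> divergence_const k p C0"
      using p by (intro divergence_const_nonneg) auto
    ultimately show ?thesis by (simp add: D_def)
  qed
  \<comment> \<open>The constant is increased by 1 because strict positivity is required.\<close>
  have "normal_distance (random_graph n p) (induced_count V E n) \<le> (D + 1) * real n powr (- \<theta>)" if "k \<le> n" for n
    by (rule order_trans[OF bound[OF that]]) (intro mult_right_mono, auto)
  then show ?thesis using \<open>0 \<le> D\<close> by (intro exI[of _ "D + 1"]) auto
qed

section \<open>The three cases\<close>

lemma edge_count_small: "k < 2 \<Longrightarrow> card E = 0"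
  using E_subset nsets_eq_empty[OF finite_V, of 2] by simp

text \<open>With too few vertices both sides of the conditions vanish, so (G2) and (G3) force
  \<open>k\<close> to be at least 3.\<close>

lemma two_star_count_small:
  assumes "k < 3"
  shows "two_star_count V E = 0" "triangle_count V E = 0"
proof -
  have "card (triples V) = 0"
    using card_triples(2)[OF finite_V] assms by (simp add: binomial_eq_0)
  then have "triples V = {}"
    using finite_triples[OF finite_V] by simp
  then have "ordered_two_stars V E = {}" "ordered_triangles V E = {}"
    by (auto simp: ordered_two_stars_def ordered_triangles_def)
  then show "two_star_count V E = 0" "triangle_count V E = 0"
    using card_ordered_two_stars[OF graph] card_ordered_triangles[OF graph] by auto
qed

lemma two_le_card_Union: "B \<subseteq> nsets {1..m :: nat} 2 \<Longrightarrow> B \<noteq> {} \<Longrightarrow> 2 \<le> card (\<Union>B)"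
proof -
  assume B: "B \<subseteq> nsets {1..m} 2" "B \<noteq> {}"
  then obtain e where e: "e \<in> B" by auto
  have "finite (\<Union>B)"
    by (rule finite_subset[of _ "{1..m}"]) (use B in \<open>auto simp: nsets_def\<close>)
  then have "card e \<le> card (\<Union>B)" using e by (intro card_mono) auto
  then show ?thesis using e B(1) by (auto simp: nsets_def)
qed

text \<open>A nonempty edge set on two vertices is a single edge, and single edges have coefficient
  zero under the hypothesis.\<close>

lemma three_le_card_Union:
  assumes e: "real (card E) = p * real (k choose 2)" and B: "B \<subseteq> K2" "B \<noteq> {}" "coeff B \<noteq> 0"
  shows "3 \<le> card (\<Union>B)"
proof (rule ccontr)
  assume "\<not> 3 \<le> card (\<Union>B)"
  then have card: "card (\<Union>B) = 2" using two_le_card_Union[OF B(1,2)] by simp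
  have fin: "finite (\<Union>B)" by (rule finite_subset[OF Union_K2[OF B(1)]]) simp
  have "b = \<Union>B" if "b \<in> B" for b
    using card_subset_eq[OF fin, of b] that B(1) card by (auto simp: nsets_def)
  then have "B = {\<Union>B}" using B(2) by blast
  moreover obtain x y where "\<Union>B = {x, y}" "x \<noteq> y" using card by (auto simp: card_2_iff)
  ultimately have xy: "B = {{x, y}}" "x \<noteq> y" by auto
  then show False
    using coeff_edge_eq_0_iff[of x y] B(1,3) e by simp
qed

text \<open>A contributing pattern, pulled back along the index map, is itself a 2-star on
  \<open>{1..k}\<close>, whose coefficient vanishes.\<close>

lemma tau_two_star_eq_0:
  assumes e: "real (card E) = p * real (k choose 2)"
    and s: "real (two_star_count V E) = 3 * p\<^sup>2 * real (k choose 3)"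
    and xyz: "x \<noteq> y" "y \<noteq> z" "x \<noteq> z"
  shows "tau n {{x, y}, {y, z}} = 0"
proof (rule ccontr)
  assume "tau n {{x, y}, {y, z}} \<noteq> 0"
  then obtain \<alpha> B where \<alpha>B: "\<alpha> \<in> increasing_indices k n" "B \<subseteq> K2"
    "(`) \<alpha> ` B = {{x, y}, {y, z}}" "coeff B \<noteq> 0"
    by (rule tau_nonzeroE)
  note inj = increasing_indicesD(1)[OF \<alpha>B(1)]
  let ?h = "inv_into {1..k} \<alpha>"
  have "\<Union>{{x, y}, {y, z}} = \<alpha> ` \<Union>B" unfolding \<alpha>B(3)[symmetric] by (rule Union_image)
  moreover have "\<Union>{{x, y}, {y, z}} = {x, y, z}" by auto
  ultimately have "{x, y, z} \<subseteq> \<alpha> ` {1..k}" using image_mono[OF Union_K2[OF \<alpha>B(2)], of \<alpha>] by simp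
  then have h: "?h x \<in> {1..k}" "?h y \<in> {1..k}" "?h z \<in> {1..k}" "?h x \<noteq> ?h y" "?h y \<noteq> ?h z" "?h x \<noteq> ?h z"
    using xyz by (auto simp only: inv_into_f_f[OF inj] insert_subset)
  have "B = (`) ?h ` (`) \<alpha> ` B"
  proof -
    have "?h ` \<alpha> ` b = b" if "b \<in> B" for b
      using inv_into_image_cancel[OF inj, of b] Union_K2[OF \<alpha>B(2)] that by auto
    then show ?thesis by (simp add: image_image)
  qed
  then have "B = {{?h x, ?h y}, {?h y, ?h z}}" unfolding \<alpha>B(3) by simp
  moreover have "(?h x, ?h y, ?h z) \<in> D3" using h by (simp add: triples_def)
  ultimately show False
    using coeff_two_star_eq_0_iff[OF e] s \<alpha>B(4) by simp
qed

end

theorem theorem3p4: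
  fixes V :: "'a set" and E :: "'a set set" and p :: real
  assumes "0 < p" and "p < 1" and "simple_graph V E"
  defines "G1 \<equiv> real (card E) \<noteq> p * real (card V choose 2)"
    and "G2 \<equiv> real (card E) = p * real (card V choose 2) \<and>
               real (two_star_count V E) \<noteq> 3 * p\<^sup>2 * real (card V choose 3)"
    and "G3 \<equiv> real (card E) = p * real (card V choose 2) \<and>
               real (two_star_count V E) = 3 * p\<^sup>2 * real (card V choose 3) \<and>
               real (triangle_count V E) \<noteq> p ^ 3 * real (card V choose 3)"
  shows "(G1 \<or> G3 \<longrightarrow> (\<exists>C>0. \<forall>n\<ge>card V.
            normal_distance (random_graph n p) (induced_count V E n) \<le> C * real n powr (-1))) \<and>
         (G2 \<longrightarrow> (\<exists>C>0. \<forall>n\<ge>card V.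
            normal_distance (random_graph n p) (induced_count V E n) \<le> C * real n powr (-1/2)))"
proof -
  interpret random_graph_count V E p
    by unfold_locales (use assms in auto)
  have "\<exists>C>0. \<forall>n\<ge>k. normal_distance (random_graph n p) (induced_count V E n) \<le> C * real n powr (- 1)" if G1
  proof (rule normal_distance_bound[where g = 2 and ?B0.0 = "{{1, 2}}"])
    have k: "2 \<le> k"
    proof (rule ccontr)
      assume "\<not> 2 \<le> k"
      then show False using that edge_count_small by (simp add: G1_def binomial_eq_0)
    qed
    then show "{{1, 2}} \<subseteq> K2" "coeff {{1, 2}} \<noteq> 0"
      using coeff_edge_eq_0_iff[of 1 2] that by (auto simp: G1_def)
    show "2 \<le> card (\<Union>B)" if "B \<subseteq> K2" "B \<noteq> {}" for B by (rule two_le_card_Union[OF that])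
    fix n :: nat and A B e S
    assume "A \<subseteq> nsets {1..n} 2" "B \<subseteq> nsets {1..n} 2" "e \<in> A" "e \<in> B" "S \<subseteq> A \<union> B - {e}" "S \<noteq> {}"
    then have "2 \<le> card (\<Union>S)" "2 \<le> card (\<Union>A \<inter> \<Union>B)"
      using overlap_ge_2[of "{1..n}" A B e S] finite_atLeastAtMost[of 1 n] by blast+
    \<comment> \<open>Here 6 = 2g + 2 theta with g = 2 and theta = 1: two vertices of
      \<open>S\<close> plus twice the two vertices of the common edge.\<close>
    then have "real 6 \<le> real (card (\<Union>S) + 2 * card (\<Union>A \<inter> \<Union>B))" by (intro of_nat_mono) simp
    then show "2 * real 2 + 2 * 1 \<le> real (card (\<Union>S)) + 2 * real (card (\<Union>A \<inter> \<Union>B))" by simp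
  qed auto
  moreover have "\<exists>C>0. \<forall>n\<ge>k. normal_distance (random_graph n p) (induced_count V E n) \<le> C * real n powr (- (1 / 2))" if G2
  proof (rule normal_distance_bound[where g = 3 and ?B0.0 = "{{1, 2}, {2, 3}}"])
    have e: "real (card E) = p * real (k choose 2)" using that by (simp add: G2_def)
    have k: "3 \<le> k"
    proof (rule ccontr)
      assume "\<not> 3 \<le> k"
      then show False using that two_star_count_small by (simp add: G2_def binomial_eq_0)
    qed
    then have "(1, 2, 3) \<in> D3" by (simp add: triples_def)
    then show "coeff {{1, 2}, {2, 3}} \<noteq> 0"
      using coeff_two_star_eq_0_iff[OF e] that by (simp add: G2_def)
    show "{{1, 2}, {2, 3}} \<subseteq> K2" using k by auto
    have "\<Union>{{1, 2}, {2, 3}} = {1, 2, 3 :: nat}" by auto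
    then show "card (\<Union>{{1, 2}, {2, 3 :: nat}}) = 3" by simp
    show "3 \<le> card (\<Union>B)" if "B \<subseteq> K2" "B \<noteq> {}" "coeff B \<noteq> 0" for B
      by (rule three_le_card_Union[OF e that])
    fix n :: nat and A B e S
    assume "A \<subseteq> nsets {1..n} 2" "B \<subseteq> nsets {1..n} 2" "e \<in> A" "e \<in> B" "S \<subseteq> A \<union> B - {e}"
      "(A - B) \<union> (B - A) \<subseteq> S" "S \<noteq> {}" "3 \<le> card (\<Union>A)" "3 \<le> card (\<Union>B)"
    then have "7 \<le> card (\<Union>S) + 2 * card (\<Union>A \<inter> \<Union>B)"
      by (intro overlap_three_vertices(1)[OF finite_atLeastAtMost])
    \<comment> \<open>7 = 2g + 2 theta with g = 3 and theta = 1/2; this is the case in which 2-stars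
      limit the rate.\<close>
    then have "real 7 \<le> real (card (\<Union>S) + 2 * card (\<Union>A \<inter> \<Union>B))" by (rule of_nat_mono)
    then show "2 * real 3 + 2 * (1 / 2) \<le> real (card (\<Union>S)) + 2 * real (card (\<Union>A \<inter> \<Union>B))" by simp
  qed auto
  moreover have "\<exists>C>0. \<forall>n\<ge>k. normal_distance (random_graph n p) (induced_count V E n) \<le> C * real n powr (- 1)" if G3
  proof (rule normal_distance_bound[where g = 3 and ?B0.0 = "{{1, 2}, {2, 3}, {1, 3}}"])
    have e: "real (card E) = p * real (k choose 2)"
      and s: "real (two_star_count V E) = 3 * p\<^sup>2 * real (k choose 3)" using that by (simp_all add: G3_def)
    have k: "3 \<le> k"
    proof (rule ccontr)
      assume "\<not> 3 \<le> k"
      then show False using that two_star_count_small by (simp add: G3_def binomial_eq_0)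
    qed
    then have "(1, 2, 3) \<in> D3" by (simp add: triples_def)
    then show "coeff {{1, 2}, {2, 3}, {1, 3}} \<noteq> 0"
      using coeff_triangle_eq_0_iff[OF e s] that by (simp add: G3_def)
    show "{{1, 2}, {2, 3}, {1, 3}} \<subseteq> K2" using k by auto
    have "\<Union>{{1, 2}, {2, 3}, {1, 3}} = {1, 2, 3 :: nat}" by auto
    then show "card (\<Union>{{1, 2}, {2, 3}, {1, 3 :: nat}}) = 3" by simp
    show "3 \<le> card (\<Union>B)" if "B \<subseteq> K2" "B \<noteq> {}" "coeff B \<noteq> 0" for B
      by (rule three_le_card_Union[OF e that])
    fix n A B f S
    assume AB: "A \<subseteq> nsets {1..n} 2" "B \<subseteq> nsets {1..n} 2" "tau n A \<noteq> 0" "f \<in> A" "f \<in> B" "S \<subseteq> A \<union> B - {f}"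
      "(A - B) \<union> (B - A) \<subseteq> S" "S \<noteq> {}" "3 \<le> card (\<Union>A)" "3 \<le> card (\<Union>B)"
    \<comment> \<open>The vanishing of the 2-star weights excludes the configuration responsible for
      the value 7, so theta = 1 is available.\<close>
    have "A \<noteq> {{x, y}, {y, z}}" if "x \<noteq> y" "y \<noteq> z" "x \<noteq> z" for x y z
      using tau_two_star_eq_0[OF e s that] AB(3) by auto
    then have "8 \<le> card (\<Union>S) + 2 * card (\<Union>A \<inter> \<Union>B)"
      by (rule overlap_three_vertices(2)[OF finite_atLeastAtMost AB(1,2,4-10)])
    then have "real 8 \<le> real (card (\<Union>S) + 2 * card (\<Union>A \<inter> \<Union>B))" by (rule of_nat_mono)
    then show "2 * real 3 + 2 * 1 \<le> real (card (\<Union>S)) + 2 * real (card (\<Union>A \<inter> \<Union>B))" by simp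
  qed auto
  ultimately show ?thesis by auto
qed

end
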